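(* Let $(T_n)_{n\in\mathbb{N}}$ be a BST sequence. For $k\in\mathbb{N}$ fixed and with $n\to\infty$, $$\begin{pmatrix}\Delta_kY^\circ(T_n)\\ \eta^\circ(T_n)\end{pmatrix}\to_{\mathcal{D}}\begin{pmatrix}2^{-k}(k1_k+\rho_k+\eta_k-\eta^\circ_\infty1_k)\\ \eta^\circ_\infty\end{pmatrix}.$$ Here $1_k$ is the $2^k$-dimensional vector with all entries equal to $1$, and $\rho_k=(\rho_{k,1},\ldots,\rho_{k,2^k})$ and $\eta_k=(\eta_{k,1},\ldots,\eta_{k,2^k})$ are independent $2^k$-dimensional random vectors, given (distributionally) as follows. The components $\eta_{k,j}$ of $\eta_k$ are independent and each $\eta_{k,j}$ has the same distribution as $\eta_\infty$. The components $\rho_{k,j}$ of $\rho_k$ have the joint (in $j=1,\ldots,2^k$) distributional representation $$\rho_{k,j}=_{\mathcal{D}}\sum_{\{l:\,u_l(k,j)=1\}}\log\xi_{u(k,j,l-1)}+\sum_{\{l:\,u_l(k,j)=0\}}\log\bigl(1-\xi_{u(k,j,l-1)}\bigr),$$ where $l$ ranges over $\{1,\ldots,k\}$ and $\xi_u$, $u\in\mathcal{N}$, is a family of independent random variables, all uniformly distributed on the unit interval. Finally, $$\eta^\circ_\infty=2^{-k}\sum_{j=1}^{2^k}(k+\rho_{k,j}+\eta_{k,j}).$$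
   Context: $=_{\mathcal{D}}$ and $\to_{\mathcal{D}}$ denote equality and convergence in distribution. Nodes are the finite words over $\{0,1\}$, i.e. elements of $\mathcal{N}:=\bigcup_{k\ge 0}\{0,1\}^k$, including the empty word (the root). A binary tree is a finite, prefix-stable set $T\subset\mathcal{N}$: if $(u_1,\ldots,u_k)\in T$ with $k\ge1$, then $(u_1,\ldots,u_{k-1})\in T$. $\#T$ is the number of nodes of $T$. BST sequence: let $(\xi_n)_{n\in\mathbb{N}}$ be independent random variables, uniformly distributed on the unit interval. $T_1$ consists only of the root, with label $\xi_1$. Given $T_n$ with its labels, $T_{n+1}$ is obtained as follows: start at the root; at a node $u\in T_n$ move to $(u,0)$ (left) if $\xi_{n+1}$ is smaller than the label of $u$ and to $(u,1)$ (right) if it is greater; the first node reached that is not in $T_n$ is added to the tree and receives the label $\xi_{n+1}$. The sequence $(T_n)_{n\in\mathbb{N}}$ of random binary trees (with labels ignored) is called a BST sequence. Silhouette: each $s\in[0,1]$ has a binary expansion $s=\sum_{k\ge1}u_k2^{-k}$, $u_k\in\{0,1\}$, made unique by requiring that for binary rationals $s<1$ one has $u_k=0$ for all sufficiently large $k$ (for $s=1$ all $u_k=1$). For a binary tree $T$ put $X_s(T):=\min\{k\in\mathbb{N}_0:(u_1,\ldots,u_k)\notin T\}$. Integrated silhouette: $Y_t(T):=\int_0^tX_s(T)\,ds$ and $Y^\circ_t(T):=Y_t(T)-tY_1(T)$ for $t\in[0,1]$, $Y^\circ(T)=(Y^\circ_t(T))_{0\le t\le1}$. Further $\eta(T):=Y_1(T)=\int_0^1X_s(T)\,ds$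 and $\eta^\circ(T):=\eta(T)-H(\#T)$, with $H(n)=H_n=\sum_{i=1}^n1/i$, $H(0)=0$. For $k\in\mathbb{N}$ and $f:[0,1]\to\mathbb{R}$, $\Delta_kf\in\mathbb{R}^{2^k}$ has components $(\Delta_kf)_j:=f(j2^{-k})-f((j-1)2^{-k})$, $j=1,\ldots,2^k$. The nodes of depth $k$ are $u(k,j)=(u_1(k,j),\ldots,u_k(k,j))\in\{0,1\}^k$, $j=1,\ldots,2^k$, in the order of their associated binary rationals, i.e. $u_m(k,j)=\lfloor2^{-k+m}(j-1)\rfloor\pmod 2$. For $l=0,\ldots,k-1$, $u(k,j,l):=(u_1(k,j),\ldots,u_l(k,j))$ is the ancestor of $u(k,j)$ at depth $l$, with $u(k,j,0)$ the empty word. $\eta_\infty$ denotes a random variable with the unique distribution having zero mean and finite second moment that satisfies $\eta_\infty=_{\mathcal{D}}\frac12(\eta_\infty+\eta'_\infty)+\zeta_\infty$, where $\eta_\infty,\eta'_\infty,\zeta_\infty$ on the right are independent, $\eta'_\infty=_{\mathcal{D}}\eta_\infty$, and $\zeta_\infty=1+\frac12(\log(\xi)+\log(1-\xi))$ with $\xi$ uniform on the unit interval. *)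

theory Defs
  imports "HOL-Probability.Probability"
begin

text \<open>Nodes are words over \<open>{0,1}\<close>, encoded with \<open>False\<close> for 0 (left) and \<open>True\<close> for 1 (right).
  Index sets of sequences start at 1, except where noted.\<close>

type_synonym node = "bool list"

definition indep_uniform :: "'a measure \<Rightarrow> ('i \<Rightarrow> 'a \<Rightarrow> real) \<Rightarrow> 'i set \<Rightarrow> bool" where
  "indep_uniform M \<xi> I \<longleftrightarrow> prob_space M \<and> prob_space.indep_vars M (\<lambda>_. borel) \<xi> I \<and>
     (\<forall>i\<in>I. distr M borel (\<xi> i) = uniform_measure lborel {0..1})"

text \<open>A labelled tree is the partial map from its nodes to their labels.
  \<open>bst_walk L x m\<close> is the node reached after \<open>m\<close> steps from the root; it is only meaningful up to
  the first node outside the tree.  A tie goes left, which for independent uniform labels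
  happens with probability zero.\<close>

primrec bst_walk :: "(node \<rightharpoonup> real) \<Rightarrow> real \<Rightarrow> nat \<Rightarrow> node" where
  "bst_walk L x 0 = []"
| "bst_walk L x (Suc m) = bst_walk L x m @ [the (L (bst_walk L x m)) < x]"

definition bst_insert :: "real \<Rightarrow> (node \<rightharpoonup> real) \<Rightarrow> (node \<rightharpoonup> real)" where
  "bst_insert x L = L(bst_walk L x (LEAST m. bst_walk L x m \<notin> dom L) \<mapsto> x)"

text \<open>Starting from the empty tree at time 0, the tree at time 1 is the root with label \<open>x 1\<close>.\<close>

primrec bst_labelled :: "(nat \<Rightarrow> real) \<Rightarrow> nat \<Rightarrow> (node \<rightharpoonup> real)" where
  "bst_labelled x 0 = Map.empty"
| "bst_labelled x (Suc n) = bst_insert (x (Suc n)) (bst_labelled x n)"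

definition bst_sequence :: "'a measure \<Rightarrow> (nat \<Rightarrow> 'a \<Rightarrow> node set) \<Rightarrow> bool" where
  "bst_sequence M T \<longleftrightarrow> (\<exists>\<xi>. indep_uniform M \<xi> {1..} \<and>
     (\<forall>n\<ge>1. \<forall>\<omega>\<in>space M. T n \<omega> = dom (bst_labelled (\<lambda>i. \<xi> i \<omega>) n)))"

text \<open>Here \<open>u i\<close> is the binary digit with weight \<open>2^-(i+1)\<close>, so that
  the word formed by the first \<open>k\<close> digits is \<open>map u [0..<k]\<close>.\<close>

definition binary_expansion :: "real \<Rightarrow> (nat \<Rightarrow> bool) \<Rightarrow> bool" where
  "binary_expansion s u \<longleftrightarrow>
     (\<lambda>i. of_bool (u i) / 2 ^ Suc i) sums s \<and>
     (s < 1 \<and> (\<exists>(a::nat) (m::nat). s = real a / 2 ^ m) \<longrightarrow> (\<forall>\<^sub>F i in sequentially. \<not> u i)) \<and>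
     (s = 1 \<longrightarrow> (\<forall>i. u i))"

definition binary_digits :: "real \<Rightarrow> nat \<Rightarrow> bool" where
  "binary_digits s = (THE u. binary_expansion s u)"

definition silhouette :: "real \<Rightarrow> node set \<Rightarrow> nat" where
  "silhouette s T = (LEAST k. map (binary_digits s) [0..<k] \<notin> T)"

definition int_silhouette :: "node set \<Rightarrow> real \<Rightarrow> real" where
  "int_silhouette T t = integral {0..t} (\<lambda>s. real (silhouette s T))"

definition centred_int_silhouette :: "node set \<Rightarrow> real \<Rightarrow> real" where
  "centred_int_silhouette T t = int_silhouette T t - t * int_silhouette T 1"

definition eta :: "node set \<Rightarrow> real" where
  "eta T = int_silhouette T 1"

definition eta_circ :: "node set \<Rightarrow> real" where
  "eta_circ T = eta T - harm (card T)"

definition Delta :: "nat \<Rightarrow> (real \<Rightarrow> real) \<Rightarrow> nat \<Rightarrow> real" where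
  "Delta k f j = f (real j / 2 ^ k) - f ((real j - 1) / 2 ^ k)"

definition zeta_infty :: "real \<Rightarrow> real" where
  "zeta_infty x = 1 + (ln x + ln (1 - x)) / 2"

definition is_eta_infty_law :: "real measure \<Rightarrow> bool" where
  "is_eta_infty_law \<mu> \<longleftrightarrow>
     prob_space \<mu> \<and> sets \<mu> = sets borel \<and>
     integrable \<mu> (\<lambda>x. x\<^sup>2) \<and> (LINT x|\<mu>. x) = 0 \<and>
     \<mu> = distr (\<mu> \<Otimes>\<^sub>M (\<mu> \<Otimes>\<^sub>M uniform_measure lborel {0..1})) borel
            (\<lambda>(x, y, z). (x + y) / 2 + zeta_infty z)"

definition eta_infty_law :: "real measure" where
  "eta_infty_law = (THE \<mu>. is_eta_infty_law \<mu>)"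

definition node_bit :: "nat \<Rightarrow> nat \<Rightarrow> nat \<Rightarrow> bool" where
  "node_bit k j m \<longleftrightarrow> \<lfloor>2 powi (int m - int k) * (real j - 1)\<rfloor> mod 2 = 1"

definition ancestor :: "nat \<Rightarrow> nat \<Rightarrow> nat \<Rightarrow> node" where
  "ancestor k j l = map (node_bit k j) [1..<Suc l]"

definition rho_rep :: "nat \<Rightarrow> (node \<Rightarrow> real) \<Rightarrow> nat \<Rightarrow> real" where
  "rho_rep k x j =
     (\<Sum>l | l \<in> {1..k} \<and> node_bit k j l. ln (x (ancestor k j (l - 1)))) +
     (\<Sum>l | l \<in> {1..k} \<and> \<not> node_bit k j l. ln (1 - x (ancestor k j (l - 1))))"

text \<open>Vectors of dimension \<open>d\<close> are functions on \<open>{1..d}\<close>, extended by \<open>undefined\<close>;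
  the \<open>\<sigma>\<close>-algebra is \<open>borel_vec d\<close> and the topology is \<open>powertop_real {1..d}\<close>.\<close>

abbreviation borel_vec :: "nat \<Rightarrow> (nat \<Rightarrow> real) measure" where
  "borel_vec d \<equiv> (\<Pi>\<^sub>M i\<in>{1..d}. borel)"

definition rvec :: "nat \<Rightarrow> (nat \<Rightarrow> real) \<Rightarrow> nat \<Rightarrow> real" where
  "rvec d v = (\<lambda>i\<in>{1..d}. v i)"

text \<open>The vector of dimension \<open>d + 1\<close> with the additional last component \<open>x\<close>.\<close>

definition stack :: "nat \<Rightarrow> (nat \<Rightarrow> real) \<Rightarrow> real \<Rightarrow> nat \<Rightarrow> real" where
  "stack d v x = rvec (d + 1) (\<lambda>i. if i \<le> d then v i else x)"

definition conv_in_distr ::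
  "nat \<Rightarrow> 'a measure \<Rightarrow> (nat \<Rightarrow> 'a \<Rightarrow> nat \<Rightarrow> real) \<Rightarrow> 'b measure \<Rightarrow> ('b \<Rightarrow> nat \<Rightarrow> real) \<Rightarrow> bool" where
  "conv_in_distr d M X N Z \<longleftrightarrow>
     (\<forall>n\<ge>1. X n \<in> M \<rightarrow>\<^sub>M borel_vec d) \<and> Z \<in> N \<rightarrow>\<^sub>M borel_vec d \<and>
     (\<forall>g. continuous_map (powertop_real {1..d}) euclideanreal g \<and>
          bounded (g ` topspace (powertop_real {1..d})) \<longrightarrow>
          (\<lambda>n. LINT \<omega>|M. g (X n \<omega>)) \<longlonglongrightarrow> (LINT \<omega>|N. g (Z \<omega>)))"

end

theory Submission
  imports Defs "HOL-Real_Asymp.Real_Asymp"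
begin

text \<open>Only the mean heights of the silhouette over dyadic intervals enter the theorem. For a word \<open>w\<close>,
  let \<open>B w T\<close> (\<open>cell_mean\<close>) be the average of \<open>X_s(T)\<close> over the dyadic interval of all \<open>s\<close> whose
  expansion begins with \<open>w\<close>. The components of \<open>\<Delta>_k Y\<degree>(T)\<close> are \<open>(B w T - B [] T) / 2^k\<close> for the \<open>2^k\<close>
  words \<open>w\<close> of length \<open>k\<close>, and \<open>\<eta>(T) = B [] T\<close>. If the root of \<open>T\<close> has subtrees \<open>L\<close> and \<open>R\<close>, then
  \<open>B [] T = 1 + (B [] L + B [] R) / 2\<close>, and \<open>B (b # w) T\<close> is \<open>1 + B w R\<close> or \<open>1 + B w L\<close>, depending on
  \<open>b\<close>.

  The shape of the search tree of a list is determined by splitting the list at its first element. For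
  independent uniform labels the two subtrees are therefore, given their sizes, independent and of the
  same kind, and the size of either one is uniform on \<open>{0..n}\<close> if the tree has \<open>n + 1\<close> nodes. A sequence
  of trees with the same one-dimensional marginal laws, \<open>random_tree n\<close>, is built on a space that
  carries an independent uniform stream at every node: the head \<open>p\<close> of the stream at a node is the
  probability with which each of the other elements below that node goes to the right, and the tail
  decides for the elements one by one. Since only the law of each single tree matters for convergence in
  distribution, all limits can be taken on this space (\<open>bst_sequence_law\<close>).

  There, the limit of \<open>B [] (random_tree n) - H n\<close> is explicit: it is \<open>\<Sum> 2^-|u| \<zeta>(p_u)\<close> over all nodes
  \<open>u\<close> (\<open>eta_limit\<close>), where \<open>\<zeta>\<close> is \<open>zeta_infty\<close>. This series satisfies the recursion that defines the law
  of \<open>\<eta>_\<infinity>\<close>, and that law is unique because the distance \<open>d t\<close> of two characteristic functions that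
  satisfy the recursion obeys both \<open>d t \<le> 2 d (t / 2)\<close> and \<open>d t = O(t^2)\<close> (\<open>is_eta_infty_law_unique\<close>).
  The differences between \<open>B [] (random_tree n) - H n\<close> and the limit have mean zero, so the errors in
  the two subtrees are orthogonal and their second moments \<open>e n\<close> satisfy
  \<open>e (n + 1) \<le> (1/2) (average of e 0, ..., e n) + H (n + 1) / (n + 1)\<close>, whence \<open>e n \<longlonglongrightarrow> 0\<close>. The last term
  bounds the second moment of the error made by replacing \<open>H i - H (n + 1)\<close> by \<open>ln p\<close>, where \<open>i\<close> is the
  size of the right subtree; it is computed exactly in \<open>root_mean_harm_ln\<close>.

  If \<open>b\<close> is a step to the right, the limit of \<open>B (b # w) (random_tree n) - H n\<close> is \<open>1 + ln p\<close> plus the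
  limit for \<open>w\<close> in the right subtree; for a step to the left, \<open>p\<close> is replaced by \<open>1 - p\<close> and the left
  subtree is taken. In both cases the truncated mean square error is at most twice the average of those
  for \<open>w\<close> and all smaller sizes plus twice the same logarithmic term (\<open>gap_size_Cons\<close>). Unwinding the
  recursion gives \<open>k + \<rho> + \<eta>\<close> for words of length \<open>k\<close>. The vectors thus converge in probability. The
  expectations of bounded continuous functions converge as well, because every subsequence of the
  vectors has a further subsequence that converges almost surely.\<close>

section \<open>The integrated silhouette as a sum over nodes\<close>

text \<open>Finite prefix-stable sets of nodes; the empty set is included.\<close>

definition binary_tree :: "node set \<Rightarrow> bool" where
  "binary_tree T \<longleftrightarrow> finite T \<and> (\<forall>u b. u @ [b] \<in> T \<longrightarrow> u \<in> T)"

text \<open>The points whose binary expansion begins with the word \<open>u\<close> form, apart from the point \<open>1\<close>, the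
  half-open interval \<open>cell u\<close> from \<open>cell_left u\<close> to \<open>cell_right u\<close>, of length \<open>2^-|u|\<close>.\<close>

primrec cell_left :: "node \<Rightarrow> real" where
  "cell_left [] = 0"
| "cell_left (b # u) = (of_bool b + cell_left u) / 2"

definition cell_right :: "node \<Rightarrow> real" where
  "cell_right u = cell_left u + 1 / 2 ^ length u"

definition cell :: "node \<Rightarrow> real set" where
  "cell u = {cell_left u..<cell_right u}"

lemma cell_right_simps: "cell_right [] = 1" "cell_right (b # u) = (of_bool b + cell_right u) / 2"
  by (auto simp: cell_right_def field_simps)

lemma cell_left_snoc: "cell_left (u @ [b]) = cell_left u + of_bool b / 2 ^ Suc (length u)"
  by (induction u) (auto simp: field_simps)

lemma cell_bounds: "0 \<le> cell_left u" "cell_left u < cell_right u" "cell_right u \<le> 1"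
proof -
  show "0 \<le> cell_left u" by (induction u) auto
  show "cell_left u < cell_right u" by (simp add: cell_right_def)
  show "cell_right u \<le> 1" by (induction u) (auto simp: cell_right_simps)
qed

lemma cell_Cons_iff: "s \<in> cell (b # u) \<longleftrightarrow> 2 * s - of_bool b \<in> cell u"
  by (auto simp: cell_def cell_right_simps)

lemma cell_unique: "length u = length v \<Longrightarrow> s \<in> cell u \<Longrightarrow> s \<in> cell v \<Longrightarrow> u = v"
proof (induction u arbitrary: v s)
  case (Cons b u)
  then obtain c v' where v: "v = c # v'" by (cases v) auto
  have *: "2 * s - of_bool b \<in> cell u" "2 * s - of_bool c \<in> cell v'"
    using Cons.prems by (auto simp: v cell_Cons_iff)
  then have "b = c"
    using cell_bounds[of u] cell_bounds[of v'] by (cases b; cases c) (auto simp: cell_def)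
  with * Cons v show ?case by auto
qed auto

lemma cell_left_prefix: "cell_left (map d [0..<n]) = (\<Sum>i<n. of_bool (d i) / 2 ^ Suc i)"
  by (induction n) (auto simp: cell_left_snoc)

lemma cell_right_prefix_Suc:
  "cell_right (map d [0..<Suc n]) = cell_right (map d [0..<n]) - of_bool (\<not> d n) / 2 ^ Suc n"
  by (auto simp: cell_right_def cell_left_snoc field_simps)

lemma cell_right_prefix_antimono:
  "m \<le> n \<Longrightarrow> cell_right (map d [0..<n]) \<le> cell_right (map d [0..<m])"
proof (induction n rule: dec_induct)
  case (step n)
  have "0 \<le> (of_bool (\<not> d n) / 2 ^ Suc n :: real)" by auto
  with step show ?case unfolding cell_right_prefix_Suc by linarith
qed simp

lemma cell_left_dyadic: "\<exists>a::nat. cell_left u = real a / 2 ^ length u"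
proof (induction u rule: rev_induct)
  case (snoc b u)
  then obtain a :: nat where "cell_left u = real a / 2 ^ length u" by auto
  then have "cell_left (u @ [b]) = real (2 * a + of_bool b) / 2 ^ length (u @ [b])"
    by (simp add: cell_left_snoc field_simps)
  then show ?case by blast
qed (auto intro: exI[of _ 0])

lemma binary_expansion_cell:
  assumes d: "binary_expansion s d" and s: "s < 1"
  shows "s \<in> cell (map d [0..<n])"
proof -
  define f where "f i = (of_bool (d i) / 2 ^ Suc i :: real)" for i
  have sums: "f sums s"
    using d unfolding binary_expansion_def f_def by (elim conjE)
  have left: "cell_left (map d [0..<m]) = sum f {..<m}" for m
    unfolding cell_left_prefix f_def ..
  have lim: "(\<lambda>m. cell_left (map d [0..<m])) \<longlonglongrightarrow> s"
    using sums unfolding left sums_def .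
  have "(\<lambda>m. cell_left (map d [0..<m]) + (1 / 2) ^ m) \<longlonglongrightarrow> s + 0"
    by (intro tendsto_add lim LIMSEQ_realpow_zero) auto
  then have lim2: "(\<lambda>m. cell_right (map d [0..<m])) \<longlonglongrightarrow> s"
    by (simp add: cell_right_def power_one_over)
  have right: "s \<le> cell_right (map d [0..<m])" for m
    by (rule LIMSEQ_le_const2[OF lim2]) (use cell_right_prefix_antimono in blast)
  \<comment> \<open>Otherwise \<open>s\<close> would be the right end point of a cell, hence dyadic, with an expansion that ends in
    ones.\<close>
  have "\<exists>i\<ge>n. \<not> d i"
  proof (rule ccontr)
    assume "\<not> ?thesis"
    then have all: "d i" if "i \<ge> n" for i using that by auto
    have "cell_right (map d [0..<m]) = cell_right (map d [0..<n])" if "n \<le> m" for m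
      using that by (induction m rule: dec_induct) (auto simp: cell_right_prefix_Suc all simp del: upt_Suc)
    then have "(\<lambda>m. cell_right (map d [0..<m])) \<longlonglongrightarrow> cell_right (map d [0..<n])"
      unfolding eventually_sequentially[symmetric] by (intro tendsto_eventually eventually_sequentiallyI)
    then have "s = cell_right (map d [0..<n])"
      using lim2 LIMSEQ_unique by blast
    moreover obtain a :: nat where "cell_left (map d [0..<n]) = real a / 2 ^ n"
      using cell_left_dyadic[of "map d [0..<n]"] by auto
    ultimately have "s = real (a + 1) / 2 ^ n"
      by (simp add: cell_right_def field_simps)
    then have dyadic: "\<exists>(a::nat) (m::nat). s = real a / 2 ^ m" by blast
    have "s < 1 \<and> (\<exists>(a::nat) (m::nat). s = real a / 2 ^ m) \<longrightarrow> (\<forall>\<^sub>F i in sequentially. \<not> d i)"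
      using d unfolding binary_expansion_def by (elim conjE)
    from mp[OF this conjI[OF s dyadic]] have "\<forall>\<^sub>F i in sequentially. \<not> d i" .
    then obtain N where "\<And>i. i \<ge> N \<Longrightarrow> \<not> d i" by (auto simp: eventually_sequentially)
    from this[of "max N n"] all[of "max N n"] show False by auto
  qed
  then obtain i where i: "i \<ge> n" "\<not> d i" by auto
  have "s \<le> cell_right (map d [0..<Suc i])" by (rule right)
  also have "\<dots> < cell_right (map d [0..<i])"
    using i by (simp add: cell_right_prefix_Suc del: upt_Suc)
  also have "\<dots> \<le> cell_right (map d [0..<n])"
    by (rule cell_right_prefix_antimono) (rule i)
  finally have "s < cell_right (map d [0..<n])" .
  moreover have "cell_left (map d [0..<n]) \<le> s"
  proof -
    have "sum f {..<n} \<le> suminf f"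
      by (rule sum_le_suminf) (use sums in \<open>auto simp: sums_iff f_def\<close>)
    then show ?thesis unfolding left using sums by (simp add: sums_iff)
  qed
  ultimately show ?thesis by (auto simp: cell_def)
qed

lemma binary_expansion_exists:
  assumes s: "0 \<le> s" "s < 1"
  shows "binary_expansion s (\<lambda>i. odd \<lfloor>2 ^ Suc i * s\<rfloor>)"
proof -
  define d where "d i = odd \<lfloor>2 ^ Suc i * s\<rfloor>" for i
  have fl: "\<lfloor>2 * x\<rfloor> = 2 * \<lfloor>x\<rfloor> + of_bool (odd \<lfloor>2 * x\<rfloor>)" for x :: real
  proof -
    have "\<lfloor>2 * x\<rfloor> = 2 * \<lfloor>x\<rfloor> \<or> \<lfloor>2 * x\<rfloor> = 2 * \<lfloor>x\<rfloor> + 1" by linarith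
    then show ?thesis by auto
  qed
  have left: "cell_left (map d [0..<n]) = \<lfloor>2 ^ n * s\<rfloor> / 2 ^ n" for n
  proof (induction n)
    case 0
    then show ?case using s by (simp add: floor_eq_iff)
  next
    case (Suc n)
    have "real_of_int \<lfloor>2 ^ Suc n * s\<rfloor> = 2 * real_of_int \<lfloor>2 ^ n * s\<rfloor> + of_bool (d n)"
      using arg_cong[OF fl[of "2 ^ n * s"], of real_of_int] unfolding d_def by (simp add: mult.assoc)
    then show ?case using Suc
      by (simp add: cell_left_snoc field_simps)
  qed
  have "(\<lambda>n. cell_left (map d [0..<n])) \<longlonglongrightarrow> s"
  proof (rule tendsto_sandwich)
    show "\<forall>\<^sub>F n in sequentially. s - (1 / 2) ^ n \<le> cell_left (map d [0..<n])"
    proof (intro always_eventually allI)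
      fix n
      have "2 ^ n * s \<le> real_of_int \<lfloor>2 ^ n * s\<rfloor> + 1" by linarith
      then have "s \<le> (real_of_int \<lfloor>2 ^ n * s\<rfloor> + 1) / 2 ^ n"
        by (simp add: pos_le_divide_eq mult.commute)
      then have "s - 1 / 2 ^ n \<le> cell_left (map d [0..<n])"
        unfolding left add_divide_distrib by linarith
      then show "s - (1 / 2) ^ n \<le> cell_left (map d [0..<n])"
        by (simp only: power_one_over)
    qed
    show "\<forall>\<^sub>F n in sequentially. cell_left (map d [0..<n]) \<le> s"
    proof (intro always_eventually allI)
      fix n
      have "real_of_int \<lfloor>2 ^ n * s\<rfloor> \<le> 2 ^ n * s" by linarith
      then show "cell_left (map d [0..<n]) \<le> s"
        unfolding left by (simp add: field_simps)
    qed
    have "(\<lambda>n. s - (1 / 2) ^ n) \<longlonglongrightarrow> s - 0"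
      by (intro tendsto_diff tendsto_const LIMSEQ_realpow_zero) auto
    then show "(\<lambda>n. s - (1 / 2) ^ n) \<longlonglongrightarrow> s" by simp
  qed simp
  then have 1: "(\<lambda>i. of_bool (d i) / 2 ^ Suc i) sums s"
    unfolding cell_left_prefix sums_def .
  have 2: "\<forall>\<^sub>F i in sequentially. \<not> d i" if "s = real a / 2 ^ m" for a m :: nat
  proof -
    have "\<not> d i" if "m \<le> i" for i
    proof -
      have "(2::real) ^ Suc i = 2 ^ (Suc i - m) * 2 ^ m"
        unfolding power_add[symmetric] using that by simp
      then have "2 ^ Suc i * s = real (a * 2 ^ (Suc i - m))"
        unfolding \<open>s = real a / 2 ^ m\<close> by (simp only:) simp
      then have "\<lfloor>2 ^ Suc i * s\<rfloor> = int (a * 2 ^ (Suc i - m))" by (metis floor_of_nat)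
      moreover have "even (int (a * 2 ^ (Suc i - m)))" using that by simp
      ultimately show ?thesis unfolding d_def by simp
    qed
    then show ?thesis by (auto simp: eventually_sequentially)
  qed
  show ?thesis
    using 1 2 s unfolding binary_expansion_def d_def by auto
qed

lemma binary_digits_cell:
  assumes s: "0 \<le> s" "s < 1"
  shows "map (binary_digits s) [0..<n] = u \<longleftrightarrow> length u = n \<and> s \<in> cell u"
proof -
  have "binary_expansion s (binary_digits s)"
    unfolding binary_digits_def
  proof (rule theI[where a = "\<lambda>i. odd \<lfloor>2 ^ Suc i * s\<rfloor>"])
    show "binary_expansion s (\<lambda>i. odd \<lfloor>2 ^ Suc i * s\<rfloor>)" by (rule binary_expansion_exists[OF s])
    fix d assume d: "binary_expansion s d"
    define d' where "d' = (\<lambda>i. odd \<lfloor>2 ^ Suc i * s\<rfloor>)"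
    show "d = (\<lambda>i. odd \<lfloor>2 ^ Suc i * s\<rfloor>)"
      unfolding d'_def[symmetric]
    proof
      fix i
      have "map d [0..<Suc i] = map d' [0..<Suc i]"
        by (rule cell_unique[of _ _ s])
          (use binary_expansion_cell[OF d s(2)]
             binary_expansion_cell[OF binary_expansion_exists[OF s] s(2)] in \<open>auto simp: d'_def simp del: upt_Suc\<close>)
      then show "d i = d' i" by simp
    qed
  qed
  from binary_expansion_cell[OF this s(2), of n] show ?thesis
    using cell_unique by fastforce
qed

text \<open>The nodes of the tree on the infinite path towards \<open>s\<close> are exactly the prefixes of length less
  than \<open>X_s(T)\<close>.\<close>

lemma silhouette_eq_sum:
  assumes T: "binary_tree T" and s: "0 \<le> s" "s < 1"
  shows "real (silhouette s T) = (\<Sum>u\<in>T. indicator (cell u) s)"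
proof -
  define w where "w k = map (binary_digits s) [0..<k]" for k
  have len: "length (w k) = k" for k by (simp add: w_def)
  have fin: "finite T" using T by (simp add: binary_tree_def)
  have ex: "\<exists>k. w k \<notin> T"
  proof (rule ccontr)
    assume "\<nexists>k. w k \<notin> T"
    then have "range w \<subseteq> T" by auto
    moreover have "inj w" by (metis injI len)
    ultimately show False using fin by (meson finite_subset range_inj_infinite)
  qed
  define K where "K = silhouette s T"
  have K: "K = (LEAST k. w k \<notin> T)" by (simp add: K_def silhouette_def w_def)
  have "w K \<notin> T" unfolding K using ex by (rule LeastI_ex)
  have above: "w k \<notin> T" if "K \<le> k" for k
    using that
  proof (induction k rule: dec_induct)
    case base show ?case by fact
  next
    case (step k)
    have "w (Suc k) = w k @ [binary_digits s k]" by (simp add: w_def)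
    with T step show ?case unfolding binary_tree_def by metis
  qed
  have below: "w k \<in> T" if "k < K" for k
    using that unfolding K by (meson not_less_Least)
  have "{u\<in>T. s \<in> cell u} = w ` {..<K}"
  proof (intro equalityI subsetI)
    fix u assume u: "u \<in> {u\<in>T. s \<in> cell u}"
    then have "w (length u) = u"
      using binary_digits_cell[OF s, of "length u" u] by (auto simp: w_def)
    with u above show "u \<in> w ` {..<K}" by (metis (no_types, lifting) image_eqI lessThan_iff linorder_not_less
        mem_Collect_eq)
  next
    fix u assume "u \<in> w ` {..<K}"
    then obtain k where k: "u = w k" "k < K" by auto
    then show "u \<in> {u\<in>T. s \<in> cell u}"
      using binary_digits_cell[OF s, of k u] below by (auto simp: w_def)
  qed
  moreover have "inj_on w {..<K}" by (metis inj_onI len)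
  ultimately have "card {u\<in>T. s \<in> cell u} = K" by (simp add: card_image)
  moreover have "(\<Sum>u\<in>T. indicator (cell u) s) = (of_nat (card {u\<in>T. s \<in> cell u}) :: real)"
    using fin by (simp add: indicator_def sum.If_cases Int_def of_bool_def)
  ultimately show ?thesis by (simp add: K_def)
qed

text \<open>The length of \<open>cell u \<inter> {0..t}\<close>, for \<open>t\<close> in the unit interval.\<close>

definition cell_length :: "node \<Rightarrow> real \<Rightarrow> real" where
  "cell_length u t = max 0 (min t (cell_right u) - cell_left u)"

lemma int_silhouette_eq_sum:
  assumes T: "binary_tree T" and t: "0 \<le> t" "t \<le> 1"
  shows "int_silhouette T t = (\<Sum>u\<in>T. cell_length u t)"
proof -
  have "int_silhouette T t = integral {0..t} (\<lambda>s. \<Sum>u\<in>T. indicator (cell u) s)"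
    unfolding int_silhouette_def
    by (rule integral_spike[of "{1}"]) (use silhouette_eq_sum[OF T] t in auto)
  also have "\<dots> = (\<Sum>u\<in>T. integral {0..t} (indicator (cell u)))"
  proof (rule integral_sum)
    show "finite T" using T by (simp add: binary_tree_def)
    show "(indicator (cell u) :: real \<Rightarrow> real) integrable_on {0..t}" for u
      unfolding integrable_on_indicator cell_def
      by (rule fmeasurable.Int) (auto intro: bounded_set_imp_lmeasurable)
  qed
  also have "\<dots> = (\<Sum>u\<in>T. cell_length u t)"
  proof (rule sum.cong)
    fix u
    have m: "cell u \<inter> {0..t} \<in> lmeasurable"
      unfolding cell_def by (rule fmeasurable.Int) (auto intro: bounded_set_imp_lmeasurable)
    have "measure lebesgue (cell u \<inter> {0..t}) = measure lebesgue {cell_left u..min t (cell_right u)}"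
    proof (rule measure_negligible_symdiff[symmetric])
      show "negligible ((cell u \<inter> {0..t} - {cell_left u..min t (cell_right u)}) \<union>
         ({cell_left u..min t (cell_right u)} - cell u \<inter> {0..t}))"
        by (rule negligible_subset[of "{cell_right u}"])
          (use cell_bounds[of u] in \<open>auto simp: cell_def\<close>)
    qed (use m in auto)
    also have "\<dots> = cell_length u t"
      by (auto simp: cell_length_def)
    finally show "integral {0..t} (indicator (cell u)) = cell_length u t"
      by (subst integral_indicator) (use m in auto)
  qed simp
  finally show ?thesis .
qed

text \<open>The proportion of \<open>cell w\<close> that is covered by \<open>cell u\<close>: it is \<open>1\<close> if \<open>u\<close> is a prefix of \<open>w\<close>, and
  \<open>2^(|w| - |u|)\<close> if \<open>w\<close> is a prefix of \<open>u\<close>.\<close>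

fun weight :: "node \<Rightarrow> node \<Rightarrow> real" where
  "weight [] u = 1 / 2 ^ length u"
| "weight (b # w) [] = 1"
| "weight (b # w) (c # u) = (if b = c then weight w u else 0)"

lemma weight_eq: "weight w u / 2 ^ length w = cell_length u (cell_right w) - cell_length u (cell_left w)"
proof (induction w u rule: weight.induct)
  case (1 u)
  then show ?case using cell_bounds[of u] by (simp add: cell_length_def cell_right_simps) (simp add: cell_right_def)
next
  case (2 b w)
  have "cell_length [] t = t" if "0 \<le> t" "t \<le> 1" for t
    using that by (simp add: cell_length_def cell_right_simps)
  then have "cell_length [] (cell_right (b # w)) - cell_length [] (cell_left (b # w)) = cell_right (b # w) -
      cell_left (b # w)"
    using cell_bounds[of "b # w"] by (metis less_eq_real_def order_trans)
  then show ?case by (simp add: cell_right_def)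
next
  case (3 b w c u)
  have half: "max 0 (min t ((x + r) / 2) - (x + l) / 2) = max 0 (min (2 * t - x) r - l) / 2" for t x r l :: real
    by (auto simp: max_def min_def field_simps)
  have len: "cell_length (c # u) t = cell_length u (2 * t - of_bool c) / 2" for t
    unfolding cell_length_def cell_right_simps cell_left.simps by (rule half)
  show ?case
  proof (cases "b = c")
    case True
    then show ?thesis using 3 by (auto simp: len cell_right_simps field_simps)
  next
    case False
    have le0: "cell_length u t = 0" if "t \<le> 0" for t
      using that cell_bounds[of u] by (simp add: cell_length_def)
    have ge1: "cell_length u t = cell_right u - cell_left u" if "t \<ge> 1" for t
      using that cell_bounds[of u] by (simp add: cell_length_def)
    have shift: "2 * cell_right (b # w) - of_bool c = cell_right w + (of_bool b - of_bool c)"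
      "2 * cell_left (b # w) - of_bool c = cell_left w + (of_bool b - of_bool c)"
      by (simp_all add: cell_right_simps)
    show ?thesis using False cell_bounds[of w] unfolding len shift
      by (cases b) (simp_all add: le0 ge1)
  qed
qed

text \<open>The average of the silhouette of \<open>T\<close> over \<open>cell w\<close>, as \<open>int_silhouette_cell\<close> shows; the silhouette
  is the sum of the indicators of the cells of the nodes.\<close>

definition cell_mean :: "node \<Rightarrow> node set \<Rightarrow> real" where
  "cell_mean w T = (\<Sum>u\<in>T. weight w u)"

lemma int_silhouette_cell:
  assumes T: "binary_tree T"
  shows "int_silhouette T (cell_right w) - int_silhouette T (cell_left w) = cell_mean w T / 2 ^ length w"
proof -
  have "0 \<le> cell_right w" "cell_left w \<le> 1" using cell_bounds[of w] by linarith+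
  then show ?thesis using cell_bounds[of w]
    by (simp add: int_silhouette_eq_sum[OF T] cell_mean_def sum_divide_distrib weight_eq sum_subtractf)
qed

lemma eta_eq_cell_mean:
  assumes T: "binary_tree T" shows "eta T = cell_mean [] T"
proof -
  have "int_silhouette T 0 = 0" by (simp add: int_silhouette_def)
  then show ?thesis using int_silhouette_cell[OF T, of "[]"] by (simp add: eta_def cell_right_simps)
qed

lemma Delta_centred_int_silhouette:
  assumes T: "binary_tree T" and w: "length w = k" "cell_left w = (real j - 1) / 2 ^ k"
  shows "Delta k (centred_int_silhouette T) j = (cell_mean w T - cell_mean [] T) / 2 ^ k"
proof -
  have r: "cell_right w = real j / 2 ^ k" using w by (simp add: cell_right_def field_simps)
  have "Delta k (centred_int_silhouette T) j =
     (int_silhouette T (cell_right w) - int_silhouette T (cell_left w)) - eta T / 2 ^ k"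
    unfolding Delta_def centred_int_silhouette_def r w(2) eta_def by (simp add: field_simps)
  then show ?thesis
    by (simp only: int_silhouette_cell[OF T] eta_eq_cell_mean[OF T] w(1) diff_divide_distrib)
qed

lemma node_bit_iff:
  assumes "m \<le> k" "j \<ge> 1"
  shows "node_bit k j m \<longleftrightarrow> odd ((j - 1) div 2 ^ (k - m))"
proof -
  have "int m - int k = - int (k - m)" using assms by simp
  then have "2 powi (int m - int k) = inverse ((2::real) ^ (k - m))"
    by (simp only: power_int_minus power_int_of_nat)
  then have "2 powi (int m - int k) * (real j - 1) = real (j - 1) / real (2 ^ (k - m))"
    using assms by (simp add: of_nat_diff divide_inverse mult.commute)
  then have "\<lfloor>2 powi (int m - int k) * (real j - 1)\<rfloor> = int ((j - 1) div 2 ^ (k - m))"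
    by (simp only: floor_divide_of_nat_eq)
  then have "node_bit k j m \<longleftrightarrow> odd (int ((j - 1) div 2 ^ (k - m)))"
    unfolding node_bit_def by (simp only: odd_iff_mod_2_eq_one)
  then show ?thesis by (simp only: even_of_nat)
qed

lemma length_ancestor [simp]: "length (ancestor k j l) = l"
  by (simp add: ancestor_def)

lemma ancestor_Suc: "ancestor k j (Suc l) = ancestor k j l @ [node_bit k j (Suc l)]"
  by (simp add: ancestor_def)

lemma take_ancestor: "l \<le> m \<Longrightarrow> take l (ancestor k j m) = ancestor k j l"
  unfolding ancestor_def by (simp add: take_map del: upt_Suc)

lemma nth_ancestor: "l < m \<Longrightarrow> ancestor k j m ! l = node_bit k j (Suc l)"
  unfolding ancestor_def by (simp del: upt_Suc)

lemma cell_left_ancestor: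
  assumes "1 \<le> j" "j \<le> 2 ^ k" "l \<le> k"
  shows "cell_left (ancestor k j l) = real ((j - 1) div 2 ^ (k - l)) / 2 ^ l"
  using assms(3)
proof (induction l)
  case 0
  have "(j - 1) div 2 ^ k = 0" using assms by auto
  then show ?case by (simp add: ancestor_def)
next
  case (Suc l)
  define a where "a = (j - 1) div 2 ^ (k - Suc l)"
  have "(j - 1) div 2 ^ (k - l) = a div 2"
  proof -
    have "k - l = Suc (k - Suc l)" using Suc.prems by simp
    then show ?thesis by (simp add: a_def div_mult2_eq mult.commute[of 2])
  qed
  moreover have "real a = 2 * real (a div 2) + of_bool (odd a)"
    by (cases "odd a") (auto elim!: oddE evenE)
  moreover have "node_bit k j (Suc l) \<longleftrightarrow> odd a"
    unfolding a_def using Suc.prems assms by (intro node_bit_iff) auto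
  ultimately show ?case
    using Suc unfolding a_def[symmetric] by (simp add: ancestor_Suc cell_left_snoc field_simps)
qed

lemma bij_betw_ancestor:
  "bij_betw (\<lambda>j. ancestor k j k) {1..2 ^ k} {w. length w = k}"
proof -
  have inj: "inj_on (\<lambda>j. ancestor k j k) {1..2 ^ k}"
  proof (rule inj_onI)
    fix i j assume ij: "i \<in> {1..2 ^ k}" "j \<in> {1..2 ^ k}" and eq: "ancestor k i k = ancestor k j k"
    have left: "cell_left (ancestor k x k) = real (x - 1) / 2 ^ k" if "x \<in> {1..2 ^ k}" for x
      using cell_left_ancestor[of x k k] that by auto
    have "real (i - 1) / 2 ^ k = real (j - 1) / 2 ^ k"
      using left[OF ij(1)] left[OF ij(2)] unfolding eq by argo
    then have "i - 1 = j - 1" by simp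
    then show "i = j" using ij by auto
  qed
  have "card {w :: node. length w = k} = 2 ^ k"
    using card_lists_length_eq[of "UNIV :: bool set" k] by simp
  moreover have "finite {w :: node. length w = k}"
    using finite_lists_length_eq[of "UNIV :: bool set" k] by simp
  ultimately have "(\<lambda>j. ancestor k j k) ` {1..2 ^ k} = {w. length w = k}"
    using inj by (intro card_subset_eq) (auto simp: card_image)
  with inj show ?thesis by (simp add: bij_betw_def)
qed

section \<open>Binary search trees by recursion on the root\<close>

text \<open>The tree whose root has the left subtree \<open>L\<close> and the right subtree \<open>R\<close>.\<close>

definition tree_node :: "node set \<Rightarrow> node set \<Rightarrow> node set" where
  "tree_node L R = insert [] (Cons False ` L \<union> Cons True ` R)"

lemma tree_node_inject: "tree_node L R = tree_node L' R' \<longleftrightarrow> L = L' \<and> R = R'"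
proof
  assume eq: "tree_node L R = tree_node L' R'"
  have "L = {v. False # v \<in> tree_node L R}" "R = {v. True # v \<in> tree_node L R}" for L R
    by (auto simp: tree_node_def)
  then show "L = L' \<and> R = R'" using eq by metis
qed auto

lemma finite_tree_node: "finite L \<Longrightarrow> finite R \<Longrightarrow> finite (tree_node L R)"
  by (simp add: tree_node_def)

lemma binary_tree_tree_node:
  assumes "binary_tree L" "binary_tree R"
  shows "binary_tree (tree_node L R)"
  unfolding binary_tree_def
proof (intro conjI allI impI)
  show "finite (tree_node L R)" using assms by (simp add: finite_tree_node binary_tree_def)
  fix u b assume u: "u @ [b] \<in> tree_node L R"
  show "u \<in> tree_node L R"
    using u assms by (cases u) (auto simp: tree_node_def binary_tree_def)
qed

lemma sum_tree_node:
  assumes "finite L" "finite R"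
  shows "sum f (tree_node L R) = f [] + (\<Sum>u\<in>L. f (False # u)) + (\<Sum>u\<in>R. f (True # u))"
proof -
  have "sum f (tree_node L R) = f [] + (sum f (Cons False ` L \<union> Cons True ` R))"
    unfolding tree_node_def using assms by (subst sum.insert) auto
  also have "sum f (Cons False ` L \<union> Cons True ` R) = sum f (Cons False ` L) + sum f (Cons True ` R)"
    using assms by (intro sum.union_disjoint) auto
  finally show ?thesis by (simp add: sum.reindex add.assoc)
qed

lemma card_tree_node: "finite L \<Longrightarrow> finite R \<Longrightarrow> card (tree_node L R) = Suc (card L + card R)"
  using sum_tree_node[of L R "\<lambda>_. 1 :: nat"] by simp

lemma cell_mean_Cons:
  assumes "finite L" "finite R"
  shows "cell_mean (b # w) (tree_node L R) = 1 + cell_mean w (if b then R else L)"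
  using assms by (simp add: cell_mean_def sum_tree_node)

lemma cell_mean_Nil:
  assumes "finite L" "finite R"
  shows "cell_mean [] (tree_node L R) = 1 + (cell_mean [] L + cell_mean [] R) / 2"
  using assms by (simp add: cell_mean_def sum_tree_node sum_divide_distrib add_divide_distrib mult.commute)

lemma cell_mean_empty [simp]: "cell_mean w {} = 0"
  by (simp add: cell_mean_def)

text \<open>The labelled tree with root label \<open>a\<close> and labelled subtrees \<open>L\<close> and \<open>R\<close>.\<close>

definition map_node :: "real \<Rightarrow> (node \<rightharpoonup> real) \<Rightarrow> (node \<rightharpoonup> real) \<Rightarrow> (node \<rightharpoonup> real)" where
  "map_node a L R u = (case u of [] \<Rightarrow> Some a | b # v \<Rightarrow> if b then R v else L v)"

lemma dom_map_node: "dom (map_node a L R) = tree_node (dom L) (dom R)"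
proof (intro set_eqI)
  fix u
  show "u \<in> dom (map_node a L R) \<longleftrightarrow> u \<in> tree_node (dom L) (dom R)"
  proof (cases u)
    case (Cons b v)
    then show ?thesis by (cases b) (auto simp: map_node_def tree_node_def)
  qed (auto simp: map_node_def tree_node_def)
qed

text \<open>The labelled search tree of a list, by recursion on the root: the first element becomes the root
  label and splits the rest of the list. Ties go to the left. It agrees with successive insertion by
  \<open>bst_labelled_eq\<close>.\<close>

function bst_of_list :: "real list \<Rightarrow> (node \<rightharpoonup> real)" where
  "bst_of_list [] = Map.empty"
| "bst_of_list (a # xs) = map_node a (bst_of_list (filter (\<lambda>x. x \<le> a) xs)) (bst_of_list (filter (\<lambda>x. a < x) xs))"
  by pat_completeness auto
termination
  by (relation "inv_image less_than length") (auto simp: less_Suc_eq_le)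

text \<open>The search tree of a list without its labels.\<close>

definition bst_shape :: "real list \<Rightarrow> node set" where
  "bst_shape xs = dom (bst_of_list xs)"

lemma bst_shape_simps:
  "bst_shape [] = {}"
  "bst_shape (a # xs) = tree_node (bst_shape (filter (\<lambda>x. x \<le> a) xs)) (bst_shape (filter (\<lambda>x. a < x) xs))"
  by (simp_all add: bst_shape_def dom_map_node)

lemma bst_shape_tree: "binary_tree (bst_shape xs) \<and> card (bst_shape xs) = length xs"
proof (induction xs rule: bst_of_list.induct)
  case 1
  then show ?case by (simp add: bst_shape_simps binary_tree_def)
next
  case (2 a xs)
  have "length (filter (\<lambda>x. x \<le> a) xs) + length (filter (\<lambda>x. a < x) xs) = length xs"
    by (induction xs) auto
  with 2 show ?case
    by (simp add: bst_shape_simps binary_tree_tree_node) (simp add: card_tree_node binary_tree_def)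
qed

lemma bst_walk_map_node:
  "bst_walk (map_node a L R) x (Suc m) = (a < x) # bst_walk (if a < x then R else L) x m"
  by (induction m) (simp_all add: map_node_def)

lemma length_bst_walk [simp]: "length (bst_walk L x m) = m"
  by (induction m) auto

lemma bst_insert_map_node:
  assumes "finite (dom L)" "finite (dom R)"
  shows "bst_insert x (map_node a L R) =
    (if a < x then map_node a L (bst_insert x R) else map_node a (bst_insert x L) R)"
proof -
  define Q where "Q = (if a < x then R else L)"
  have iff: "bst_walk (map_node a L R) x (Suc m) \<notin> dom (map_node a L R) \<longleftrightarrow> bst_walk Q x m \<notin> dom Q" for m
    unfolding bst_walk_map_node Q_def by (auto simp: map_node_def dom_def)
  have ex: "\<exists>m. bst_walk Q x m \<notin> dom Q"
  proof (rule ccontr)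
    assume "\<nexists>m. bst_walk Q x m \<notin> dom Q"
    then have "range (bst_walk Q x) \<subseteq> dom Q" by blast
    moreover have "inj (bst_walk Q x)" by (metis injI length_bst_walk)
    moreover have "finite (dom Q)" using assms by (simp add: Q_def)
    ultimately show False by (meson finite_subset range_inj_infinite)
  qed
  obtain m where m: "bst_walk Q x m \<notin> dom Q" using ex by blast
  have "(LEAST m. bst_walk (map_node a L R) x m \<notin> dom (map_node a L R)) =
     Suc (LEAST m. bst_walk Q x m \<notin> dom Q)"
  proof (rule Least_Suc2[where n = "Suc m" and m = m])
    show "bst_walk (map_node a L R) x (Suc m) \<notin> dom (map_node a L R)" using iff m by blast
    show "bst_walk Q x m \<notin> dom Q" by (rule m)
    show "\<not> bst_walk (map_node a L R) x 0 \<notin> dom (map_node a L R)" by (simp add: map_node_def dom_def)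
    show "\<forall>k. (bst_walk (map_node a L R) x (Suc k) \<notin> dom (map_node a L R)) = (bst_walk Q x k \<notin> dom Q)"
      using iff by blast
  qed
  then have "bst_insert x (map_node a L R) =
      (map_node a L R)((a < x) # bst_walk Q x (LEAST m. bst_walk Q x m \<notin> dom Q) \<mapsto> x)"
    unfolding bst_insert_def by (simp only: bst_walk_map_node Q_def)
  also have "\<dots> = (if a < x then map_node a L (bst_insert x R) else map_node a (bst_insert x L) R)"
    by (auto simp: fun_eq_iff map_node_def bst_insert_def Q_def split: list.split)
  finally show ?thesis .
qed

lemma finite_dom_bst_of_list: "finite (dom (bst_of_list xs))"
  using bst_shape_tree[of xs] by (simp add: bst_shape_def binary_tree_def)

lemma bst_of_list_snoc: "bst_of_list (xs @ [x]) = bst_insert x (bst_of_list xs)"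
proof (induction xs rule: bst_of_list.induct)
  case 1
  have "(LEAST m. bst_walk (\<lambda>u. None) x m \<notin> dom (\<lambda>u. None :: real option)) = 0"
    by (rule Least_equality) auto
  then show ?case by (auto simp: bst_insert_def map_node_def fun_eq_iff split: list.split)
next
  case (2 a xs)
  then show ?case
    by (simp add: bst_insert_map_node finite_dom_bst_of_list)
qed

lemma bst_labelled_eq: "bst_labelled x n = bst_of_list (map x [1..<Suc n])"
  by (induction n) (simp_all add: bst_of_list_snoc)

lemma bst_shape_strict_mono:
  assumes "strict_mono (f :: real \<Rightarrow> real)"
  shows "bst_shape (map f xs) = bst_shape xs"
  by (induction xs rule: bst_of_list.induct)
    (simp_all add: bst_shape_simps filter_map o_def strict_mono_less_eq[OF assms] strict_mono_less[OF assms])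

section \<open>Independent uniform samples\<close>

text \<open>The uniform distribution on the unit interval.\<close>

definition unif :: "real measure" where
  "unif = uniform_measure lborel {0..1}"

lemma sets_unif [simp, measurable_cong]: "sets unif = sets borel"
  by (simp add: unif_def)

lemma space_unif [simp]: "space unif = UNIV"
  by (simp add: unif_def)

lemma prob_space_unif: "prob_space unif"
  unfolding unif_def by (rule prob_space_uniform_measure) auto

interpretation unif: prob_space unif
  by (rule prob_space_unif)

lemma nn_integral_unif:
  assumes [measurable]: "f \<in> borel_measurable borel"
  shows "(\<integral>\<^sup>+x. f x \<partial>unif) = (\<integral>\<^sup>+x. f x * indicator {0..1} x \<partial>lborel)"
  unfolding unif_def by (subst nn_integral_uniform_measure) (auto simp: divide_ennreal_def)

lemma nn_integral_unif_has_integral: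
  assumes "(f has_integral r) {0..1}" "\<And>x. 0 \<le> x \<Longrightarrow> x \<le> 1 \<Longrightarrow> 0 \<le> f x" and [measurable]: "f \<in> borel_measurable borel"
  shows "(\<integral>\<^sup>+x. ennreal (f x) \<partial>unif) = ennreal r"
  using nn_integral_has_integral_lebesgue'[of "{0..1}" f r] assms by (simp add: nn_integral_unif)

lemma AE_unif: "AE x in unif. 0 < x \<and> x < 1"
proof -
  have "AE x in lborel. x \<noteq> 0 \<and> x \<noteq> (1::real)"
    using AE_lborel_singleton[of "0::real"] AE_lborel_singleton[of "1::real"] by eventually_elim auto
  then have "AE x in lborel. x \<in> {0..1} \<longrightarrow> 0 < x \<and> x < (1::real)"
    by eventually_elim auto
  then show ?thesis unfolding unif_def
    by (intro AE_uniform_measureI) auto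
qed

lemma nn_integral_unif_reflect:
  assumes [measurable]: "f \<in> borel_measurable borel"
  shows "(\<integral>\<^sup>+x. f (1 - x) \<partial>unif) = (\<integral>\<^sup>+x. f x \<partial>unif)"
proof -
  have "(\<integral>\<^sup>+x. f x \<partial>unif) = (\<integral>\<^sup>+x. f (1 - x) * indicator {0..1} (1 - x) \<partial>lborel)"
    unfolding nn_integral_unif[OF assms]
    by (subst nn_integral_real_affine[where c = "-1" and t = 1]) auto
  also have "\<dots> = (\<integral>\<^sup>+x. f (1 - x) \<partial>unif)"
    by (subst nn_integral_unif) (auto intro!: nn_integral_cong simp: indicator_def)
  finally show ?thesis by simp
qed

lemma nn_integral_unif_left:
  assumes [measurable]: "f \<in> borel_measurable borel" and p: "0 < p" "p < 1"
  shows "(\<integral>\<^sup>+x. f x * indicator {..p} x \<partial>unif) = ennreal p * (\<integral>\<^sup>+y. f (p * y) \<partial>unif)"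
proof -
  have "(\<integral>\<^sup>+x. f x * indicator {..p} x \<partial>unif) = (\<integral>\<^sup>+x. f x * indicator {..p} x * indicator {0..1} x \<partial>lborel)"
    by (subst nn_integral_unif) auto
  also have "\<dots> = ennreal p * (\<integral>\<^sup>+y. f (p * y) * indicator {..p} (p * y) * indicator {0..1} (p * y) \<partial>lborel)"
    using p by (subst nn_integral_real_affine[where c = p and t = 0]) auto
  also have "(\<integral>\<^sup>+y. f (p * y) * indicator {..p} (p * y) * indicator {0..1} (p * y) \<partial>lborel) = (\<integral>\<^sup>+y. f (p * y) \<partial>unif)"
  proof (subst nn_integral_unif)
    have "p * y \<le> p \<longleftrightarrow> y \<le> 1" "0 \<le> p * y \<longleftrightarrow> 0 \<le> y" for y
      using p by (auto simp: zero_le_mult_iff)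
    moreover have "y \<le> 1 \<Longrightarrow> p * y \<le> 1" for y
      using p mult_left_mono[of y 1 p] by linarith
    ultimately show "(\<integral>\<^sup>+y. f (p * y) * indicator {..p} (p * y) * indicator {0..1} (p * y) \<partial>lborel) =
        (\<integral>\<^sup>+y. f (p * y) * indicator {0..1} y \<partial>lborel)"
      by (intro nn_integral_cong) (auto simp: indicator_def)
  qed simp
  finally show ?thesis .
qed

lemma nn_integral_unif_right:
  assumes [measurable]: "f \<in> borel_measurable borel" and p: "0 < p" "p < 1"
  shows "(\<integral>\<^sup>+x. f x * indicator {p<..} x \<partial>unif) = ennreal (1 - p) * (\<integral>\<^sup>+y. f (p + (1 - p) * y) \<partial>unif)"
proof -
  have "(\<integral>\<^sup>+x. f x * indicator {p<..} x \<partial>unif) = (\<integral>\<^sup>+x. f (1 - x) * indicator {p<..} (1 - x) \<partial>unif)"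
    by (subst nn_integral_unif_reflect[symmetric]) auto
  also have "\<dots> = (\<integral>\<^sup>+x. f (1 - x) * indicator {..1 - p} x \<partial>unif)"
  proof (rule nn_integral_cong_AE)
    have "AE x in lborel. x \<in> {0..1} \<longrightarrow> x \<noteq> 1 - p"
      using AE_lborel_singleton[of "1 - p"] by eventually_elim auto
    then have "AE x in unif. x \<noteq> 1 - p"
      unfolding unif_def by (intro AE_uniform_measureI) auto
    then show "AE x in unif. f (1 - x) * indicator {p<..} (1 - x) = f (1 - x) * indicator {..1 - p} x"
      by eventually_elim (auto simp: indicator_def)
  qed
  also have "\<dots> = ennreal (1 - p) * (\<integral>\<^sup>+y. f (1 - (1 - p) * y) \<partial>unif)"
    using p by (intro nn_integral_unif_left) auto
  also have "(\<integral>\<^sup>+y. f (1 - (1 - p) * y) \<partial>unif) = (\<integral>\<^sup>+y. f (1 - (1 - p) * (1 - y)) \<partial>unif)"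
    by (subst nn_integral_unif_reflect[symmetric]) auto
  also have "\<dots> = (\<integral>\<^sup>+y. f (p + (1 - p) * y) \<partial>unif)"
    by (simp add: algebra_simps)
  finally show ?thesis .
qed

abbreviation unif_stream :: "real stream measure" where
  "unif_stream \<equiv> stream_space unif"

interpretation unif_stream: prob_space unif_stream
  by (rule unif.prob_space_stream_space)

text \<open>Functions of real lists for which the value on the first \<open>n\<close> elements of a stream is a measurable
  function of the stream, for every \<open>n\<close>. This is the form of measurability that iterated integration
  over the list elements needs.\<close>

definition list_measurable :: "'b measure \<Rightarrow> (real list \<Rightarrow> 'b) \<Rightarrow> bool" where
  "list_measurable K F \<longleftrightarrow> (\<forall>n. (\<lambda>s. F (stake n s)) \<in> unif_stream \<rightarrow>\<^sub>M K)"

lemma list_measurable_map: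
  assumes F: "list_measurable K F" and fs: "\<And>f. f \<in> set fs \<Longrightarrow> f \<in> borel_measurable N"
  shows "(\<lambda>\<omega>. F (map (\<lambda>f. f \<omega>) fs)) \<in> N \<rightarrow>\<^sub>M K"
proof -
  define g where "g \<omega> = to_stream (\<lambda>i. if i < length fs then (fs ! i) \<omega> else 0)" for \<omega>
  have g: "g \<in> N \<rightarrow>\<^sub>M unif_stream"
  proof (rule measurable_stream_space2)
    have [measurable]: "fs ! i \<in> borel_measurable N" if "i < length fs" for i
      using fs that by simp
    show "(\<lambda>\<omega>. g \<omega> !! n) \<in> N \<rightarrow>\<^sub>M unif" for n
      by (cases "n < length fs") (auto simp: g_def to_stream_def)
  qed
  have "stake (length fs) (g \<omega>) = map (\<lambda>f. f \<omega>) fs" for \<omega>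
    by (rule nth_equalityI) (auto simp: g_def to_stream_def)
  moreover have "(\<lambda>\<omega>. F (stake (length fs) (g \<omega>))) \<in> N \<rightarrow>\<^sub>M K"
    by (rule measurable_compose[OF g F[unfolded list_measurable_def, rule_format]])
  ultimately show ?thesis by simp
qed

lemma measurable_filter_list:
  assumes "\<And>i. i \<in> set is \<Longrightarrow> Measurable.pred N (\<lambda>\<omega>. Q i \<omega>)"
  shows "(\<lambda>\<omega>. filter (\<lambda>i. Q i \<omega>) is) \<in> N \<rightarrow>\<^sub>M count_space (lists (set is) \<inter> {js. length js \<le> length is})"
  using assms
proof (induction "is")
  case (Cons i "is")
  let ?I = "\<lambda>is :: 'a list. lists (set is) \<inter> {js. length js \<le> length is}"
  have IH: "(\<lambda>\<omega>. filter (\<lambda>i. Q i \<omega>) is) \<in> N \<rightarrow>\<^sub>M count_space (?I is)"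
    using Cons by auto
  have [measurable]: "Measurable.pred N (\<lambda>\<omega>. Q i \<omega>)" using Cons by auto
  have "(\<lambda>\<omega>. if Q i \<omega> then i # filter (\<lambda>i. Q i \<omega>) is else filter (\<lambda>i. Q i \<omega>) is)
      \<in> N \<rightarrow>\<^sub>M count_space (?I (i # is))"
  proof (rule measurable_If)
    show "(\<lambda>\<omega>. i # filter (\<lambda>i. Q i \<omega>) is) \<in> N \<rightarrow>\<^sub>M count_space (?I (i # is))"
      by (rule measurable_compose[OF IH]) auto
    show "(\<lambda>\<omega>. filter (\<lambda>i. Q i \<omega>) is) \<in> N \<rightarrow>\<^sub>M count_space (?I (i # is))"
      by (rule measurable_compose[OF IH, of "\<lambda>x. x"]) auto
  qed simp
  then show ?case by (simp add: if_distrib cong: if_cong)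
qed auto

text \<open>The indices of the selected elements form one of finitely many lists, so that the value is a
  measurable selection.\<close>

lemma measurable_filter_map:
  assumes fs: "\<And>f. f \<in> set fs \<Longrightarrow> f \<in> borel_measurable N"
    and Q: "\<And>f. f \<in> set fs \<Longrightarrow> Measurable.pred N (\<lambda>\<omega>. Q \<omega> (f \<omega>))"
    and F: "\<And>gs. set gs \<subseteq> set fs \<Longrightarrow> length gs \<le> length fs \<Longrightarrow> (\<lambda>\<omega>. F (map (\<lambda>f. f \<omega>) gs)) \<in> N \<rightarrow>\<^sub>M K"
  shows "(\<lambda>\<omega>. F (filter (Q \<omega>) (map (\<lambda>f. f \<omega>) fs))) \<in> N \<rightarrow>\<^sub>M K"
proof -
  define J where "J = lists (set [0..<length fs]) \<inter> {js. length js \<le> length [0..<length fs]}"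
  have g: "(\<lambda>\<omega>. filter (\<lambda>i. Q \<omega> ((fs ! i) \<omega>)) [0..<length fs]) \<in> N \<rightarrow>\<^sub>M count_space J"
    unfolding J_def by (rule measurable_filter_list) (auto intro: Q)
  have f: "(\<lambda>\<omega>. F (map (\<lambda>i. (fs ! i) \<omega>) js)) \<in> N \<rightarrow>\<^sub>M K" if "js \<in> J" for js
  proof -
    have "(\<lambda>\<omega>. F (map (\<lambda>f. f \<omega>) (map ((!) fs) js))) \<in> N \<rightarrow>\<^sub>M K"
      by (rule F) (use that in \<open>auto simp: J_def\<close>)
    then show ?thesis by (simp add: o_def)
  qed
  have "(\<lambda>\<omega>. F (map (\<lambda>i. (fs ! i) \<omega>) (filter (\<lambda>i. Q \<omega> ((fs ! i) \<omega>)) [0..<length fs]))) \<in> N \<rightarrow>\<^sub>M K"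
    by (rule measurable_compose_countable'[where f = "\<lambda>js \<omega>. F (map (\<lambda>i. (fs ! i) \<omega>) js)", OF f g]) auto
  moreover have "map (\<lambda>i. (fs ! i) \<omega>) (filter (\<lambda>i. Q \<omega> ((fs ! i) \<omega>)) [0..<length fs]) = filter (Q \<omega>) (map (\<lambda>f.
      f \<omega>) fs)" for \<omega>
  proof -
    have "map (\<lambda>f. f \<omega>) fs = map (\<lambda>i. (fs ! i) \<omega>) [0..<length fs]"
      by (rule nth_equalityI) auto
    then show ?thesis by (simp add: filter_map o_def)
  qed
  ultimately show ?thesis by simp
qed

text \<open>The space of finite node sets with the discrete \<open>\<sigma>\<close>-algebra. Restricting to finite sets makes it
  countable, so that a measurable selection among countably many measurable functions remains
  measurable.\<close>

abbreviation tree_space :: "node set measure" where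
  "tree_space \<equiv> count_space (Collect finite)"

lemma measurable_tree_node:
  assumes "f \<in> N \<rightarrow>\<^sub>M tree_space" "g \<in> N \<rightarrow>\<^sub>M tree_space"
  shows "(\<lambda>\<omega>. tree_node (f \<omega>) (g \<omega>)) \<in> N \<rightarrow>\<^sub>M tree_space"
proof -
  have c: "countable (Collect finite :: node set set)" by (rule countable_Collect_finite)
  have "(\<lambda>\<omega>. tree_node T (g \<omega>)) \<in> N \<rightarrow>\<^sub>M tree_space" if "T \<in> Collect finite" for T
    by (rule measurable_compose[OF assms(2)]) (use that in \<open>auto simp: finite_tree_node\<close>)
  then show ?thesis
    by (rule measurable_compose_countable'[OF _ assms(1) c])
qed

lemma measurable_bst_shape:
  assumes "\<And>f. f \<in> set fs \<Longrightarrow> f \<in> borel_measurable N"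
  shows "(\<lambda>\<omega>. bst_shape (map (\<lambda>f. f \<omega>) fs)) \<in> N \<rightarrow>\<^sub>M tree_space"
  using assms
proof (induction "length fs" arbitrary: fs rule: less_induct)
  case less
  show ?case
  proof (cases fs)
    case Nil
    then show ?thesis by (auto simp: bst_shape_simps)
  next
    case (Cons f gs)
    have [measurable]: "h \<in> borel_measurable N" if "h \<in> set fs" for h using less that by auto
    have [measurable]: "f \<in> borel_measurable N" using Cons by auto
    have gs: "h \<in> borel_measurable N" if "h \<in> set gs" for h using that Cons by auto
    have "(\<lambda>\<omega>. bst_shape (filter (\<lambda>x. x \<le> f \<omega>) (map (\<lambda>f. f \<omega>) gs))) \<in> N \<rightarrow>\<^sub>M tree_space"
      using gs Cons by (intro measurable_filter_map less(1)) auto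
    moreover have "(\<lambda>\<omega>. bst_shape (filter (\<lambda>x. f \<omega> < x) (map (\<lambda>f. f \<omega>) gs))) \<in> N \<rightarrow>\<^sub>M tree_space"
      using gs Cons by (intro measurable_filter_map less(1)) auto
    ultimately show ?thesis
      unfolding Cons list.map bst_shape_simps by (rule measurable_tree_node)
  qed
qed

lemma measurable_snth_borel [measurable]: "(\<lambda>s. s !! i) \<in> borel_measurable unif_stream"
proof -
  have "(\<lambda>s. s !! i) \<in> unif_stream \<rightarrow>\<^sub>M unif" by (rule measurable_snth)
  then show ?thesis by simp
qed

lemma stake_eq_map: "stake n s = map (\<lambda>f. f s) (map (\<lambda>i s. s !! i) [0..<n])"
  by (rule nth_equalityI) auto

lemma list_measurable_bst_shape: "list_measurable tree_space bst_shape"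
  unfolding list_measurable_def stake_eq_map
  by (intro allI measurable_bst_shape) (auto simp del: list.map_comp)

lemma list_measurable_Cons:
  "list_measurable K F \<Longrightarrow> list_measurable K (\<lambda>xs. F (x # xs))"
proof -
  assume F: "list_measurable K F"
  have "(\<lambda>s. F (stake (Suc n) (x ## s))) \<in> unif_stream \<rightarrow>\<^sub>M K" for n
    using F[unfolded list_measurable_def, rule_format, of "Suc n"]
    by (rule measurable_compose[rotated]) simp
  then show ?thesis by (simp add: list_measurable_def)
qed

lemma list_measurable_map_fun:
  assumes F: "list_measurable K F" and [measurable]: "h \<in> borel_measurable borel"
  shows "list_measurable K (\<lambda>xs. F (map h xs))"
  unfolding list_measurable_def stake_eq_map map_map
proof
  fix n
  have "(\<lambda>s. F (map (\<lambda>f. f s) (map (\<lambda>i s. h (s !! i)) [0..<n]))) \<in> unif_stream \<rightarrow>\<^sub>M K"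
    by (rule list_measurable_map[OF F]) auto
  then show "(\<lambda>x. F (map (h \<circ> ((\<lambda>f. f x) \<circ> (\<lambda>i s. s !! i))) [0..<n])) \<in> unif_stream \<rightarrow>\<^sub>M K"
    by (simp add: o_def)
qed

text \<open>The expectation of a function of \<open>n\<close> independent uniform variables.\<close>

definition sample_mean :: "nat \<Rightarrow> (real list \<Rightarrow> ennreal) \<Rightarrow> ennreal" where
  "sample_mean n F = (\<integral>\<^sup>+s. F (stake n s) \<partial>unif_stream)"

lemma sample_mean_0: "sample_mean 0 F = F []"
  by (simp add: sample_mean_def unif_stream.emeasure_space_1)

lemma sample_mean_Suc:
  assumes "(\<lambda>s. F (stake (Suc n) s)) \<in> borel_measurable unif_stream"
  shows "sample_mean (Suc n) F = (\<integral>\<^sup>+x. sample_mean n (\<lambda>xs. F (x # xs)) \<partial>unif)"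
  unfolding sample_mean_def by (subst unif.nn_integral_stream_space[OF assms]) simp

text \<open>The probability that a binomial variable with parameters \<open>n\<close> and \<open>p\<close> takes the value \<open>i\<close>.\<close>

definition binomial_weight :: "nat \<Rightarrow> real \<Rightarrow> nat \<Rightarrow> real" where
  "binomial_weight n p i = real (n choose i) * p ^ i * (1 - p) ^ (n - i)"

lemma binomial_weight_nonneg: "0 \<le> p \<Longrightarrow> p \<le> 1 \<Longrightarrow> 0 \<le> binomial_weight n p i"
  by (simp add: binomial_weight_def)

lemma sum_binomial_weight_Suc:
  fixes a :: "nat \<Rightarrow> ennreal"
  assumes p: "0 \<le> p" "p \<le> 1"
  shows "(\<Sum>i\<le>Suc n. ennreal (binomial_weight (Suc n) p i) * a i) =
    (\<Sum>i\<le>n. ennreal (binomial_weight n p i) * (ennreal p * a (Suc i) + ennreal (1 - p) * a i))"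
proof -
  define c where "c i = ennreal (p ^ i * (1 - p) ^ (Suc n - i)) * a i" for i
  have bw: "ennreal (binomial_weight m p i) = of_nat (m choose i) * ennreal (p ^ i * (1 - p) ^ (m - i))" for m i
    unfolding binomial_weight_def ennreal_of_nat_eq_real_of_nat mult.assoc
    using p by (intro ennreal_mult) auto
  have e1: "ennreal (p ^ i * (1 - p) ^ (n - i)) * ennreal p = ennreal (p ^ Suc i * (1 - p) ^ (Suc n - Suc i))" for i
    using p by (subst ennreal_mult[symmetric]) (auto simp: ac_simps)
  have e2: "ennreal (p ^ i * (1 - p) ^ (n - i)) * ennreal (1 - p) = ennreal (p ^ i * (1 - p) ^ (Suc n - i))"
      if "i \<le> n" for i
    using p that by (subst ennreal_mult[symmetric]) (auto simp: ac_simps Suc_diff_le)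
  have c1: "ennreal (binomial_weight n p i) * (ennreal p * a (Suc i)) = of_nat (n choose i) * c (Suc i)" for i
    unfolding c_def bw e1[symmetric] by (simp only: mult.assoc)
  have c2: "ennreal (binomial_weight n p i) * (ennreal (1 - p) * a i) = of_nat (n choose i) * c i" if "i \<le> n" for i
    unfolding c_def bw e2[OF that, symmetric] by (simp only: mult.assoc)
  have c3: "ennreal (binomial_weight (Suc n) p i) * a i = of_nat (Suc n choose i) * c i" for i
    unfolding c_def bw by (simp only: mult.assoc)
  have "(\<Sum>i\<le>Suc n. of_nat (Suc n choose i) * c i) = c 0 + (\<Sum>i\<le>n. of_nat (Suc n choose Suc i) * c (Suc i))"
    by (subst sum.atMost_Suc_shift) simp
  also have "\<dots> = c 0 + ((\<Sum>i\<le>n. of_nat (n choose i) * c (Suc i)) + (\<Sum>i\<le>n. of_nat (n choose Suc i) * c (Suc i)))"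
    by (simp add: distrib_right sum.distrib)
  also have "\<dots> = (\<Sum>i\<le>n. of_nat (n choose i) * c (Suc i)) + (c 0 + (\<Sum>i\<le>n. of_nat (n choose Suc i) * c (Suc i)))"
    by (simp add: ac_simps)
  also have "c 0 + (\<Sum>i\<le>n. of_nat (n choose Suc i) * c (Suc i)) = (\<Sum>i\<le>Suc n. of_nat (n choose i) * c i)"
    by (subst sum.atMost_Suc_shift) simp
  also have "\<dots> = (\<Sum>i\<le>n. of_nat (n choose i) * c i)"
    by (simp add: binomial_eq_0)
  finally show ?thesis
    unfolding c3 by (simp only: distrib_left sum.distrib c1) (simp add: c2)
qed

text \<open>Given that the \<open>i\<close> elements not exceeding \<open>p\<close> and the \<open>n - i\<close> elements above \<open>p\<close> have been
  separated, the former are independent and uniform on \<open>[0, p]\<close>, the latter on \<open>[p, 1]\<close>, and both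
  samples are independent. The induction adds one element at the front of the list, and the binomial
  coefficients obey Pascal's rule.\<close>

lemma sample_mean_split:
  assumes p: "0 < p" "p < 1" and F: "list_measurable borel F" and G: "list_measurable borel G"
  shows "sample_mean n (\<lambda>xs. F (filter (\<lambda>x. x \<le> p) xs) * G (filter (\<lambda>x. p < x) xs)) =
    (\<Sum>i\<le>n. ennreal (binomial_weight n p i) *
       (sample_mean i (\<lambda>xs. F (map (\<lambda>y. p * y) xs)) * sample_mean (n - i) (\<lambda>xs. G (map (\<lambda>y. p + (1 - p) * y) xs))))"
  using F G
proof (induction n arbitrary: F G)
  case 0
  then show ?case by (simp add: sample_mean_0 binomial_weight_def)
next
  case (Suc n)
  note [measurable] = Suc.prems[unfolded list_measurable_def, rule_format]
  have m1: "(\<lambda>s. F (filter (\<lambda>x. x \<le> p) (stake m s))) \<in> borel_measurable unif_stream"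
    "(\<lambda>s. G (filter (\<lambda>x. p < x) (stake m s))) \<in> borel_measurable unif_stream" for m
    unfolding stake_eq_map by (intro measurable_filter_map list_measurable_map Suc.prems; auto)+
  have mF: "(\<lambda>s. F (map (\<lambda>y. p * y) (stake m s))) \<in> borel_measurable unif_stream" for m
    using list_measurable_map_fun[OF Suc.prems(1), of "\<lambda>y. p * y"] by (simp add: list_measurable_def)
  have mG: "(\<lambda>s. G (map (\<lambda>y. p + (1 - p) * y) (stake m s))) \<in> borel_measurable unif_stream" for m
    using list_measurable_map_fun[OF Suc.prems(2), of "\<lambda>y. p + (1 - p) * y"] by (simp add: list_measurable_def)
  define X where "X i = sample_mean i (\<lambda>xs. F (map (\<lambda>y. p * y) xs))" for i
  define Y where "Y i = sample_mean i (\<lambda>xs. G (map (\<lambda>y. p + (1 - p) * y) xs))" for i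
  define Xx where "Xx i x = sample_mean i (\<lambda>xs. F (x # map (\<lambda>y. p * y) xs))" for i x
  define Yx where "Yx i x = sample_mean i (\<lambda>xs. G (x # map (\<lambda>y. p + (1 - p) * y) xs))" for i x
  have [measurable]: "Xx i \<in> borel_measurable borel" for i
  proof -
    have "(\<lambda>z. F (map (\<lambda>f. f z) (fst # map (\<lambda>j z. p * (snd z !! j)) [0..<i]))) \<in> borel_measurable (borel \<Otimes>\<^sub>M
        unif_stream)"
      by (rule list_measurable_map[OF Suc.prems(1)]) auto
    then have "(\<lambda>(x, s). F (x # map (\<lambda>y. p * y) (stake i s))) \<in> borel_measurable (borel \<Otimes>\<^sub>M unif_stream)"
      by (simp add: stake_eq_map o_def case_prod_beta')
    then show ?thesis unfolding Xx_def[abs_def] sample_mean_def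
      by (rule unif_stream.borel_measurable_nn_integral)
  qed
  have [measurable]: "Yx i \<in> borel_measurable borel" for i
  proof -
    have "(\<lambda>z. G (map (\<lambda>f. f z) (fst # map (\<lambda>j z. p + (1 - p) * (snd z !! j)) [0..<i]))) \<in> borel_measurable
        (borel \<Otimes>\<^sub>M unif_stream)"
      by (rule list_measurable_map[OF Suc.prems(2)]) auto
    then have "(\<lambda>(x, s). G (x # map (\<lambda>y. p + (1 - p) * y) (stake i s))) \<in> borel_measurable (borel \<Otimes>\<^sub>M unif_stream)"
      by (simp add: stake_eq_map o_def case_prod_beta')
    then show ?thesis unfolding Yx_def[abs_def] sample_mean_def
      by (rule unif_stream.borel_measurable_nn_integral)
  qed
  have XSuc: "X (Suc i) = (\<integral>\<^sup>+y. Xx i (p * y) \<partial>unif)" for i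
    unfolding X_def Xx_def using mF[of "Suc i"] by (subst sample_mean_Suc) auto
  have YSuc: "Y (Suc i) = (\<integral>\<^sup>+y. Yx i (p + (1 - p) * y) \<partial>unif)" for i
    unfolding Y_def Yx_def using mG[of "Suc i"] by (subst sample_mean_Suc) auto
  let ?H = "\<lambda>xs. F (filter (\<lambda>x. x \<le> p) xs) * G (filter (\<lambda>x. p < x) xs)"
  have inner: "sample_mean n (\<lambda>xs. ?H (x # xs)) =
     (\<Sum>i\<le>n. ennreal (binomial_weight n p i) * (Xx i x * indicator {..p} x * Y (n - i))) +
     (\<Sum>i\<le>n. ennreal (binomial_weight n p i) * (X i * (Yx (n - i) x * indicator {p<..} x)))" for x
  proof (cases "x \<le> p")
    case True
    then have "sample_mean n (\<lambda>xs. ?H (x # xs)) =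
       sample_mean n (\<lambda>xs. F (x # filter (\<lambda>x. x \<le> p) xs) * G (filter (\<lambda>x. p < x) xs))"
      by simp
    also have "\<dots> = (\<Sum>i\<le>n. ennreal (binomial_weight n p i) * (Xx i x * Y (n - i)))"
      unfolding Xx_def Y_def
      by (rule Suc.IH[OF list_measurable_Cons]) (use Suc.prems in auto)
    finally show ?thesis using True by simp
  next
    case False
    then have "sample_mean n (\<lambda>xs. ?H (x # xs)) =
       sample_mean n (\<lambda>xs. F (filter (\<lambda>x. x \<le> p) xs) * G (x # filter (\<lambda>x. p < x) xs))"
      by simp
    also have "\<dots> = (\<Sum>i\<le>n. ennreal (binomial_weight n p i) * (X i * Yx (n - i) x))"
      unfolding X_def Yx_def
      by (rule Suc.IH[OF _ list_measurable_Cons]) (use Suc.prems in auto)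
    finally show ?thesis using False by simp
  qed
  have "sample_mean (Suc n) ?H = (\<integral>\<^sup>+x. sample_mean n (\<lambda>xs. ?H (x # xs)) \<partial>unif)"
    using m1[of "Suc n"] by (intro sample_mean_Suc borel_measurable_times_ennreal)
  also have "\<dots> =
     (\<Sum>i\<le>n. ennreal (binomial_weight n p i) * ((\<integral>\<^sup>+x. Xx i x * indicator {..p} x \<partial>unif) * Y (n - i))) +
     (\<Sum>i\<le>n. ennreal (binomial_weight n p i) * (X i * (\<integral>\<^sup>+x. Yx (n - i) x * indicator {p<..} x \<partial>unif)))"
  proof -
    have "(\<integral>\<^sup>+x. (\<Sum>i\<le>n. ennreal (binomial_weight n p i) * (Xx i x * indicator {..p} x * Y (n - i))) \<partial>unif) =
       (\<Sum>i\<le>n. ennreal (binomial_weight n p i) * ((\<integral>\<^sup>+x. Xx i x * indicator {..p} x \<partial>unif) * Y (n - i)))"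
      by (subst nn_integral_sum) (simp_all add: nn_integral_cmult nn_integral_multc)
    moreover have "(\<integral>\<^sup>+x. (\<Sum>i\<le>n. ennreal (binomial_weight n p i) * (X i * (Yx (n - i) x * indicator {p<..} x))) \<partial>unif) =
       (\<Sum>i\<le>n. ennreal (binomial_weight n p i) * (X i * (\<integral>\<^sup>+x. Yx (n - i) x * indicator {p<..} x \<partial>unif)))"
      by (subst nn_integral_sum) (simp_all add: nn_integral_cmult)
    ultimately show ?thesis
      unfolding inner by (subst nn_integral_add) simp_all
  qed
  also have "\<dots> =
     (\<Sum>i\<le>n. ennreal (binomial_weight n p i) * (ennreal p * (X (Suc i) * Y (n - i)))) +
     (\<Sum>i\<le>n. ennreal (binomial_weight n p i) * (ennreal (1 - p) * (X i * Y (Suc n - i))))"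
  proof -
    have "(\<integral>\<^sup>+x. Xx i x * indicator {..p} x \<partial>unif) * Y (n - i) = ennreal p * (X (Suc i) * Y (n - i))" for i
      by (simp only: nn_integral_unif_left[OF _ p] \<open>Xx i \<in> borel_measurable borel\<close> XSuc mult.assoc)
    moreover have "X i * (\<integral>\<^sup>+x. Yx (n - i) x * indicator {p<..} x \<partial>unif) = ennreal (1 - p) * (X i * Y (Suc n - i))"
      if "i \<le> n" for i
      unfolding Suc_diff_le[OF that] YSuc
      by (simp only: nn_integral_unif_right[OF _ p] \<open>Yx (n - i) \<in> borel_measurable borel\<close>) (rule mult.left_commute)
    ultimately show ?thesis by simp
  qed
  also have "\<dots> = (\<Sum>i\<le>n. ennreal (binomial_weight n p i) *
       (ennreal p * (X (Suc i) * Y (Suc n - Suc i)) + ennreal (1 - p) * (X i * Y (Suc n - i))))"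
    by (simp add: sum.distrib distrib_left)
  also have "\<dots> = (\<Sum>i\<le>Suc n. ennreal (binomial_weight (Suc n) p i) * (X i * Y (Suc n - i)))"
    using p by (subst sum_binomial_weight_Suc) auto
  finally show ?case unfolding X_def Y_def .
qed

section \<open>Beta integrals with a logarithm\<close>

lemma continuous_on_times_ln: "continuous_on {0..1} (\<lambda>x::real. x * ln x)"
proof -
  have "isCont (\<lambda>x::real. x * ln x) x" if "0 < x" for x
    using that by (intro continuous_intros) auto
  moreover have "((\<lambda>x::real. x * ln x) \<longlongrightarrow> 0) (at_right 0)" "((\<lambda>x::real. x * ln x) \<longlongrightarrow> 0) (at_left 1)"
    by real_asymp+
  ultimately show ?thesis
    by (intro continuous_on_IccI) (auto simp: isCont_def intro: filterlim_mono[OF _ order_refl at_le])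
qed

lemma continuous_on_times_ln_squared: "continuous_on {0..1} (\<lambda>x::real. x * (ln x)\<^sup>2)"
proof -
  have "isCont (\<lambda>x::real. x * (ln x)\<^sup>2) x" if "0 < x" for x
    using that by (intro continuous_intros) auto
  moreover have "((\<lambda>x::real. x * (ln x)\<^sup>2) \<longlongrightarrow> 0) (at_right 0)" "((\<lambda>x::real. x * (ln x)\<^sup>2) \<longlongrightarrow> 0) (at_left 1)"
    by real_asymp+
  ultimately show ?thesis
    by (intro continuous_on_IccI) (auto simp: isCont_def intro: filterlim_mono[OF _ order_refl at_le])
qed

lemma ln_squared_has_integral: "((\<lambda>x::real. (ln x)\<^sup>2) has_integral 2) {0..1}"
proof -
  have "((\<lambda>x::real. (ln x)\<^sup>2) has_integral
     (1 * (ln 1)\<^sup>2 - 2 * (1 * ln 1) + 2 * 1) - (0 * (ln 0)\<^sup>2 - 2 * (0 * ln 0) + 2 * 0)) {0..1::real}"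
  proof (rule fundamental_theorem_of_calculus_interior)
    show "continuous_on {0..1} (\<lambda>x::real. x * (ln x)\<^sup>2 - 2 * (x * ln x) + 2 * x)"
      by (intro continuous_intros continuous_on_times_ln continuous_on_times_ln_squared)
    show "((\<lambda>x. x * (ln x)\<^sup>2 - 2 * (x * ln x) + 2 * x) has_vector_derivative (ln x)\<^sup>2) (at x)"
      if "x \<in> {0<..<1}" for x :: real
      unfolding has_real_derivative_iff_has_vector_derivative[symmetric] using that
      by (auto intro!: derivative_eq_intros simp: power2_eq_square field_simps)
  qed simp
  then show ?thesis by simp
qed

text \<open>The value of the Beta function at \<open>(i + 1, m + 1)\<close>.\<close>

definition beta_coeff :: "nat \<Rightarrow> nat \<Rightarrow> real" where
  "beta_coeff i m = fact i * fact m / fact (i + m + 1)"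

lemma beta_coeff_Suc: "beta_coeff i (Suc m) = beta_coeff i m - beta_coeff (Suc i) m"
  by (simp add: beta_coeff_def divide_simps) (simp add: algebra_simps)

lemma beta_coeff_swap: "beta_coeff i (Suc m) * (real i + 1) = beta_coeff (Suc i) m * (real m + 1)"
  by (simp add: beta_coeff_def divide_simps add.commute)

lemma binomial_beta_coeff: "i \<le> n \<Longrightarrow> real (n choose i) * beta_coeff i (n - i) = 1 / (real n + 1)"
  by (simp add: beta_coeff_def binomial_fact divide_simps)

lemma beta_has_integral:
  "((\<lambda>p. p ^ i * (1 - p) ^ m) has_integral beta_coeff i m) {0..1::real}"
proof (induction m arbitrary: i)
  case 0
  have "((\<lambda>p. p ^ i) has_integral 1 ^ Suc i / real (Suc i) - 0 ^ Suc i / real (Suc i)) {0..1::real}"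
  proof (rule fundamental_theorem_of_calculus)
    show "((\<lambda>p. p ^ Suc i / real (Suc i)) has_vector_derivative x ^ i) (at x within {0..1})" for x :: real
      unfolding has_real_derivative_iff_has_vector_derivative[symmetric]
      by (rule derivative_eq_intros refl | simp)+
  qed simp
  then show ?case by (simp add: beta_coeff_def)
next
  case (Suc m)
  have "((\<lambda>p. p ^ i * (1 - p) ^ m - p ^ Suc i * (1 - p) ^ m) has_integral beta_coeff i (Suc m)) {0..1::real}"
    unfolding beta_coeff_Suc by (intro has_integral_diff Suc)
  then show ?case by (simp add: algebra_simps)
qed

text \<open>The mean of \<open>ln p\<close> under the Beta distribution with parameters \<open>(i + 1, m + 1)\<close> is
  \<open>H i - H (i + m + 1)\<close>.\<close>

lemma beta_ln_has_integral:
  "((\<lambda>p. p ^ i * (1 - p) ^ m * ln p) has_integral beta_coeff i m * (harm i - harm (i + m + 1))) {0..1::real}"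
proof (induction m arbitrary: i)
  case 0
  define F where "F p = p ^ i * (p * ln p) / real (Suc i) - p ^ Suc i / (real (Suc i))\<^sup>2" for p :: real
  have "((\<lambda>p. p ^ i * ln p) has_integral F 1 - F 0) {0..1::real}"
  proof (rule fundamental_theorem_of_calculus_interior)
    show "continuous_on {0..1} F"
      unfolding F_def by (intro continuous_intros continuous_on_times_ln) auto
    show "(F has_vector_derivative x ^ i * ln x) (at x)" if "x \<in> {0<..<1}" for x
    proof -
      have eq: "(F has_field_derivative d) (at x) \<longleftrightarrow>
        ((\<lambda>p. p ^ Suc i * ln p / real (Suc i) - p ^ Suc i / (real (Suc i))\<^sup>2) has_field_derivative d) (at x)" for d
        unfolding F_def by (simp add: mult_ac)
      have "((\<lambda>p. p ^ Suc i * ln p / real (Suc i) - p ^ Suc i / (real (Suc i))\<^sup>2) has_field_derivative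
         (real (Suc i) * x ^ i * ln x + x ^ Suc i * (1 / x)) / real (Suc i) - real (Suc i) * x ^ i / (real
             (Suc i))\<^sup>2) (at x)"
      proof (intro DERIV_diff DERIV_cdivide)
        show "((\<lambda>p. p ^ Suc i) has_field_derivative real (Suc i) * x ^ i) (at x)"
          by (rule derivative_eq_intros refl | simp)+
        show "((\<lambda>p. p ^ Suc i * ln p) has_field_derivative
            real (Suc i) * x ^ i * ln x + x ^ Suc i * (1 / x)) (at x)"
          using that by (auto intro!: derivative_eq_intros simp: field_simps simp del: of_nat_Suc power_Suc)
      qed
      also have "(real (Suc i) * x ^ i * ln x + x ^ Suc i * (1 / x)) / real (Suc i) - real (Suc i) * x ^ i /
          (real (Suc i))\<^sup>2
         = x ^ i * ln x"
        using that by (simp add: add_divide_distrib power2_eq_square del: of_nat_Suc)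
      finally show ?thesis
        unfolding has_real_derivative_iff_has_vector_derivative[symmetric] eq .
    qed
  qed simp
  moreover have "F 1 - F 0 = beta_coeff i 0 * (harm i - harm (i + 0 + 1))"
    by (simp add: F_def beta_coeff_def harm_Suc power2_eq_square inverse_eq_divide del: of_nat_Suc)
  ultimately show ?case by simp
next
  case (Suc m)
  have "beta_coeff i m * (harm i - harm (i + m + 1)) - beta_coeff (Suc i) m * (harm (Suc i) - harm (Suc i + m + 1))
     = beta_coeff i (Suc m) * (harm i - harm (i + Suc m + 1))"
  proof -
    define c where "c = beta_coeff (Suc i) m / (real i + 1)"
    have c: "beta_coeff (Suc i) m = c * (real i + 1)" by (simp add: c_def)
    have c': "beta_coeff i (Suc m) = c * (real m + 1)"
      using beta_coeff_swap[of i m] unfolding c_def by (simp add: field_simps)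
    have c'': "beta_coeff i m = c * (real m + 1) + c * (real i + 1)"
      using beta_coeff_Suc[of i m] unfolding c c' by simp
    have h: "harm (Suc i) = harm i + 1 / (real i + 1)"
      "harm (Suc i + m + 1) = harm (i + m + 1) + 1 / (real i + real m + 2)"
      "harm (i + Suc m + 1) = harm (i + m + 1) + 1 / (real i + real m + 2)"
      by (simp_all add: harm_Suc inverse_eq_divide add_ac)
    have nz: "real i + 1 \<noteq> 0" "real i + real m + 2 \<noteq> 0" by linarith+
    show ?thesis unfolding c c' c'' h using nz by (simp add: divide_simps) algebra
  qed
  then have "((\<lambda>p. p ^ i * (1 - p) ^ m * ln p - p ^ Suc i * (1 - p) ^ m * ln p) has_integral
     beta_coeff i (Suc m) * (harm i - harm (i + Suc m + 1))) {0..1::real}"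
    using has_integral_diff[OF Suc[of i] Suc[of "Suc i"]] by simp
  then show ?case by (simp add: algebra_simps)
qed

lemma sum_harm_lessThan: "(\<Sum>i<m. harm i) = real m * (harm m :: real) - real m"
proof (induction m)
  case (Suc m)
  have "real (Suc m) * inverse (real (Suc m)) = 1" by simp
  then have "real (Suc m) * harm (Suc m) = real (Suc m) * harm m + (1 :: real)"
    by (simp only: harm_Suc distrib_left)
  with Suc show ?case by (simp add: algebra_simps)
qed simp

lemma sum_harm_diff_squared:
  "(\<Sum>i<m. (harm i - harm m)\<^sup>2) = 2 * real m - (harm m :: real)"
proof (induction m)
  case (Suc m)
  define d where "d = 1 / real (Suc m)"
  have h: "harm (Suc m) = harm m + d" by (simp add: harm_Suc d_def inverse_eq_divide)
  have "(\<Sum>i<Suc m. (harm i - harm (Suc m))\<^sup>2) = (\<Sum>i<m. (harm i - harm m - d)\<^sup>2) + d\<^sup>2"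
    by (simp add: h power2_eq_square algebra_simps)
  also have "(\<Sum>i<m. (harm i - harm m - d)\<^sup>2) = (\<Sum>i<m. (harm i - harm m)\<^sup>2 - 2 * d * (harm i - harm m) + d\<^sup>2)"
    by (simp add: power2_eq_square algebra_simps)
  also have "\<dots> = 2 * real m - harm m - 2 * d * (- real m) + real m * d\<^sup>2"
    unfolding sum.distrib sum_subtractf sum_distrib_left[symmetric] Suc.IH sum_harm_lessThan by simp
  also have "\<dots> + d\<^sup>2 = 2 * real m - harm m + 2 * d * real m + d * (d * real (Suc m))"
    by (simp add: power2_eq_square algebra_simps)
  also have "d * real (Suc m) = 1" by (simp add: d_def)
  also have "2 * real m - harm m + 2 * d * real m + d * 1 = 2 * real m - harm m + 2 * (d * real (Suc m)) - d"
    by (simp add: algebra_simps)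
  also have "\<dots> = 2 * real (Suc m) - harm (Suc m)"
    unfolding \<open>d * real (Suc m) = 1\<close> h by simp
  finally show ?case .
qed (simp add: harm_def)

section \<open>Splitting at the root\<close>

lemma measurable_binomial_weight [measurable]: "(\<lambda>p. binomial_weight n p i) \<in> borel_measurable borel"
  unfolding binomial_weight_def by measurable

text \<open>The expectation of \<open>h i p\<close> when \<open>p\<close> is uniform and, given \<open>p\<close>, the index \<open>i\<close> is binomial with
  parameters \<open>n\<close> and \<open>p\<close>: the joint law of the size of a subtree at the root and the label that splits
  the other \<open>n\<close> elements.\<close>

definition root_mean :: "nat \<Rightarrow> (nat \<Rightarrow> real \<Rightarrow> ennreal) \<Rightarrow> ennreal" where
  "root_mean n h = (\<integral>\<^sup>+p. (\<Sum>i\<le>n. ennreal (binomial_weight n p i) * h i p) \<partial>unif)"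

lemma root_mean_mono:
  "(\<And>i p. i \<le> n \<Longrightarrow> 0 < p \<Longrightarrow> p < 1 \<Longrightarrow> g i p \<le> h i p) \<Longrightarrow> root_mean n g \<le> root_mean n h"
  unfolding root_mean_def
  by (rule nn_integral_mono_AE, use AE_unif in eventually_elim) (auto intro!: sum_mono mult_left_mono)

lemma root_mean_add:
  assumes [measurable]: "\<And>i. g i \<in> borel_measurable borel" "\<And>i. h i \<in> borel_measurable borel"
  shows "root_mean n (\<lambda>i p. g i p + h i p) = root_mean n g + root_mean n h"
  unfolding root_mean_def by (subst nn_integral_add[symmetric]) (auto simp: distrib_left sum.distrib)

lemma root_mean_cmult:
  assumes [measurable]: "\<And>i. g i \<in> borel_measurable borel"
  shows "root_mean n (\<lambda>i p. c * g i p) = c * root_mean n g"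
  unfolding root_mean_def by (subst nn_integral_cmult[symmetric]) (auto simp: sum_distrib_left mult_ac)

lemma root_mean_size: "root_mean n (\<lambda>i p. a i) = (\<Sum>i\<le>n. ennreal (1 / (real n + 1)) * a i)"
proof -
  have "(\<integral>\<^sup>+p. ennreal (binomial_weight n p i) \<partial>unif) = ennreal (1 / (real n + 1))" if "i \<le> n" for i
  proof (rule nn_integral_unif_has_integral)
    have "((\<lambda>p. real (n choose i) * (p ^ i * (1 - p) ^ (n - i))) has_integral
        real (n choose i) * beta_coeff i (n - i)) {0..1}"
      by (intro has_integral_mult_right beta_has_integral)
    then show "((\<lambda>p. binomial_weight n p i) has_integral 1 / (real n + 1)) {0..1}"
      unfolding binomial_beta_coeff[OF that] binomial_weight_def by (simp add: mult.assoc)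
  qed (auto intro: binomial_weight_nonneg)
  then show ?thesis
    unfolding root_mean_def by (subst nn_integral_sum) (auto simp: nn_integral_multc)
qed

lemma root_mean_reflect:
  assumes [measurable]: "\<And>i. h i \<in> borel_measurable borel"
  shows "root_mean n (\<lambda>i p. h (n - i) (1 - p)) = root_mean n h"
proof -
  have "(\<Sum>i\<le>n. ennreal (binomial_weight n p i) * h (n - i) (1 - p)) =
      (\<Sum>i\<le>n. ennreal (binomial_weight n (1 - p) i) * h i (1 - p))" for p
    by (rule sum.reindex_bij_witness[of _ "\<lambda>i. n - i" "\<lambda>i. n - i"])
      (auto simp: binomial_weight_def binomial_symmetric[symmetric] mult_ac)
  then have "root_mean n (\<lambda>i p. h (n - i) (1 - p)) =
      (\<integral>\<^sup>+p. (\<Sum>i\<le>n. ennreal (binomial_weight n (1 - p) i) * h i (1 - p)) \<partial>unif)"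
    unfolding root_mean_def by simp
  also have "\<dots> = root_mean n h"
    unfolding root_mean_def by (subst nn_integral_unif_reflect) auto
  finally show ?thesis .
qed

lemma sum_binomial_weight: "(\<Sum>i\<le>n. binomial_weight n p i) = 1"
  using binomial_ring[of p "1 - p" n] by (simp add: binomial_weight_def)

text \<open>Given \<open>i\<close>, the conditional mean of \<open>ln p\<close> is \<open>H i - H (n + 1)\<close>. The left-hand side is therefore
  the difference of the second moments of \<open>ln p\<close> and of \<open>H i - H (n + 1)\<close>, and the latter involves only
  the uniform law of \<open>i\<close>.\<close>

lemma root_mean_harm_ln:
  "root_mean n (\<lambda>i p. ennreal ((harm i - harm (Suc n) - ln p)\<^sup>2)) = ennreal (harm (Suc n) / real (Suc n))"
proof -
  define h :: "nat \<Rightarrow> real" where "h i = harm i - harm (Suc n)" for i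
  define f where "f p = (\<Sum>i\<le>n. binomial_weight n p i * (h i - ln p)\<^sup>2)" for p
  have f_eq: "f p = (\<Sum>i\<le>n. (h i)\<^sup>2 * (real (n choose i) * (p ^ i * (1 - p) ^ (n - i))) -
      2 * h i * (real (n choose i) * (p ^ i * (1 - p) ^ (n - i) * ln p))) + (ln p)\<^sup>2" for p
  proof -
    have "f p = (\<Sum>i\<le>n. ((h i)\<^sup>2 * binomial_weight n p i - 2 * h i * (binomial_weight n p i * ln p)) +
        binomial_weight n p i * (ln p)\<^sup>2)"
      unfolding f_def by (intro sum.cong) (auto simp: power2_eq_square algebra_simps)
    also have "\<dots> = (\<Sum>i\<le>n. (h i)\<^sup>2 * binomial_weight n p i - 2 * h i * (binomial_weight n p i * ln p)) + (ln p)\<^sup>2"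
      unfolding sum.distrib sum_distrib_right[symmetric] sum_binomial_weight by simp
    finally show ?thesis by (simp add: binomial_weight_def mult_ac)
  qed
  have "(f has_integral (\<Sum>i\<le>n. (h i)\<^sup>2 * (real (n choose i) * beta_coeff i (n - i)) -
      2 * h i * (real (n choose i) * (beta_coeff i (n - i) * (harm i - harm (i + (n - i) + 1))))) + 2) {0..1}"
    unfolding f_eq[abs_def]
    by (intro has_integral_add has_integral_sum has_integral_diff has_integral_mult_right
        beta_has_integral beta_ln_has_integral ln_squared_has_integral) auto
  also have "(\<Sum>i\<le>n. (h i)\<^sup>2 * (real (n choose i) * beta_coeff i (n - i)) -
      2 * h i * (real (n choose i) * (beta_coeff i (n - i) * (harm i - harm (i + (n - i) + 1))))) + 2
     = (\<Sum>i\<le>n. - ((h i)\<^sup>2 / (real n + 1))) + 2"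
  proof -
    have "(h i)\<^sup>2 * (real (n choose i) * beta_coeff i (n - i)) -
      2 * h i * (real (n choose i) * (beta_coeff i (n - i) * (harm i - harm (i + (n - i) + 1)))) =
      - ((h i)\<^sup>2 / (real n + 1))" if "i \<le> n" for i
    proof -
      have "harm i - harm (i + (n - i) + 1) = h i" using that by (simp add: h_def)
      then show ?thesis unfolding mult.assoc[symmetric, of "real (n choose i)"] binomial_beta_coeff[OF that]
        by (simp add: power2_eq_square)
    qed
    then show ?thesis by simp
  qed
  also have "\<dots> = 2 - (\<Sum>i<Suc n. (harm i - harm (Suc n))\<^sup>2) / (real n + 1)"
    by (simp add: sum_negf sum_divide_distrib h_def lessThan_Suc_atMost)
  also have "\<dots> = harm (Suc n) / real (Suc n)"
    unfolding sum_harm_diff_squared by (simp add: field_simps)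
  finally have int: "(f has_integral harm (Suc n) / real (Suc n)) {0..1}" .
  have "root_mean n (\<lambda>i p. ennreal ((h i - ln p)\<^sup>2)) = (\<integral>\<^sup>+p. ennreal (f p) \<partial>unif)"
    unfolding root_mean_def
  proof (rule nn_integral_cong_AE, use AE_unif in eventually_elim)
    fix p :: real assume p: "0 < p \<and> p < 1"
    then have "ennreal (binomial_weight n p i) * ennreal ((h i - ln p)\<^sup>2) = ennreal (binomial_weight n p i *
        (h i - ln p)\<^sup>2)" for i
      by (intro ennreal_mult[symmetric] binomial_weight_nonneg) auto
    then show "(\<Sum>i\<le>n. ennreal (binomial_weight n p i) * ennreal ((h i - ln p)\<^sup>2)) = ennreal (f p)"
      unfolding f_def using p by (simp add: sum_ennreal binomial_weight_nonneg)
  qed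
  also have "\<dots> = ennreal (harm (Suc n) / real (Suc n))"
  proof (rule nn_integral_unif_has_integral[OF int])
    show "0 \<le> f p" if "0 \<le> p" "p \<le> 1" for p
      unfolding f_def using that by (intro sum_nonneg mult_nonneg_nonneg binomial_weight_nonneg) auto
    show "f \<in> borel_measurable borel" unfolding f_def by measurable
  qed
  finally show ?thesis by (simp add: h_def)
qed

text \<open>The first element of the stream is the splitting value; counted are those of the next \<open>n\<close> elements
  that do not exceed it.\<close>

definition split_count :: "nat \<Rightarrow> real stream \<Rightarrow> nat" where
  "split_count n s = length (filter (\<lambda>x. x \<le> shd s) (stake n (stl s)))"

lemma split_count_le: "split_count n s \<le> n"
  unfolding split_count_def using length_filter_le[of _ "stake n (stl s)"] by simp

lemma measurable_shd_borel [measurable]: "shd \<in> borel_measurable unif_stream"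
  using measurable_snth_borel[of 0] by simp

lemma measurable_split_count [measurable]: "split_count n \<in> unif_stream \<rightarrow>\<^sub>M count_space UNIV"
proof -
  have *: "stake n (stl s) = map (\<lambda>f. f s) (map (\<lambda>i s. s !! Suc i) [0..<n])" for s
    by (rule nth_equalityI) auto
  have "(\<lambda>s. length (filter (\<lambda>x. x \<le> shd s) (map (\<lambda>f. f s) (map (\<lambda>i s. s !! Suc i) [0..<n]))))
     \<in> unif_stream \<rightarrow>\<^sub>M count_space UNIV"
    by (rule measurable_filter_map) (auto simp del: snth.simps)
  then show ?thesis unfolding split_count_def[abs_def] * .
qed

lemma sample_mean_cong: "(\<And>xs. length xs = n \<Longrightarrow> F xs = G xs) \<Longrightarrow> sample_mean n F = sample_mean n G"
  unfolding sample_mean_def by (intro nn_integral_cong) simp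

lemma sample_mean_const: "sample_mean n (\<lambda>_. c) = c"
  by (simp add: sample_mean_def unif_stream.emeasure_space_1)

lemma nn_integral_split_count:
  assumes [measurable]: "\<And>i. h i \<in> borel_measurable borel"
  shows "(\<integral>\<^sup>+s. h (split_count n s) (shd s) \<partial>unif_stream) = root_mean n h"
proof -
  have "(\<lambda>s. h (split_count n s) (shd s)) \<in> borel_measurable unif_stream"
    by (rule measurable_compose_countable[where f = "\<lambda>i s. h i (shd s)"]) auto
  then have "(\<integral>\<^sup>+s. h (split_count n s) (shd s) \<partial>unif_stream) =
     (\<integral>\<^sup>+p. sample_mean n (\<lambda>xs. h (length (filter (\<lambda>x. x \<le> p) xs)) p * 1) \<partial>unif)"
    by (subst unif.nn_integral_stream_space) (auto simp: split_count_def sample_mean_def)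
  also have "\<dots> = root_mean n h"
    unfolding root_mean_def
  proof (rule nn_integral_cong_AE, use AE_unif in eventually_elim)
    fix p :: real assume p: "0 < p \<and> p < 1"
    have "sample_mean i (\<lambda>xs. h (length (map ((*) p) xs)) p) = h i p" for i
      using sample_mean_cong[of i "\<lambda>xs. h (length (map ((*) p) xs)) p" "\<lambda>_. h i p"] by (simp add: sample_mean_const)
    then show "sample_mean n (\<lambda>xs. h (length (filter (\<lambda>x. x \<le> p) xs)) p * 1) =
        (\<Sum>i\<le>n. ennreal (binomial_weight n p i) * h i p)"
      using p by (subst sample_mean_split) (auto simp: list_measurable_def sample_mean_const)
  qed
  finally show ?thesis .
qed

text \<open>The probability that the search tree of \<open>n\<close> independent uniform labels has shape \<open>T\<close>.\<close>

definition shape_prob :: "nat \<Rightarrow> node set \<Rightarrow> ennreal" where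
  "shape_prob n T = sample_mean n (\<lambda>xs. indicator {T} (bst_shape xs))"

lemma list_measurable_shape_indicator:
  "list_measurable borel (\<lambda>xs. indicator {T} (bst_shape xs) :: ennreal)"
  unfolding list_measurable_def
proof
  show "(\<lambda>s. indicator {T} (bst_shape (stake n s)) :: ennreal) \<in> borel_measurable unif_stream" for n
    by (rule measurable_compose[OF list_measurable_bst_shape[unfolded list_measurable_def, rule_format]]) auto
qed

lemma shape_prob_0: "shape_prob 0 T = indicator {{}} T"
  by (auto simp: shape_prob_def sample_mean_0 bst_shape_simps indicator_def)

lemma shape_prob_Suc_not_node:
  assumes "\<And>L R. T \<noteq> tree_node L R"
  shows "shape_prob (Suc n) T = 0"
proof -
  have "sample_mean (Suc n) (\<lambda>xs. indicator {T} (bst_shape xs)) = sample_mean (Suc n) (\<lambda>_. 0)"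
  proof (rule sample_mean_cong)
    fix xs :: "real list" assume "length xs = Suc n"
    then obtain a ys where "xs = a # ys" by (cases xs) auto
    then have "bst_shape xs \<noteq> T" using assms by (metis bst_shape_simps(2))
    then show "indicator {T} (bst_shape xs) = (0 :: ennreal)" by simp
  qed
  then show ?thesis by (simp add: shape_prob_def sample_mean_const)
qed

lemma shape_prob_Suc_node:
  "shape_prob (Suc n) (tree_node L R) =
    (\<Sum>i\<le>n. ennreal (1 / (real n + 1)) * (shape_prob i L * shape_prob (n - i) R))"
proof -
  have "shape_prob (Suc n) (tree_node L R) =
     (\<integral>\<^sup>+p. sample_mean n (\<lambda>xs. indicator {L} (bst_shape (filter (\<lambda>x. x \<le> p) xs)) * indicator {R} (bst_shape
         (filter (\<lambda>x. p < x) xs))) \<partial>unif)"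
  proof -
    have "(indicator {tree_node L R} (bst_shape (p # xs)) :: ennreal) =
        indicator {L} (bst_shape (filter (\<lambda>x. x \<le> p) xs)) * indicator {R} (bst_shape (filter (\<lambda>x. p < x) xs))" for p xs
      by (auto simp: bst_shape_simps tree_node_inject indicator_def)
    then show ?thesis unfolding shape_prob_def
      by (subst sample_mean_Suc[OF list_measurable_shape_indicator[unfolded list_measurable_def, rule_format]]) simp
  qed
  also have "\<dots> = root_mean n (\<lambda>i p. shape_prob i L * shape_prob (n - i) R)"
    unfolding root_mean_def
  proof (rule nn_integral_cong_AE, use AE_unif in eventually_elim)
    fix p :: real assume p: "0 < p \<and> p < 1"
    have "strict_mono (\<lambda>y. p * y)" "strict_mono (\<lambda>y. p + (1 - p) * y)"
      using p by (auto simp: strict_mono_def)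
    then show "sample_mean n (\<lambda>xs. indicator {L} (bst_shape (filter (\<lambda>x. x \<le> p) xs)) * indicator {R}
        (bst_shape (filter (\<lambda>x. p < x) xs)))
      = (\<Sum>i\<le>n. ennreal (binomial_weight n p i) * (shape_prob i L * shape_prob (n - i) R))"
      using p by (subst sample_mean_split)
        (auto simp: list_measurable_shape_indicator bst_shape_strict_mono shape_prob_def)
  qed
  finally show ?thesis by (simp add: root_mean_size)
qed

section \<open>The space of independent splits\<close>

text \<open>The probability space that carries an independent stream of independent uniform variables at every
  node.\<close>

definition split_space :: "(node \<Rightarrow> real stream) measure" where
  "split_space = (\<Pi>\<^sub>M u\<in>UNIV. unif_stream)"

lemma sets_split_space [measurable_cong]: "sets split_space = sets (\<Pi>\<^sub>M u\<in>UNIV. unif_stream)"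
  by (simp add: split_space_def)

interpretation node_product: product_prob_space "\<lambda>u :: node. unif_stream" UNIV ..

interpretation split_space: prob_space split_space
  unfolding split_space_def by (rule node_product.P.prob_space_axioms)

interpretation split_pair: pair_prob_space split_space split_space ..

lemma space_unif_stream [simp]: "space unif_stream = UNIV"
  by (simp add: space_stream_space)

lemma space_split_space [simp]: "space split_space = UNIV"
  by (simp add: split_space_def space_PiM)

lemma measurable_split_space_component [measurable]:
  "(\<lambda>\<omega>. \<omega> u) \<in> split_space \<rightarrow>\<^sub>M unif_stream"
  unfolding split_space_def by (rule measurable_component_singleton) simp

text \<open>The streams of the left or right subtree of the root, indexed by the nodes of that subtree.\<close>

definition descend :: "bool \<Rightarrow> (node \<Rightarrow> 'b) \<Rightarrow> node \<Rightarrow> 'b" where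
  "descend b \<omega> u = \<omega> (b # u)"

text \<open>The family of streams that has the stream \<open>s\<close> at the root and the given families below it.\<close>

definition graft :: "(node \<Rightarrow> 'b) \<Rightarrow> (node \<Rightarrow> 'b) \<Rightarrow> 'b \<Rightarrow> node \<Rightarrow> 'b" where
  "graft \<omega>0 \<omega>1 s u = (case u of [] \<Rightarrow> s | b # v \<Rightarrow> if b then \<omega>1 v else \<omega>0 v)"

lemma graft_simps [simp]:
  "descend False (graft \<omega>0 \<omega>1 s) = \<omega>0" "descend True (graft \<omega>0 \<omega>1 s) = \<omega>1" "graft \<omega>0 \<omega>1 s [] = s"
  by (simp_all add: descend_def graft_def fun_eq_iff)

lemma measurable_into_split_space:
  assumes "\<And>u. (\<lambda>x. f x u) \<in> N \<rightarrow>\<^sub>M unif_stream"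
  shows "f \<in> N \<rightarrow>\<^sub>M split_space"
  unfolding split_space_def using assms by (intro measurable_PiM_single') (auto simp: PiE_def)

lemma measurable_descend [measurable]: "descend b \<in> split_space \<rightarrow>\<^sub>M split_space"
  by (rule measurable_into_split_space) (simp add: descend_def)

lemma measurable_graft:
  "(\<lambda>z. graft (fst z) (fst (snd z)) (snd (snd z))) \<in> split_space \<Otimes>\<^sub>M (split_space \<Otimes>\<^sub>M unif_stream) \<rightarrow>\<^sub>M split_space"
proof (rule measurable_into_split_space)
  show "(\<lambda>z. graft (fst z) (fst (snd z)) (snd (snd z)) u) \<in> split_space \<Otimes>\<^sub>M (split_space \<Otimes>\<^sub>M unif_stream) \<rightarrow>\<^sub>M
      unif_stream" for u
    by (cases u) (auto simp: graft_def)
qed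

lemma emeasure_split_space_box:
  assumes "finite J" "\<And>u. u \<in> J \<Longrightarrow> F u \<in> sets unif_stream"
  shows "emeasure split_space {\<omega>. \<forall>u\<in>J. \<omega> u \<in> F u} = (\<Prod>u\<in>J. emeasure unif_stream (F u))"
  using node_product.emeasure_PiM_Collect[of J F] assms by (simp add: split_space_def space_PiM)

lemma sets_split_space_box:
  assumes "finite J" "\<And>u. u \<in> J \<Longrightarrow> F u \<in> sets unif_stream"
  shows "{\<omega>. \<forall>u\<in>J. \<omega> u \<in> F u} \<in> sets split_space"
proof -
  have "{\<omega> \<in> space split_space. \<forall>u\<in>J. \<omega> u \<in> F u} \<in> sets split_space"
    using assms by measurable
  then show ?thesis by simp
qed

text \<open>The stream at the root and the families of the two subtrees are independent, and both families
  have the law of the whole family. All recursions below rest on this self-similarity.\<close>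

lemma distr_graft:
  "distr (split_space \<Otimes>\<^sub>M (split_space \<Otimes>\<^sub>M unif_stream)) split_space
     (\<lambda>z. graft (fst z) (fst (snd z)) (snd (snd z))) = split_space"
  (is "distr ?P _ ?j = _")
proof -
  have "distr ?P split_space ?j = PiM UNIV (\<lambda>_. unif_stream)"
  proof (rule node_product.PiM_eq)
    \<comment> \<open>Both measures are compared on boxes with finitely many restricted coordinates.\<close>
    show "sets (distr ?P split_space ?j) = sets (PiM UNIV (\<lambda>_. unif_stream))"
      by (simp add: split_space_def)
    fix J :: "node set" and F assume J: "finite J" and F: "\<And>j. j \<in> J \<Longrightarrow> F j \<in> sets unif_stream"
    define G where "G u = (if u \<in> J then F u else UNIV)" for u
    have G [measurable]: "G u \<in> sets unif_stream" for u
      using F sets.top[of unif_stream] by (simp add: G_def)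
    define L where "L b = {v. b # v \<in> J}" for b
    have fin: "finite (L b)" for b
      unfolding L_def using finite_vimageI[OF J, of "Cons b"] by (simp add: vimage_def)
    let ?K = "tree_node (L False) (L True)"
    have K: "J \<subseteq> ?K" "finite ?K"
    proof
      fix u assume "u \<in> J"
      then show "u \<in> ?K"
      proof (cases u)
        case (Cons b v)
        with \<open>u \<in> J\<close> show ?thesis by (cases b) (auto simp: tree_node_def L_def image_iff)
      qed (simp add: tree_node_def)
    qed (simp add: fin finite_tree_node)
    have emb: "prod_emb UNIV (\<lambda>_. unif_stream) J (Pi\<^sub>E J F) = {\<omega>. \<forall>u\<in>J. \<omega> u \<in> F u}"
      by (auto simp: prod_emb_def PiE_iff)
    have "?j -` {\<omega>. \<forall>u\<in>J. \<omega> u \<in> F u} =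
       {\<omega>. \<forall>v\<in>L False. \<omega> v \<in> G (False # v)} \<times> ({\<omega>. \<forall>v\<in>L True. \<omega> v \<in> G (True # v)} \<times> G [])"
    proof (intro set_eqI iffI)
      fix z assume z: "z \<in> ?j -` {\<omega>. \<forall>u\<in>J. \<omega> u \<in> F u}"
      obtain a b s where [simp]: "z = (a, b, s)" by (cases z) auto
      have *: "graft a b s u \<in> G u" for u using z by (auto simp: G_def)
      show "z \<in> {\<omega>. \<forall>v\<in>L False. \<omega> v \<in> G (False # v)} \<times> ({\<omega>. \<forall>v\<in>L True. \<omega> v \<in> G (True # v)} \<times> G [])"
        using *[of "[]"] *[of "False # _"] *[of "True # _"] by (auto simp: graft_def)
    next
      fix z assume z: "z \<in> {\<omega>. \<forall>v\<in>L False. \<omega> v \<in> G (False # v)} \<times> ({\<omega>. \<forall>v\<in>L True. \<omega> v \<in> G (True # v)} \<times> G [])"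
      obtain a b s where [simp]: "z = (a, b, s)" by (cases z) auto
      have "graft a b s u \<in> G u" if "u \<in> J" for u
        using z that by (cases u) (auto simp: graft_def L_def)
      then show "z \<in> ?j -` {\<omega>. \<forall>u\<in>J. \<omega> u \<in> F u}" by (auto simp: G_def)
    qed
    moreover have "{\<omega>. \<forall>u\<in>J. \<omega> u \<in> F u} \<in> sets split_space"
      using J F by (rule sets_split_space_box)
    ultimately have "emeasure (distr ?P split_space ?j) {\<omega>. \<forall>u\<in>J. \<omega> u \<in> F u} = emeasure ?P
       ({\<omega>. \<forall>v\<in>L False. \<omega> v \<in> G (False # v)} \<times> ({\<omega>. \<forall>v\<in>L True. \<omega> v \<in> G (True # v)} \<times> G []))"
      by (simp add: emeasure_distr measurable_graft space_pair_measure)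
    also have "\<dots> = (\<Prod>v\<in>L False. emeasure unif_stream (G (False # v))) *
       ((\<Prod>v\<in>L True. emeasure unif_stream (G (True # v))) * emeasure unif_stream (G []))"
    proof -
      interpret S: pair_prob_space split_space unif_stream ..
      have b1: "{\<omega>. \<forall>v\<in>L False. \<omega> v \<in> G (False # v)} \<in> sets split_space"
        and b2: "{\<omega>. \<forall>v\<in>L True. \<omega> v \<in> G (True # v)} \<in> sets split_space"
        by (auto intro!: sets_split_space_box fin)
      have "{\<omega>. \<forall>v\<in>L True. \<omega> v \<in> G (True # v)} \<times> G [] \<in> sets (split_space \<Otimes>\<^sub>M unif_stream)"
        using b2 by auto
      then show ?thesis using b1 b2
        by (subst S.P.emeasure_pair_measure_Times, simp, simp, subst unif_stream.emeasure_pair_measure_Times)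
          (simp_all add: emeasure_split_space_box fin)
    qed
    also have "\<dots> = (\<Prod>u\<in>?K. emeasure unif_stream (G u))"
    proof -
      have "(\<Prod>u\<in>?K. emeasure unif_stream (G u)) = emeasure unif_stream (G []) *
         (\<Prod>u\<in>Cons False ` L False \<union> Cons True ` L True. emeasure unif_stream (G u))"
        unfolding tree_node_def using fin by (subst prod.insert) auto
      also have "(\<Prod>u\<in>Cons False ` L False \<union> Cons True ` L True. emeasure unif_stream (G u)) =
         (\<Prod>u\<in>Cons False ` L False. emeasure unif_stream (G u)) * (\<Prod>u\<in>Cons True ` L True. emeasure unif_stream (G u))"
        using fin by (intro prod.union_disjoint) auto
      finally show ?thesis by (simp add: prod.reindex mult_ac)
    qed
    also have "\<dots> = (\<Prod>u\<in>J. emeasure unif_stream (F u))"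
      using K unif_stream.emeasure_space_1
      by (intro prod.mono_neutral_cong_right) (auto simp: G_def)
    finally show "emeasure (distr ?P split_space ?j) (prod_emb UNIV (\<lambda>_. unif_stream) J (Pi\<^sub>E J F)) =
       (\<Prod>u\<in>J. emeasure unif_stream (F u))"
      unfolding emb .
  qed
  then show ?thesis by (simp add: split_space_def)
qed

lemma nn_integral_split:
  assumes f: "f \<in> borel_measurable split_space"
  shows "(\<integral>\<^sup>+\<omega>. f \<omega> \<partial>split_space) =
    (\<integral>\<^sup>+s. \<integral>\<^sup>+\<omega>0. \<integral>\<^sup>+\<omega>1. f (graft \<omega>0 \<omega>1 s) \<partial>split_space \<partial>split_space \<partial>unif_stream)"
proof -
  interpret S: pair_prob_space split_space unif_stream ..
  have j [measurable]: "(\<lambda>z. f (graft (fst z) (fst (snd z)) (snd (snd z)))) \<in>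
      borel_measurable (split_space \<Otimes>\<^sub>M (split_space \<Otimes>\<^sub>M unif_stream))"
    using f by (rule measurable_compose[OF measurable_graft])
  have m: "(\<lambda>z. f (graft (g z) (h z) (k z))) \<in> borel_measurable N"
    if "g \<in> N \<rightarrow>\<^sub>M split_space" "h \<in> N \<rightarrow>\<^sub>M split_space" "k \<in> N \<rightarrow>\<^sub>M unif_stream" for g h k and N :: "'x measure"
  proof -
    have "(\<lambda>z. (g z, (h z, k z))) \<in> N \<rightarrow>\<^sub>M split_space \<Otimes>\<^sub>M (split_space \<Otimes>\<^sub>M unif_stream)"
      using that by simp
    from measurable_compose[OF this j] show ?thesis by simp
  qed
  have "(\<integral>\<^sup>+\<omega>. f \<omega> \<partial>split_space) =
     (\<integral>\<^sup>+z. f (graft (fst z) (fst (snd z)) (snd (snd z))) \<partial>(split_space \<Otimes>\<^sub>M (split_space \<Otimes>\<^sub>M unif_stream)))"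
    by (subst distr_graft[symmetric], subst nn_integral_distr[OF measurable_graft]) (simp_all add: f)
  also have "\<dots> = (\<integral>\<^sup>+\<omega>0. \<integral>\<^sup>+z. f (graft \<omega>0 (fst z) (snd z)) \<partial>(split_space \<Otimes>\<^sub>M unif_stream) \<partial>split_space)"
    using S.P.nn_integral_fst[OF j] by simp
  also have "\<dots> = (\<integral>\<^sup>+\<omega>0. \<integral>\<^sup>+s. \<integral>\<^sup>+\<omega>1. f (graft \<omega>0 \<omega>1 s) \<partial>split_space \<partial>unif_stream \<partial>split_space)"
  proof (rule nn_integral_cong)
    fix \<omega>0
    show "(\<integral>\<^sup>+z. f (graft \<omega>0 (fst z) (snd z)) \<partial>(split_space \<Otimes>\<^sub>M unif_stream)) =
      (\<integral>\<^sup>+s. \<integral>\<^sup>+\<omega>1. f (graft \<omega>0 \<omega>1 s) \<partial>split_space \<partial>unif_stream)"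
      by (subst S.nn_integral_snd[symmetric]) (auto intro!: m)
  qed
  also have "\<dots> = (\<integral>\<^sup>+s. \<integral>\<^sup>+\<omega>0. \<integral>\<^sup>+\<omega>1. f (graft \<omega>0 \<omega>1 s) \<partial>split_space \<partial>split_space \<partial>unif_stream)"
  proof (rule S.Fubini'[symmetric])
    have "(\<lambda>(z, \<omega>1). f (graft (fst z) \<omega>1 (snd z))) \<in> borel_measurable ((split_space \<Otimes>\<^sub>M unif_stream) \<Otimes>\<^sub>M split_space)"
      unfolding case_prod_beta' by (rule m) auto
    then have "(\<lambda>z. \<integral>\<^sup>+\<omega>1. f (graft (fst z) \<omega>1 (snd z)) \<partial>split_space) \<in> borel_measurable (split_space \<Otimes>\<^sub>M unif_stream)"
      by (rule split_space.borel_measurable_nn_integral)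
    then show "(\<lambda>(\<omega>0, s). \<integral>\<^sup>+\<omega>1. f (graft \<omega>0 \<omega>1 s) \<partial>split_space) \<in> borel_measurable (split_space \<Otimes>\<^sub>M unif_stream)"
      by (simp add: case_prod_beta')
  qed
  finally show ?thesis .
qed

lemma distr_descend: "distr split_space split_space (descend b) = split_space"
proof -
  have "distr (PiM UNIV (\<lambda>_. unif_stream)) (PiM UNIV (\<lambda>_. unif_stream)) (\<lambda>\<omega>. \<lambda>u\<in>UNIV. \<omega> (b # u)) =
    PiM UNIV (\<lambda>u :: node. unif_stream)"
    by (rule distr_PiM_reindex) (auto intro: unif_stream.prob_space_axioms)
  then show ?thesis unfolding split_space_def descend_def[abs_def] by (simp only: restrict_UNIV)
qed

lemma integral_descend:
  "(f :: _ \<Rightarrow> real) \<in> borel_measurable split_space \<Longrightarrow> (LINT \<omega>|split_space. f (descend b \<omega>)) = (LINT \<omega>|split_space. f \<omega>)"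
  by (subst (2) distr_descend[symmetric, of b]) (simp add: integral_distr)

lemma integrable_descend:
  "integrable split_space (f :: _ \<Rightarrow> real) \<Longrightarrow> integrable split_space (\<lambda>\<omega>. f (descend b \<omega>))"
  by (rule integrable_distr[OF measurable_descend]) (simp add: distr_descend)

lemma AE_descend: "AE \<omega> in split_space. Q \<omega> \<Longrightarrow> AE \<omega> in split_space. Q (descend b \<omega>)"
  by (rule AE_distrD[OF measurable_descend]) (simp only: distr_descend)

text \<open>The tree with \<open>n\<close> nodes that is driven by the streams. The number of elements sent to the right is
  the number of those not exceeding the splitting value, so that the right subtree receives a fraction
  of about \<open>p\<close> of the elements. This orientation, opposite to that of a search tree, has the same law
  and matches the logarithms of the splitting values on right steps in \<open>rho_rep\<close>.\<close>

function random_tree :: "nat \<Rightarrow> (node \<Rightarrow> real stream) \<Rightarrow> node set" where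
  "random_tree 0 \<omega> = {}"
| "random_tree (Suc n) \<omega> = tree_node (random_tree (n - split_count n (\<omega> [])) (descend False \<omega>))
     (random_tree (split_count n (\<omega> [])) (descend True \<omega>))"
  by pat_completeness auto
termination
  by (relation "inv_image less_than fst") (auto simp: le_imp_less_Suc split_count_le)

lemma random_tree_tree: "binary_tree (random_tree n \<omega>) \<and> card (random_tree n \<omega>) = n"
proof (induction n \<omega> rule: random_tree.induct)
  case (1 \<omega>)
  then show ?case by (simp add: binary_tree_def)
next
  case (2 n \<omega>)
  then show ?case using split_count_le[of n "\<omega> []"]
    by (simp add: binary_tree_tree_node) (simp add: card_tree_node binary_tree_def)
qed

lemma finite_random_tree: "finite (random_tree n \<omega>)"
  using random_tree_tree[of n \<omega>] by (simp add: binary_tree_def)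

lemma measurable_split_count_atMost: "(\<lambda>\<omega>. split_count n (\<omega> [])) \<in> split_space \<rightarrow>\<^sub>M count_space {..n}"
proof -
  have "split_count n \<in> unif_stream \<rightarrow>\<^sub>M count_space {..n}"
    by (rule measurable_count_space_extend[where B = UNIV]) (auto simp: split_count_le)
  then show ?thesis by (rule measurable_compose[OF measurable_split_space_component])
qed

lemma measurable_random_tree: "random_tree n \<in> split_space \<rightarrow>\<^sub>M tree_space"
proof (induction n rule: less_induct)
  case (less n)
  show ?case
  proof (cases n)
    case 0
    have "random_tree n = (\<lambda>\<omega>. {})" using 0 by auto
    then show ?thesis by simp
  next
    case (Suc m)
    have "(\<lambda>\<omega>. tree_node (random_tree (m - i) (descend False \<omega>)) (random_tree i (descend True \<omega>))) \<in>
        split_space \<rightarrow>\<^sub>M tree_space"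
      if "i \<in> {..m}" for i
      by (intro measurable_tree_node measurable_compose[OF measurable_descend] less) (use that Suc in auto)
    from measurable_compose_countable'[OF this measurable_split_count_atMost]
    show ?thesis unfolding Suc by (simp add: fun_eq_iff cong: measurable_cong)
  qed
qed

lemma measurable_fun_random_tree: "(\<lambda>\<omega>. g (random_tree n \<omega>) :: 'b) \<in> split_space \<rightarrow>\<^sub>M N"
  if "\<And>T. g T \<in> space N"
  by (rule measurable_compose[OF measurable_random_tree]) (use that in auto)

text \<open>Both sides satisfy the recursion of \<open>shape_prob_Suc_node\<close> in the tree; the exchange of the roles
  of left and right only reverses the sum over the sizes.\<close>

lemma nn_integral_random_tree_indicator:
  "(\<integral>\<^sup>+\<omega>. indicator {T} (random_tree n \<omega>) \<partial>split_space) = shape_prob n T"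
proof (induction n arbitrary: T rule: less_induct)
  case (less n)
  show ?case
  proof (cases n)
    case 0
    have "indicator {T} {} = (indicator {{}} T :: ennreal)" by (auto simp: indicator_def)
    then show ?thesis
      using split_space.emeasure_space_1 by (simp add: 0 shape_prob_0)
  next
    case (Suc m)
    show ?thesis
    proof (cases "\<exists>L R. T = tree_node L R")
      case False
      then have "random_tree (Suc m) \<omega> \<noteq> T" for \<omega> by auto
      then show ?thesis using False by (simp add: Suc shape_prob_Suc_not_node)
    next
      case True
      then obtain L R where T: "T = tree_node L R" by auto
      have meas [measurable]: "(\<lambda>\<omega>. indicator {T} (random_tree k \<omega>) :: ennreal) \<in> borel_measurable split_space" for T k
        by (rule measurable_fun_random_tree) simp
      have "(\<integral>\<^sup>+\<omega>. indicator {T} (random_tree n \<omega>) \<partial>split_space) =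
        (\<integral>\<^sup>+s. \<integral>\<^sup>+\<omega>0. \<integral>\<^sup>+\<omega>1. indicator {L} (random_tree (m - split_count m s) \<omega>0) *
            indicator {R} (random_tree (split_count m s) \<omega>1) \<partial>split_space \<partial>split_space \<partial>unif_stream)"
        unfolding Suc T
        by (subst nn_integral_split[OF meas]) (auto intro!: nn_integral_cong simp: tree_node_inject indicator_def)
      also have "\<dots> = (\<integral>\<^sup>+s. shape_prob (m - split_count m s) L * shape_prob (split_count m s) R \<partial>unif_stream)"
        by (simp add: nn_integral_cmult nn_integral_multc less Suc le_imp_less_Suc split_count_le)
      also have "\<dots> = root_mean m (\<lambda>i p. shape_prob (m - i) L * shape_prob i R)"
        by (rule nn_integral_split_count) simp
      also have "\<dots> = (\<Sum>i\<le>m. ennreal (1 / (real m + 1)) * (shape_prob (m - i) L * shape_prob i R))"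
        by (rule root_mean_size)
      also have "\<dots> = shape_prob n T"
        unfolding Suc T shape_prob_Suc_node
        by (rule sum.reindex_bij_witness[of _ "\<lambda>i. m - i" "\<lambda>i. m - i"]) auto
      finally show ?thesis .
    qed
  qed
qed

section \<open>Centred square-integrable functions\<close>

text \<open>Square-integrable functions with mean zero.\<close>

definition centred :: "'b measure \<Rightarrow> ('b \<Rightarrow> real) \<Rightarrow> bool" where
  "centred M X \<longleftrightarrow> X \<in> borel_measurable M \<and> integrable M (\<lambda>\<omega>. (X \<omega>)\<^sup>2) \<and> (LINT \<omega>|M. X \<omega>) = 0"

abbreviation second_moment :: "'b measure \<Rightarrow> ('b \<Rightarrow> real) \<Rightarrow> real" where
  "second_moment M X \<equiv> LINT \<omega>|M. (X \<omega>)\<^sup>2"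

lemma centredD:
  assumes "centred M X"
  shows "X \<in> borel_measurable M" "integrable M (\<lambda>\<omega>. (X \<omega>)\<^sup>2)" "(LINT \<omega>|M. X \<omega>) = 0"
  using assms by (auto simp: centred_def)

lemma second_moment_nonneg: "0 \<le> second_moment M X"
  by simp

lemma (in prob_space) integrable_centred: "centred M X \<Longrightarrow> integrable M X"
  by (auto simp: centred_def intro: square_integrable_imp_integrable)

lemma nn_integral_second_moment:
  "centred M X \<Longrightarrow> (\<integral>\<^sup>+\<omega>. ennreal ((X \<omega>)\<^sup>2) \<partial>M) = ennreal (second_moment M X)"
  by (intro nn_integral_eq_integral) (auto simp: centred_def)

lemma (in prob_space) nn_integral_centred_square:
  assumes X: "centred M X"
  shows "(\<integral>\<^sup>+\<omega>. ennreal ((X \<omega> / 2 + c)\<^sup>2) \<partial>M) = ennreal (second_moment M X / 4 + c\<^sup>2)"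
proof -
  have eq: "(X \<omega> / 2 + c)\<^sup>2 = (X \<omega>)\<^sup>2 / 4 + c * X \<omega> + c\<^sup>2" for \<omega>
    by (simp add: power2_eq_square field_simps)
  have i: "integrable M (\<lambda>\<omega>. (X \<omega>)\<^sup>2 / 4 + c * X \<omega> + c\<^sup>2)"
    using centredD(2)[OF X] integrable_centred[OF X] by auto
  have "(\<integral>\<^sup>+\<omega>. ennreal ((X \<omega> / 2 + c)\<^sup>2) \<partial>M) = ennreal (LINT \<omega>|M. (X \<omega> / 2 + c)\<^sup>2)"
    by (intro nn_integral_eq_integral) (use i in \<open>simp_all only: eq[symmetric] zero_le_power2 AE_I2\<close>)
  also have "(LINT \<omega>|M. (X \<omega> / 2 + c)\<^sup>2) = second_moment M X / 4 + c\<^sup>2"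
    unfolding eq using centredD(2)[OF X] integrable_centred[OF X] centredD(3)[OF X]
    by (simp add: prob_space)
  finally show ?thesis .
qed

text \<open>The mixed term vanishes, because \<open>X\<close> and \<open>Y\<close> have mean zero and are evaluated at independent
  points.\<close>

lemma nn_integral_average_square:
  assumes X: "centred split_space X" and Y: "centred split_space Y"
  shows "(\<integral>\<^sup>+\<omega>0. \<integral>\<^sup>+\<omega>1. ennreal (((X \<omega>0 + Y \<omega>1) / 2 + c)\<^sup>2) \<partial>split_space \<partial>split_space) =
    ennreal (second_moment split_space X / 4 + second_moment split_space Y / 4 + c\<^sup>2)"
proof -
  note [measurable] = centredD(1)[OF X]
  have eq: "(X \<omega>0 + Y \<omega>1) / 2 + c = Y \<omega>1 / 2 + (X \<omega>0 / 2 + c)" for \<omega>0 \<omega>1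
    by (simp add: field_simps)
  have "(\<integral>\<^sup>+\<omega>0. \<integral>\<^sup>+\<omega>1. ennreal (((X \<omega>0 + Y \<omega>1) / 2 + c)\<^sup>2) \<partial>split_space \<partial>split_space) =
    (\<integral>\<^sup>+\<omega>0. ennreal (second_moment split_space Y / 4) + ennreal ((X \<omega>0 / 2 + c)\<^sup>2) \<partial>split_space)"
    unfolding eq split_space.nn_integral_centred_square[OF Y] by (simp add: ennreal_plus)
  also have "\<dots> = ennreal (second_moment split_space Y / 4) + ennreal (second_moment split_space X / 4 + c\<^sup>2)"
    by (subst nn_integral_add)
      (auto simp: split_space.nn_integral_centred_square[OF X] split_space.emeasure_space_1[simplified])
  finally show ?thesis by (simp add: ennreal_plus[symmetric] add_ac del: ennreal_plus)
qed

lemma distr_split_space_component: "distr split_space unif_stream (\<lambda>\<omega>. \<omega> u) = unif_stream"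
  using node_product.PiM_component[of u] by (simp add: split_space_def)

lemma centred_graft:
  assumes X: "centred split_space X" and Y: "centred split_space Y" and b: "centred unif_stream b"
  shows "centred split_space (\<lambda>\<omega>. (X (descend False \<omega>) + Y (descend True \<omega>)) / 2 + b (\<omega> []))" (is "centred _ ?Z")
    and "second_moment split_space (\<lambda>\<omega>. (X (descend False \<omega>) + Y (descend True \<omega>)) / 2 + b (\<omega> [])) =
      second_moment split_space X / 4 + second_moment split_space Y / 4 + second_moment unif_stream b"
proof -
  note [measurable] = centredD(1)[OF X] centredD(1)[OF Y] centredD(1)[OF b]
  let ?m = "second_moment split_space X / 4 + second_moment split_space Y / 4"
  have "(\<integral>\<^sup>+\<omega>. ennreal ((?Z \<omega>)\<^sup>2) \<partial>split_space) = (\<integral>\<^sup>+s. ennreal (?m + (b s)\<^sup>2) \<partial>unif_stream)"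
    by (subst nn_integral_split) (simp_all add: nn_integral_average_square[OF X Y])
  also have "\<dots> = (\<integral>\<^sup>+s. ennreal ?m + ennreal ((b s)\<^sup>2) \<partial>unif_stream)"
    by (intro nn_integral_cong ennreal_plus) auto
  also have "\<dots> = ennreal ?m + ennreal (second_moment unif_stream b)"
    by (subst nn_integral_add)
      (auto simp: nn_integral_second_moment[OF b] unif_stream.emeasure_space_1[simplified])
  also have "\<dots> = ennreal (?m + second_moment unif_stream b)"
    by (intro ennreal_plus[symmetric]) auto
  finally have *: "integrable split_space (\<lambda>\<omega>. (?Z \<omega>)\<^sup>2) \<and>
     second_moment split_space ?Z = ?m + second_moment unif_stream b"
    by (subst (asm) nn_integral_eq_integrable) auto
  then show "second_moment split_space ?Z = ?m + second_moment unif_stream b" by simp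
  have i: "integrable split_space (\<lambda>\<omega>. X (descend False \<omega>))" "integrable split_space (\<lambda>\<omega>. Y (descend True \<omega>))"
    using integrable_descend split_space.integrable_centred X Y by blast+
  have bi: "integrable split_space (\<lambda>\<omega>. b (\<omega> []))"
    by (rule integrable_distr[OF measurable_split_space_component])
      (simp add: distr_split_space_component unif_stream.integrable_centred[OF b])
  have "(LINT \<omega>|split_space. b (\<omega> [])) = (LINT s|unif_stream. b s)"
    using integral_distr[OF measurable_split_space_component centredD(1)[OF b], of "[]"]
    by (simp add: distr_split_space_component)
  then have "(LINT \<omega>|split_space. ?Z \<omega>) = 0"
    using i bi by (simp add: integral_descend centredD(3)[OF X] centredD(3)[OF Y] centredD(3)[OF b])
  then show "centred split_space ?Z" using * unfolding centred_def by simp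
qed

section \<open>The limit of the centred mean silhouette\<close>

lemma distr_shd: "distr unif_stream unif shd = unif"
proof (rule measure_eqI)
  fix A assume "A \<in> sets (distr unif_stream unif shd)"
  then have A [measurable]: "A \<in> sets borel" by simp
  have "emeasure (distr unif_stream unif shd) A = (\<integral>\<^sup>+x. indicator A x \<partial>distr unif_stream unif shd)"
    by (rule nn_integral_indicator[symmetric]) simp
  also have "\<dots> = (\<integral>\<^sup>+s. indicator A (shd s) \<partial>unif_stream)"
    by (rule nn_integral_distr) simp_all
  also have "\<dots> = emeasure unif A"
    by (subst unif.nn_integral_stream_space)
      (simp_all add: unif_stream.emeasure_space_1[simplified])
  finally show "emeasure (distr unif_stream unif shd) A = emeasure unif A" .
qed simp

lemma integrable_shd: "integrable unif (f :: real \<Rightarrow> real) \<Longrightarrow> integrable unif_stream (\<lambda>s. f (shd s))"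
  by (rule integrable_distr[of shd unif_stream unif]) (simp_all add: distr_shd)

lemma integral_shd: "(f :: real \<Rightarrow> real) \<in> borel_measurable borel \<Longrightarrow> (LINT s|unif_stream. f (shd s)) = (LINT x|unif. f x)"
  by (subst (2) distr_shd[symmetric]) (simp add: integral_distr)

lemma measurable_zeta_infty [measurable]: "zeta_infty \<in> borel_measurable borel"
  unfolding zeta_infty_def[abs_def] by measurable

lemma unif_ln:
  "integrable unif (\<lambda>x. (ln x)\<^sup>2)" "integrable unif ln" "(LINT x|unif. ln x) = -1"
proof -
  have "(\<integral>\<^sup>+x. ennreal ((ln x)\<^sup>2) \<partial>unif) = ennreal 2"
    by (rule nn_integral_unif_has_integral[OF ln_squared_has_integral]) auto
  then show sq: "integrable unif (\<lambda>x. (ln x)\<^sup>2)"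
    by (subst (asm) nn_integral_eq_integrable) auto
  show "integrable unif ln"
    by (rule unif.square_integrable_imp_integrable[OF _ sq]) simp
  have "(ln has_integral -1) {0..1::real}"
    using beta_ln_has_integral[of 0 0] by (simp add: beta_coeff_def harm_def)
  from has_integral_neg[OF this] have "((\<lambda>p. - ln p) has_integral 1) {0..1::real}" by simp
  then have "(\<integral>\<^sup>+x. ennreal (- ln x) \<partial>unif) = ennreal 1"
  proof (rule nn_integral_unif_has_integral)
    show "0 \<le> - ln x" if "0 \<le> x" "x \<le> 1" for x :: real
      using that by (cases "x = 0") auto
  qed simp
  moreover have "AE x in unif. 0 \<le> - ln x"
    using AE_unif by eventually_elim auto
  ultimately have "(LINT x|unif. - ln x) = 1"
    by (subst (asm) nn_integral_eq_integrable) auto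
  then show "(LINT x|unif. ln x) = -1" by simp
qed

lemma distr_unif_reflect: "distr unif unif (\<lambda>x. 1 - x) = unif"
proof (rule measure_eqI)
  fix A assume "A \<in> sets (distr unif unif (\<lambda>x. 1 - x))"
  then have A [measurable]: "A \<in> sets borel" by simp
  have "emeasure (distr unif unif (\<lambda>x. 1 - x)) A = (\<integral>\<^sup>+x. indicator A x \<partial>distr unif unif (\<lambda>x. 1 - x))"
    by (rule nn_integral_indicator[symmetric]) simp
  also have "\<dots> = (\<integral>\<^sup>+x. indicator A (1 - x) \<partial>unif)"
    by (rule nn_integral_distr) simp_all
  also have "\<dots> = emeasure unif A"
    by (subst nn_integral_unif_reflect) simp_all
  finally show "emeasure (distr unif unif (\<lambda>x. 1 - x)) A = emeasure unif A" .
qed simp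

lemma unif_ln_reflect:
  "integrable unif (\<lambda>x. (ln (1 - x))\<^sup>2)" "integrable unif (\<lambda>x. ln (1 - x))" "(LINT x|unif. ln (1 - x)) = -1"
proof -
  show "integrable unif (\<lambda>x. (ln (1 - x))\<^sup>2)" "integrable unif (\<lambda>x. ln (1 - x))"
    using integrable_distr[of "\<lambda>x. 1 - x" unif unif "\<lambda>x. (ln x)\<^sup>2"]
      integrable_distr[of "\<lambda>x. 1 - x" unif unif ln]
    by (simp_all add: distr_unif_reflect unif_ln)
  have "(LINT x|unif. ln (1 - x)) = (LINT x|distr unif unif (\<lambda>x. 1 - x). ln x)"
    by (simp add: integral_distr)
  then show "(LINT x|unif. ln (1 - x)) = -1" by (simp add: distr_unif_reflect unif_ln)
qed

lemma centred_zeta: "centred unif_stream (\<lambda>s. zeta_infty (shd s))"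
proof -
  have "integrable unif (\<lambda>x. (zeta_infty x)\<^sup>2)"
  proof (rule Bochner_Integration.integrable_bound)
    show "integrable unif (\<lambda>x. 2 + ((ln x)\<^sup>2 + (ln (1 - x))\<^sup>2))"
      by (intro Bochner_Integration.integrable_add unif_ln unif_ln_reflect) auto
    show "AE x in unif. norm ((zeta_infty x)\<^sup>2) \<le> norm (2 + ((ln x)\<^sup>2 + (ln (1 - x))\<^sup>2))"
    proof (rule AE_I2)
      fix x :: real
      define a b where "a = ln x" and "b = ln (1 - x)"
      have bound: "z \<le> 2 + q" if "z = p / 4" "p + m + 2 * d = 8 + 4 * q" "0 \<le> m" "0 \<le> d" for p m d q z :: real
        using that by linarith
      have "(1 + (a + b) / 2)\<^sup>2 \<le> 2 + (a\<^sup>2 + b\<^sup>2)"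
      proof (rule bound)
        show "(1 + (a + b) / 2)\<^sup>2 = (2 + (a + b))\<^sup>2 / 4"
          by (simp add: power2_eq_square field_simps)
        show "(2 + (a + b))\<^sup>2 + (2 - (a + b))\<^sup>2 + 2 * (a - b)\<^sup>2 = 8 + 4 * (a\<^sup>2 + b\<^sup>2)"
          by algebra
      qed simp_all
      then have "(zeta_infty x)\<^sup>2 \<le> 2 + (a\<^sup>2 + b\<^sup>2)"
        unfolding zeta_infty_def a_def[symmetric] b_def[symmetric] .
      then show "norm ((zeta_infty x)\<^sup>2) \<le> norm (2 + ((ln x)\<^sup>2 + (ln (1 - x))\<^sup>2))"
        by (simp add: a_def b_def)
    qed
  qed simp
  moreover have "(LINT x|unif. zeta_infty x) = 0"
    unfolding zeta_infty_def using unif_ln unif_ln_reflect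
    by (simp add: unif.prob_space[simplified])
  ultimately show ?thesis
    unfolding centred_def using integrable_shd[of "\<lambda>x. (zeta_infty x)\<^sup>2"] by (simp add: integral_shd)
qed

text \<open>The contribution of the nodes at depth \<open>l\<close> to the limit, \<open>2^-l\<close> times the sum of \<open>zeta_infty\<close> over
  the splitting values at these nodes.\<close>

primrec level_sum :: "nat \<Rightarrow> (node \<Rightarrow> real stream) \<Rightarrow> real" where
  "level_sum 0 \<omega> = zeta_infty (shd (\<omega> []))"
| "level_sum (Suc l) \<omega> = (level_sum l (descend False \<omega>) + level_sum l (descend True \<omega>)) / 2"

text \<open>The variance of \<open>zeta_infty\<close> at a uniform argument.\<close>

abbreviation zeta_variance :: real where
  "zeta_variance \<equiv> second_moment unif_stream (\<lambda>s. zeta_infty (shd s))"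

lemma centred_zero: "centred M (\<lambda>_. 0)"
  by (simp add: centred_def)

lemma level_sum_moments:
  "centred split_space (level_sum l) \<and> second_moment split_space (level_sum l) = zeta_variance / 2 ^ l"
proof (induction l)
  case 0
  show ?case
    using centred_graft[OF centred_zero centred_zero centred_zeta] by (simp add: fun_eq_iff cong:
        Bochner_Integration.integral_cong)
next
  case (Suc l)
  then have "centred split_space (level_sum l)" by simp
  from centred_graft[OF this this centred_zero] Suc show ?case
    by simp
qed

text \<open>The contribution of the nodes at depth less than \<open>n\<close> to the limit.\<close>

definition level_partial_sum :: "nat \<Rightarrow> (node \<Rightarrow> real stream) \<Rightarrow> real" where
  "level_partial_sum n \<omega> = (\<Sum>l<n. level_sum l \<omega>)"

lemma level_partial_sum_Suc:
  "level_partial_sum (Suc n) \<omega> =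
    (level_partial_sum n (descend False \<omega>) + level_partial_sum n (descend True \<omega>)) / 2 + zeta_infty (shd (\<omega> []))"
  unfolding level_partial_sum_def
  by (subst sum.lessThan_Suc_shift) (simp add: sum.distrib sum_divide_distrib add_divide_distrib)

lemma level_partial_sum_moments:
  "centred split_space (level_partial_sum n) \<and> second_moment split_space (level_partial_sum n) \<le> 2 * zeta_variance"
proof (induction n)
  case 0
  have "level_partial_sum 0 = (\<lambda>_. 0)" by (simp add: level_partial_sum_def fun_eq_iff)
  then show ?case by (simp add: centred_zero)
next
  case (Suc n)
  have eq: "level_partial_sum (Suc n) = (\<lambda>\<omega>. (level_partial_sum n (descend False \<omega>) + level_partial_sum n
      (descend True \<omega>)) / 2
      + zeta_infty (shd (\<omega> [])))"
    by (simp add: level_partial_sum_Suc fun_eq_iff)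
  have IH: "centred split_space (level_partial_sum n)" using Suc by simp
  have "second_moment split_space (level_partial_sum (Suc n)) =
     second_moment split_space (level_partial_sum n) / 2 + zeta_variance"
    unfolding eq centred_graft(2)[OF IH IH centred_zeta] by simp
  also have "\<dots> \<le> 2 * zeta_variance" using Suc by simp
  finally show ?case using centred_graft(1)[OF IH IH centred_zeta] unfolding eq by simp
qed

lemma measurable_level_sum [measurable]: "level_sum l \<in> borel_measurable split_space"
  using level_sum_moments by (simp add: centred_def)

lemma integrable_level_sum: "integrable split_space (level_sum l)"
  using level_sum_moments split_space.integrable_centred by blast

lemma summable_integral_level_sum: "summable (\<lambda>l. LINT \<omega>|split_space. norm (level_sum l \<omega>))"
proof (rule summable_comparison_test)
  show "summable (\<lambda>l. ((3 / 4) ^ l + zeta_variance * (2 / 3) ^ l) / 2)"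
    by (intro summable_divide summable_add summable_mult summable_geometric) auto
  show "\<exists>N. \<forall>l\<ge>N. norm (LINT \<omega>|split_space. norm (level_sum l \<omega>)) \<le> ((3 / 4) ^ l + zeta_variance * (2 / 3) ^ l) / 2"
  proof (intro exI allI impI)
    fix l :: nat
    \<comment> \<open>The inequality of the means, \<open>2 |x| \<le> a + x^2 / a\<close>, bounds the first moment by the second; any
      ratio of \<open>a\<close> strictly between \<open>1/2\<close> and \<open>1\<close> makes both resulting series converge.\<close>
    define a :: real where "a = (3 / 4) ^ l"
    have a: "a > 0" by (simp add: a_def)
    have "norm x \<le> (a + x\<^sup>2 / a) / 2" for x :: real
    proof -
      have "0 \<le> (a - \<bar>x\<bar>)\<^sup>2" by simp
      then have "2 * \<bar>x\<bar> * a \<le> a * a + x\<^sup>2" by (simp add: power2_eq_square algebra_simps)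
      then show ?thesis using a by (simp add: field_simps)
    qed
    moreover have sq: "integrable split_space (\<lambda>\<omega>. (level_sum l \<omega>)\<^sup>2)"
      using level_sum_moments[of l] by (simp add: centred_def)
    ultimately have "(LINT \<omega>|split_space. norm (level_sum l \<omega>)) \<le> (LINT \<omega>|split_space. (a + (level_sum l \<omega>)\<^sup>2 / a) / 2)"
      by (intro integral_mono) (auto intro: integrable_level_sum)
    also have "\<dots> = (a + zeta_variance / 2 ^ l / a) / 2"
      using sq level_sum_moments[of l] by (simp add: split_space.prob_space[simplified])
    also have "zeta_variance / 2 ^ l / a = zeta_variance * (2 / 3) ^ l"
      by (simp add: a_def power_divide field_simps flip: power_mult_distrib)
    finally show "norm (LINT \<omega>|split_space. norm (level_sum l \<omega>)) \<le> ((3 / 4) ^ l + zeta_variance * (2 / 3) ^ l) / 2"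
      by (simp add: a_def)
  qed
qed

lemma AE_summable_level_sum: "AE \<omega> in split_space. summable (\<lambda>l. norm (level_sum l \<omega>))"
proof -
  have "(\<integral>\<^sup>+\<omega>. (\<Sum>l. ennreal (norm (level_sum l \<omega>))) \<partial>split_space) = (\<Sum>l. \<integral>\<^sup>+\<omega>. ennreal (norm (level_sum l \<omega>))
      \<partial>split_space)"
    by (intro nn_integral_suminf) auto
  also have "\<dots> = (\<Sum>l. ennreal (LINT \<omega>|split_space. norm (level_sum l \<omega>)))"
    by (intro arg_cong[where f = suminf] ext nn_integral_eq_integral integrable_norm integrable_level_sum) auto
  also have "\<dots> \<noteq> \<infinity>"
    unfolding infinity_ennreal_def by (rule ennreal_suminf_neq_top[OF summable_integral_level_sum]) simp
  finally have "AE \<omega> in split_space. (\<Sum>l. ennreal (norm (level_sum l \<omega>))) \<noteq> \<infinity>"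
    by (intro nn_integral_PInf_AE) auto
  then show ?thesis
    by eventually_elim (rule summable_suminf_not_top, simp_all)
qed

text \<open>The almost sure limit of the centred mean silhouette. Where the series diverges, which happens
  with probability zero, the value is irrelevant.\<close>

definition eta_limit :: "(node \<Rightarrow> real stream) \<Rightarrow> real" where
  "eta_limit \<omega> = (\<Sum>l. level_sum l \<omega>)"

lemma measurable_eta_limit [measurable]: "eta_limit \<in> borel_measurable split_space"
  unfolding eta_limit_def[abs_def] by measurable

lemma AE_eta_limit_rec:
  "AE \<omega> in split_space. eta_limit \<omega> =
    (eta_limit (descend False \<omega>) + eta_limit (descend True \<omega>)) / 2 + zeta_infty (shd (\<omega> []))"
  using AE_descend[OF AE_summable_level_sum, of False] AE_descend[OF AE_summable_level_sum, of True]
      AE_summable_level_sum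
proof eventually_elim
  fix \<omega>
  assume s: "summable (\<lambda>l. norm (level_sum l (descend False \<omega>)))" "summable (\<lambda>l. norm (level_sum l (descend True \<omega>)))"
    "summable (\<lambda>l. norm (level_sum l \<omega>))"
  note s' = s[THEN summable_norm_cancel]
  have "eta_limit \<omega> = (\<Sum>l. level_sum (Suc l) \<omega>) + level_sum 0 \<omega>"
    unfolding eta_limit_def using suminf_split_head[OF s'(3)] by simp
  also have "(\<Sum>l. level_sum (Suc l) \<omega>) = (eta_limit (descend False \<omega>) + eta_limit (descend True \<omega>)) / 2"
    using s'(1,2) by (simp add: eta_limit_def suminf_divide suminf_add summable_add)
  finally show "eta_limit \<omega> =
    (eta_limit (descend False \<omega>) + eta_limit (descend True \<omega>)) / 2 + zeta_infty (shd (\<omega> []))" by simp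
qed

lemma centred_eta_limit: "centred split_space eta_limit"
  unfolding centred_def
proof (intro conjI)
  show "eta_limit \<in> borel_measurable split_space" by simp
  have "(LINT \<omega>|split_space. eta_limit \<omega>) = (\<Sum>l. LINT \<omega>|split_space. level_sum l \<omega>)"
    unfolding eta_limit_def
    by (rule integral_suminf[OF integrable_level_sum AE_summable_level_sum summable_integral_level_sum])
  then show "(LINT \<omega>|split_space. eta_limit \<omega>) = 0"
    using level_sum_moments by (simp add: centred_def)
  have [measurable]: "level_partial_sum n \<in> borel_measurable split_space" for n
    unfolding level_partial_sum_def[abs_def] by measurable
  \<comment> \<open>Fatou's lemma for the squares of the partial sums.\<close>
  have "(\<integral>\<^sup>+\<omega>. ennreal ((eta_limit \<omega>)\<^sup>2) \<partial>split_space) = (\<integral>\<^sup>+\<omega>. liminf (\<lambda>n. ennreal ((level_partial_sum n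
      \<omega>)\<^sup>2)) \<partial>split_space)"
  proof (rule nn_integral_cong_AE, use AE_summable_level_sum in eventually_elim)
    fix \<omega> assume "summable (\<lambda>l. norm (level_sum l \<omega>))"
    then have "(\<lambda>n. level_partial_sum n \<omega>) \<longlonglongrightarrow> eta_limit \<omega>"
      unfolding level_partial_sum_def eta_limit_def by (rule summable_LIMSEQ[OF summable_norm_cancel])
    then have "(\<lambda>n. ennreal ((level_partial_sum n \<omega>)\<^sup>2)) \<longlonglongrightarrow> ennreal ((eta_limit \<omega>)\<^sup>2)"
      by (intro tendsto_ennrealI tendsto_power)
    then show "ennreal ((eta_limit \<omega>)\<^sup>2) = liminf (\<lambda>n. ennreal ((level_partial_sum n \<omega>)\<^sup>2))"
      by (rule lim_imp_Liminf[OF trivial_limit_sequentially, symmetric])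
  qed
  also have "\<dots> \<le> liminf (\<lambda>n. \<integral>\<^sup>+\<omega>. ennreal ((level_partial_sum n \<omega>)\<^sup>2) \<partial>split_space)"
    by (rule nn_integral_liminf) simp
  also have "\<dots> \<le> liminf (\<lambda>n :: nat. ennreal (2 * zeta_variance))"
    using level_partial_sum_moments
    by (intro Liminf_mono always_eventually allI) (simp add: nn_integral_second_moment ennreal_leI del: ennreal_plus)
  also have "\<dots> < \<infinity>" by (simp add: Liminf_const)
  finally show "integrable split_space (\<lambda>\<omega>. (eta_limit \<omega>)\<^sup>2)"
    by (intro integrableI_bounded) auto
qed

section \<open>Uniqueness of the limit law\<close>

lemma is_eta_infty_law_eta_limit: "is_eta_infty_law (distr split_space borel eta_limit)"
proof -
  let ?\<mu> = "distr split_space borel eta_limit"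
  let ?f = "\<lambda>(x, y, z). (x + y) / 2 + zeta_infty z"
  let ?P = "split_space \<Otimes>\<^sub>M (split_space \<Otimes>\<^sub>M unif_stream)"
  have prob: "prob_space ?\<mu>" by (rule split_space.prob_space_distr) simp
  interpret \<mu>: prob_space ?\<mu> by fact
  have f [measurable]: "?f \<in> borel_measurable (borel \<Otimes>\<^sub>M (borel \<Otimes>\<^sub>M borel))" by measurable
  have "?\<mu> = distr split_space borel
     (\<lambda>\<omega>. ?f (eta_limit (descend False \<omega>), eta_limit (descend True \<omega>), shd (\<omega> [])))"
    using AE_eta_limit_rec by (intro distr_cong_AE) auto
  also have "\<dots> = distr (distr ?P split_space (\<lambda>z. graft (fst z) (fst (snd z)) (snd (snd z)))) borel
     (\<lambda>\<omega>. ?f (eta_limit (descend False \<omega>), eta_limit (descend True \<omega>), shd (\<omega> [])))"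
    by (simp only: distr_graft)
  also have "\<dots> = distr ?P borel (\<lambda>(\<omega>0, \<omega>1, s). ?f (eta_limit \<omega>0, eta_limit \<omega>1, shd s))"
    by (subst distr_distr[OF _ measurable_graft]) (auto simp: o_def case_prod_beta')
  also have "\<dots> = distr (distr ?P (borel \<Otimes>\<^sub>M (borel \<Otimes>\<^sub>M unif)) (\<lambda>(\<omega>0, \<omega>1, s). (eta_limit \<omega>0, eta_limit \<omega>1, shd
      s))) borel ?f"
    by (subst distr_distr) (auto simp: o_def case_prod_beta')
  also have "distr ?P (borel \<Otimes>\<^sub>M (borel \<Otimes>\<^sub>M unif)) (\<lambda>(\<omega>0, \<omega>1, s). (eta_limit \<omega>0, eta_limit \<omega>1, shd s)) = ?\<mu>
      \<Otimes>\<^sub>M (?\<mu> \<Otimes>\<^sub>M unif)"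
  proof -
    have "?\<mu> \<Otimes>\<^sub>M unif = distr (split_space \<Otimes>\<^sub>M unif_stream) (borel \<Otimes>\<^sub>M unif) (\<lambda>(\<omega>1, s). (eta_limit \<omega>1, shd s))"
      by (subst (1) distr_shd[symmetric], subst pair_measure_distr)
        (simp_all add: distr_shd unif.sigma_finite_measure_axioms)
    moreover have "?\<mu> \<Otimes>\<^sub>M distr (split_space \<Otimes>\<^sub>M unif_stream) (borel \<Otimes>\<^sub>M unif) (\<lambda>(\<omega>1, s). (eta_limit \<omega>1, shd s)) =
       distr ?P (borel \<Otimes>\<^sub>M (borel \<Otimes>\<^sub>M unif)) (\<lambda>(x, y). (eta_limit x, (\<lambda>(\<omega>1, s). (eta_limit \<omega>1, shd s)) y))"
    proof (rule pair_measure_distr)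
      interpret S: pair_prob_space split_space unif_stream ..
      show "sigma_finite_measure (distr (split_space \<Otimes>\<^sub>M unif_stream) (borel \<Otimes>\<^sub>M unif) (\<lambda>(\<omega>1, s). (eta_limit
          \<omega>1, shd s)))"
        by (intro prob_space_imp_sigma_finite S.P.prob_space_distr) simp
    qed simp_all
    ultimately show ?thesis by (simp add: case_prod_beta')
  qed
  finally have eq: "?\<mu> = distr (?\<mu> \<Otimes>\<^sub>M (?\<mu> \<Otimes>\<^sub>M unif)) borel ?f" .
  have "integrable ?\<mu> (\<lambda>x. x\<^sup>2)" "(LINT x|?\<mu>. x) = 0"
    using centredD[OF centred_eta_limit] by (simp_all add: integrable_distr_eq integral_distr)
  then show ?thesis
    unfolding is_eta_infty_law_def unif_def[symmetric] using prob eq by simp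
qed

lemma is_eta_infty_law_char:
  assumes "is_eta_infty_law \<mu>"
  shows "char \<mu> t = (char \<mu> (t / 2))\<^sup>2 * (CLINT z|unif. iexp (t * zeta_infty z))"
proof -
  have \<mu>: "prob_space \<mu>" "sets \<mu> = sets borel"
    and eq: "\<mu> = distr (\<mu> \<Otimes>\<^sub>M (\<mu> \<Otimes>\<^sub>M unif)) borel (\<lambda>(x, y, z). (x + y) / 2 + zeta_infty z)"
    using assms by (auto simp: is_eta_infty_law_def unif_def[symmetric])
  interpret \<mu>: prob_space \<mu> by fact
  interpret \<mu>u: pair_prob_space \<mu> unif ..
  interpret \<mu>\<mu>u: pair_prob_space \<mu> "\<mu> \<Otimes>\<^sub>M unif" ..
  note [measurable_cong] = \<mu>(2)
  let ?g = "\<lambda>x y z. iexp (t / 2 * x) * (iexp (t / 2 * y) * iexp (t * zeta_infty z))"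
  have m: "(\<lambda>(x, y, z). (x + y) / 2 + zeta_infty z) \<in> borel_measurable (\<mu> \<Otimes>\<^sub>M (\<mu> \<Otimes>\<^sub>M unif))"
    by measurable
  have "char \<mu> t = (CLINT w|\<mu> \<Otimes>\<^sub>M (\<mu> \<Otimes>\<^sub>M unif). ?g (fst w) (fst (snd w)) (snd (snd w)))"
    unfolding char_def
    by (subst eq, subst integral_distr[OF m])
      (auto intro!: Bochner_Integration.integral_cong simp: exp_add[symmetric] field_simps)
  also have "\<dots> = (CLINT x|\<mu>. CLINT v|\<mu> \<Otimes>\<^sub>M unif. ?g x (fst v) (snd v))"
    by (subst \<mu>\<mu>u.integral_fst'[symmetric]) (auto intro!: \<mu>\<mu>u.P.integrable_const_bound[where B = 1] simp: norm_mult)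
  also have "(\<lambda>x. CLINT v|\<mu> \<Otimes>\<^sub>M unif. ?g x (fst v) (snd v)) = (\<lambda>x. CLINT y|\<mu>. CLINT z|unif. ?g x y z)"
    by (intro ext, subst \<mu>u.integral_fst'[symmetric]) (auto intro!: \<mu>u.P.integrable_const_bound[where B = 1]
        simp: norm_mult)
  also have "(CLINT x|\<mu>. CLINT y|\<mu>. CLINT z|unif. ?g x y z) = (char \<mu> (t / 2))\<^sup>2 * (CLINT z|unif. iexp (t *
      zeta_infty z))"
    by (simp add: char_def power2_eq_square)
  finally show ?thesis .
qed

text \<open>The first-order term is absent because the mean is zero.\<close>

lemma is_eta_infty_law_char_bound:
  assumes "is_eta_infty_law \<mu>"
  shows "cmod (char \<mu> t - 1) \<le> 2 * (LINT x|\<mu>. x\<^sup>2) * t\<^sup>2"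
proof -
  have \<mu>: "prob_space \<mu>" "sets \<mu> = sets borel" and sq: "integrable \<mu> (\<lambda>x. x\<^sup>2)" and mean: "(LINT x|\<mu>. x) = 0"
    using assms by (auto simp: is_eta_infty_law_def)
  interpret \<mu>: real_distribution \<mu>
    using \<mu> sets_eq_imp_space_eq[OF \<mu>(2)] by (simp add: real_distribution_def real_distribution_axioms_def)
  have i1: "integrable \<mu> (\<lambda>x. x)"
    by (rule \<mu>.square_integrable_imp_integrable[OF _ sq]) simp
  define m where "m = (LINT x|\<mu>. x\<^sup>2)"
  have m: "m \<ge> 0" by (simp add: m_def)
  have "integrable \<mu> (\<lambda>x. x ^ k)" if "k \<le> 2" for k
  proof -
    from that have "k = 0 \<or> k = 1 \<or> k = 2" by auto
    then show ?thesis using sq i1 by auto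
  qed
  from \<mu>.char_approx1[OF this, where t = t]
  have approx: "cmod (char \<mu> t - (\<Sum>k\<le>2. ((\<i> * t) ^ k / fact k) * (LINT x|\<mu>. x ^ k))) \<le>
      (2 * \<bar>t\<bar>\<^sup>2 / fact 2) * (LINT x|\<mu>. \<bar>x\<bar>\<^sup>2)"
    by blast
  have three: "(\<Sum>k\<le>2. f k) = f 0 + f 1 + f 2" for f :: "nat \<Rightarrow> complex"
    by (simp add: numeral_2_eq_2)
  have "(\<Sum>k\<le>2. ((\<i> * t) ^ k / fact k) * (LINT x|\<mu>. x ^ k)) = 1 - of_real (t\<^sup>2 * m / 2)"
    unfolding three using mean \<mu>.prob_space by (simp add: m_def power_mult_distrib fact_2)
  with approx have "cmod (char \<mu> t - (1 - of_real (t\<^sup>2 * m / 2))) \<le> t\<^sup>2 * m"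
    by (simp add: m_def fact_2)
  moreover have "cmod (char \<mu> t - 1) \<le> cmod (char \<mu> t - (1 - of_real (t\<^sup>2 * m / 2))) + cmod (of_real (t\<^sup>2 * m / 2))"
    using norm_triangle_ineq[of "char \<mu> t - (1 - of_real (t\<^sup>2 * m / 2))" "- of_real (t\<^sup>2 * m / 2)"] by simp
  moreover have "cmod (of_real (t\<^sup>2 * m / 2)) = t\<^sup>2 * m / 2"
    using m by (simp only: norm_of_real) simp
  ultimately have "cmod (char \<mu> t - 1) \<le> t\<^sup>2 * m + t\<^sup>2 * m / 2" by linarith
  also have "\<dots> \<le> 2 * m * t\<^sup>2"
    using mult_nonneg_nonneg[OF zero_le_power2[of t] m] by (simp add: mult.commute)
  finally show ?thesis by (simp add: m_def)
qed

text \<open>With \<open>d t\<close> the distance of the characteristic functions at \<open>t\<close>, the recursion gives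
  \<open>d t \<le> 2 d (t / 2)\<close>, and the moments give \<open>d t \<le> C t^2\<close>. Iterating, \<open>d t \<le> 2^n C (t / 2^n)^2\<close> for all
  \<open>n\<close>.\<close>

lemma is_eta_infty_law_unique:
  assumes \<mu>: "is_eta_infty_law \<mu>" and \<nu>: "is_eta_infty_law \<nu>"
  shows "\<mu> = \<nu>"
proof (rule Levy_uniqueness)
  show r: "real_distribution \<mu>" "real_distribution \<nu>"
    using assms sets_eq_imp_space_eq[of \<mu> borel] sets_eq_imp_space_eq[of \<nu> borel]
    by (auto simp: is_eta_infty_law_def real_distribution_def real_distribution_axioms_def)
  interpret \<mu>: real_distribution \<mu> by fact
  interpret \<nu>: real_distribution \<nu> by fact
  define d where "d t = cmod (char \<mu> t - char \<nu> t)" for t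
  have half: "d t \<le> 2 * d (t / 2)" for t
  proof -
    let ?\<psi> = "CLINT z|unif. iexp (t * zeta_infty z)"
    have "cmod ?\<psi> \<le> (LINT z|unif. cmod (iexp (t * zeta_infty z)))"
      by (rule integral_norm_bound)
    also have "\<dots> = 1" by (simp add: unif.prob_space[simplified])
    finally have \<psi>: "cmod ?\<psi> \<le> 1" .
    have "char \<mu> t - char \<nu> t = (char \<mu> (t / 2) - char \<nu> (t / 2)) * ((char \<mu> (t / 2) + char \<nu> (t / 2)) * ?\<psi>)"
      unfolding is_eta_infty_law_char[OF \<mu>, of t] is_eta_infty_law_char[OF \<nu>, of t]
      by (simp add: power2_eq_square algebra_simps)
    then have "d t = d (t / 2) * (cmod (char \<mu> (t / 2) + char \<nu> (t / 2)) * cmod ?\<psi>)"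
      by (simp add: d_def norm_mult)
    also have "\<dots> \<le> d (t / 2) * (2 * 1)"
    proof (intro mult_left_mono mult_mono \<psi>)
      show "cmod (char \<mu> (t / 2) + char \<nu> (t / 2)) \<le> 2"
        using norm_triangle_ineq[of "char \<mu> (t / 2)" "char \<nu> (t / 2)"] \<mu>.cmod_char_le_1[of "t / 2"]
            \<nu>.cmod_char_le_1[of "t / 2"]
        by linarith
    qed (auto simp: d_def)
    finally show ?thesis by simp
  qed
  define C where "C = 2 * (LINT x|\<mu>. x\<^sup>2) + 2 * (LINT x|\<nu>. x\<^sup>2)"
  have bound: "d t \<le> C * t\<^sup>2" for t
  proof -
    have "d t \<le> cmod (char \<mu> t - 1) + cmod (char \<nu> t - 1)"
      unfolding d_def using norm_triangle_ineq4[of "char \<mu> t - 1" "char \<nu> t - 1"] by simp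
    also have "\<dots> \<le> C * t\<^sup>2"
      using is_eta_infty_law_char_bound[OF \<mu>, of t] is_eta_infty_law_char_bound[OF \<nu>, of t]
      unfolding C_def distrib_right by linarith
    finally show ?thesis .
  qed
  have iter: "d t \<le> 2 ^ n * d (t / 2 ^ n)" for t n
  proof (induction n)
    case (Suc n)
    have "2 ^ n * d (t / 2 ^ n) \<le> 2 ^ n * (2 * d (t / 2 ^ n / 2))"
      by (intro mult_left_mono half) auto
    also have "\<dots> = 2 ^ Suc n * d (t / 2 ^ Suc n)" by (simp add: mult_ac)
    finally show ?case using Suc by linarith
  qed simp
  have "d t \<le> C * t\<^sup>2 * (1 / 2) ^ n" for t n
  proof -
    have "d t \<le> 2 ^ n * (C * (t / 2 ^ n)\<^sup>2)"
      by (rule order_trans[OF iter[of t n]]) (intro mult_left_mono bound, simp)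
    also have "\<dots> = C * t\<^sup>2 * (1 / 2) ^ n"
      by (simp add: power2_eq_square power_one_over field_simps)
    finally show ?thesis .
  qed
  moreover have "(\<lambda>n. C * t\<^sup>2 * (1 / 2) ^ n) \<longlonglongrightarrow> C * t\<^sup>2 * 0" for t
    by (intro tendsto_mult_left LIMSEQ_realpow_zero) auto
  ultimately have "d t \<le> C * t\<^sup>2 * 0" for t
    using LIMSEQ_le_const by blast
  then have "d t = 0" for t
    using norm_ge_zero[of "char \<mu> t - char \<nu> t"] by (simp add: d_def)
  then show "char \<mu> = char \<nu>" by (simp add: d_def fun_eq_iff)
qed

lemma eta_infty_law_eq: "eta_infty_law = distr split_space borel eta_limit"
  unfolding eta_infty_law_def
  by (rule the_equality) (auto intro: is_eta_infty_law_eta_limit is_eta_infty_law_unique)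

section \<open>Averages of null sequences\<close>

lemma average_eventually_le:
  fixes a :: "nat \<Rightarrow> real"
  assumes nonneg: "\<And>n. 0 \<le> a n" and bounded: "\<And>n. a n \<le> K"
    and c: "0 \<le> c" "\<forall>\<^sub>F n in sequentially. a n \<le> c" and e: "0 < e"
  shows "\<forall>\<^sub>F n in sequentially. (\<Sum>i\<le>n. a i) / real (Suc n) \<le> c + e"
proof -
  obtain m where m: "a n \<le> c" if "n \<ge> m" for n
    using c(2) by (auto simp: eventually_sequentially)
  have K: "0 \<le> K" using nonneg[of 0] bounded[of 0] by linarith
  have sum_le: "(\<Sum>i\<le>n. a i) \<le> real m * K + real (Suc n) * c" for n
  proof -
    have "(\<Sum>i\<le>n. a i) \<le> (\<Sum>i\<le>n. (if i < m then K else 0) + c)"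
    proof (rule sum_mono)
      fix i
      show "a i \<le> (if i < m then K else 0) + c"
        using bounded[of i] m[of i] c(1) by (cases "i < m") auto
    qed
    also have "\<dots> = (\<Sum>i\<in>{..n} \<inter> {i. i < m}. K) + real (Suc n) * c"
      by (simp add: sum.distrib sum.If_cases)
    also have "(\<Sum>i\<in>{..n} \<inter> {i. i < m}. K) \<le> real m * K"
    proof -
      have "card ({..n} \<inter> {i. i < m}) \<le> card {..<m}" by (rule card_mono) auto
      then show ?thesis using K by (simp add: mult_right_mono)
    qed
    finally show ?thesis by simp
  qed
  have "(\<lambda>n. real m * K / real (Suc n)) \<longlonglongrightarrow> 0"
    by (rule LIMSEQ_Suc) (rule lim_const_over_n)
  then have "\<forall>\<^sub>F n in sequentially. real m * K / real (Suc n) < e"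
    using e by (rule order_tendstoD)
  then show ?thesis
  proof eventually_elim
    case (elim n)
    have "(\<Sum>i\<le>n. a i) / real (Suc n) \<le> (real m * K + real (Suc n) * c) / real (Suc n)"
      by (intro divide_right_mono sum_le) simp
    also have "\<dots> = real m * K / real (Suc n) + c"
      by (simp add: add_divide_distrib del: of_nat_Suc)
    finally show ?case using elim by linarith
  qed
qed

lemma average_tendsto_0:
  fixes a :: "nat \<Rightarrow> real"
  assumes "\<And>n. 0 \<le> a n" "\<And>n. a n \<le> K" "a \<longlonglongrightarrow> 0"
  shows "(\<lambda>n. (\<Sum>i\<le>n. a i) / real (Suc n)) \<longlonglongrightarrow> 0"
proof (rule order_tendstoI)
  fix e :: real assume e: "0 < e"
  have "\<forall>\<^sub>F n in sequentially. a n \<le> e / 3"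
    using order_tendstoD(2)[OF assms(3), of "e / 3"] e by (auto elim: eventually_mono)
  from average_eventually_le[OF assms(1,2) _ this, of "e / 3"] e
  have "\<forall>\<^sub>F n in sequentially. (\<Sum>i\<le>n. a i) / real (Suc n) \<le> e / 3 + e / 3" by simp
  then show "\<forall>\<^sub>F n in sequentially. (\<Sum>i\<le>n. a i) / real (Suc n) < e"
    by (rule eventually_mono) (use e in linarith)
next
  fix e :: real assume "e < 0"
  then show "\<forall>\<^sub>F n in sequentially. e < (\<Sum>i\<le>n. a i) / real (Suc n)"
    using assms(1) by (intro always_eventually allI) (rule less_le_trans, auto intro!: divide_nonneg_nonneg sum_nonneg)
qed

lemma harm_average_tendsto_0: "(\<lambda>n. harm (Suc n) / real (Suc n)) \<longlonglongrightarrow> (0 :: real)"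
proof -
  have "(\<lambda>n. (\<Sum>i\<le>n. 1 / real (Suc i)) / real (Suc n)) \<longlonglongrightarrow> 0"
  proof (rule average_tendsto_0)
    show "(\<lambda>n. 1 / real (Suc n)) \<longlonglongrightarrow> 0" by (rule LIMSEQ_Suc) (rule lim_const_over_n)
    show "1 / real (Suc n) \<le> 1" for n by simp
  qed simp
  moreover have "harm (Suc n) = (\<Sum>i\<le>n. 1 / real (Suc i))" for n
    by (induction n) (simp_all add: harm_Suc inverse_eq_divide harm_def[of 0])
  ultimately show ?thesis by simp
qed

text \<open>The sequence is bounded, and an eventual bound \<open>c > 0\<close> improves to the eventual bound \<open>3 c / 4\<close>.\<close>

lemma half_average_recursion_tendsto_0:
  fixes d b :: "nat \<Rightarrow> real"
  assumes nonneg: "\<And>n. 0 \<le> d n" and b: "b \<longlonglongrightarrow> 0"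
    and rec: "\<And>n. d (Suc n) \<le> (\<Sum>i\<le>n. d i) / real (Suc n) / 2 + b n"
  shows "d \<longlonglongrightarrow> 0"
proof -
  obtain B where B: "B > 0" "\<And>n. \<bar>b n\<bar> \<le> B"
    using Bseq_cmult_iff convergent_imp_Bseq[OF convergentI[OF b]] by (auto simp: Bseq_def)
  define K where "K = max (d 0) (2 * B)"
  have K: "K > 0" using B by (simp add: K_def)
  have bounded: "d n \<le> K" for n
  proof (induction n rule: less_induct)
    case (less n)
    show ?case
    proof (cases n)
      case 0
      then show ?thesis by (simp add: K_def)
    next
      case (Suc m)
      have "(\<Sum>i\<le>m. d i) \<le> (\<Sum>i\<le>m. K)"
        using less Suc by (intro sum_mono) auto
      then have "(\<Sum>i\<le>m. d i) / real (Suc m) \<le> K"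
        by (simp add: pos_divide_le_eq mult.commute)
      moreover have "b m \<le> K / 2" using B(2)[of m] unfolding K_def by linarith
      ultimately have "(\<Sum>i\<le>m. d i) / real (Suc m) / 2 + b m \<le> K / 2 + K / 2"
        by (intro add_mono divide_right_mono) auto
      with rec[of m] show ?thesis unfolding Suc by simp
    qed
  qed
  have step: "\<forall>\<^sub>F n in sequentially. d n \<le> 3 / 4 * c" if c: "c > 0" "\<forall>\<^sub>F n in sequentially. d n \<le> c" for c
  proof -
    have "\<forall>\<^sub>F n in sequentially. (\<Sum>i\<le>n. d i) / real (Suc n) \<le> c + c / 4"
      by (rule average_eventually_le[OF nonneg bounded]) (use c in auto)
    moreover have "\<forall>\<^sub>F n in sequentially. b n < c / 8"
      by (rule order_tendstoD[OF b]) (use c in auto)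
    ultimately have "\<forall>\<^sub>F n in sequentially. d (Suc n) \<le> 3 / 4 * c"
    proof eventually_elim
      case (elim n)
      then have "(\<Sum>i\<le>n. d i) / real (Suc n) / 2 + b n \<le> (c + c / 4) / 2 + c / 8"
        by (intro add_mono divide_right_mono) auto
      with rec[of n] have "d (Suc n) \<le> (c + c / 4) / 2 + c / 8" by (rule order_trans)
      also have "\<dots> = 3 / 4 * c" by simp
      finally show ?case .
    qed
    then show ?thesis using eventually_sequentially_Suc[of "\<lambda>n. d n \<le> 3 / 4 * c"] by blast
  qed
  have iter: "\<forall>\<^sub>F n in sequentially. d n \<le> (3 / 4) ^ r * K" for r
  proof (induction r)
    case 0
    then show ?case using bounded by simp
  next
    case (Suc r)
    from step[OF _ this] K show ?case by (simp add: mult.assoc)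
  qed
  show ?thesis
  proof (rule order_tendstoI)
    fix e :: real assume e: "0 < e"
    have "(\<lambda>r. (3 / 4) ^ r * K) \<longlonglongrightarrow> 0 * K"
      by (intro tendsto_mult_right LIMSEQ_realpow_zero) auto
    then have "\<forall>\<^sub>F r in sequentially. (3 / 4) ^ r * K < e"
      using e by (intro order_tendstoD) auto
    then obtain r where "(3 / 4) ^ r * K < e" by (auto simp: eventually_sequentially)
    with iter[of r] show "\<forall>\<^sub>F n in sequentially. d n < e" by (auto elim!: eventually_mono)
  next
    fix e :: real assume "e < 0"
    then show "\<forall>\<^sub>F n in sequentially. e < d n"
      using nonneg by (intro always_eventually allI) (rule less_le_trans)
  qed
qed

section \<open>Mean square convergence of the centred mean silhouette\<close>

lemma measurable_cell_mean_random_tree [measurable]: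
  "(\<lambda>\<omega>. cell_mean w (random_tree n \<omega>)) \<in> borel_measurable split_space"
  by (rule measurable_fun_random_tree) simp

lemma weight_bounds: "0 \<le> weight w u" "weight w u \<le> 1"
  by (induction w u rule: weight.induct) (auto simp: divide_simps)

lemma cell_mean_bounds: "0 \<le> cell_mean w T" "cell_mean w T \<le> real (card T)"
  unfolding cell_mean_def using weight_bounds sum_bounded_above[of T "weight w" 1] by (auto intro: sum_nonneg)

lemma cell_mean_random_tree_Suc:
  "cell_mean [] (random_tree (Suc n) \<omega>) =
    1 + (cell_mean [] (random_tree (n - split_count n (\<omega> [])) (descend False \<omega>)) +
         cell_mean [] (random_tree (split_count n (\<omega> [])) (descend True \<omega>))) / 2"
  by (simp add: cell_mean_Nil finite_random_tree)

lemma root_mean_size_real: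
  assumes t: "\<And>i. 0 \<le> t i"
  shows "root_mean n (\<lambda>i p. ennreal (t i)) = ennreal ((\<Sum>i\<le>n. t i) / real (Suc n))"
proof -
  have "root_mean n (\<lambda>i p. ennreal (t i)) = (\<Sum>i\<le>n. ennreal (1 / (real n + 1) * t i))"
    unfolding root_mean_size using t by (intro sum.cong ennreal_mult[symmetric]) auto
  also have "\<dots> = ennreal (\<Sum>i\<le>n. 1 / (real n + 1) * t i)"
    using t by (intro sum_ennreal) auto
  finally show ?thesis unfolding sum_distrib_left[symmetric] by (simp add: add.commute)
qed

lemma nn_integral_cell_mean_random_tree:
  "(\<integral>\<^sup>+\<omega>. ennreal (cell_mean [] (random_tree n \<omega>)) \<partial>split_space) = ennreal (harm n)"
proof (induction n rule: less_induct)
  case (less n)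
  show ?case
  proof (cases n)
    case 0
    then show ?thesis by (simp add: harm_def)
  next
    case (Suc m)
    have half: "(\<integral>\<^sup>+\<omega>. ennreal (cell_mean [] (random_tree i \<omega>) / 2) \<partial>split_space) = ennreal (harm i / 2)" if
        "i < n" for i
    proof -
      have *: "ennreal (x / 2) = ennreal (1 / 2) * ennreal x" if "0 \<le> x" for x :: real
        using that by (subst ennreal_mult[symmetric]) auto
      show ?thesis
        using less[OF that] by (simp add: * cell_mean_bounds nn_integral_cmult harm_nonneg)
    qed
    let ?c = "\<lambda>i \<omega>. cell_mean [] (random_tree i \<omega>) / 2"
    define t :: "nat \<Rightarrow> real" where "t i = 1 + (harm (m - i) / 2 + harm i / 2)" for i
    have t: "0 \<le> t i" for i by (simp add: t_def harm_nonneg)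
    have meas: "(\<lambda>\<omega>. ennreal (cell_mean [] (random_tree (Suc m) \<omega>))) \<in> borel_measurable split_space"
      by measurable
    have "(\<integral>\<^sup>+\<omega>. ennreal (cell_mean [] (random_tree n \<omega>)) \<partial>split_space) =
      (\<integral>\<^sup>+s. \<integral>\<^sup>+\<omega>0. \<integral>\<^sup>+\<omega>1. 1 + (ennreal (?c (m - split_count m s) \<omega>0) + ennreal (?c (split_count m s) \<omega>1))
          \<partial>split_space \<partial>split_space \<partial>unif_stream)"
      unfolding Suc
      by (subst nn_integral_split[OF meas])
        (auto intro!: nn_integral_cong simp: cell_mean_random_tree_Suc cell_mean_bounds add_divide_distrib
          ennreal_plus ennreal_1 simp del: random_tree.simps)
    also have "\<dots> = (\<integral>\<^sup>+s. 1 + (ennreal (harm (m - split_count m s) / 2) + ennreal (harm (split_count m s) /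
        2)) \<partial>unif_stream)"
      using split_space.emeasure_space_1
      by (simp add: nn_integral_add half Suc le_imp_less_Suc split_count_le)
    also have "\<dots> = root_mean m (\<lambda>i p. 1 + (ennreal (harm (m - i) / 2) + ennreal (harm i / 2)))"
      by (rule nn_integral_split_count) simp
    also have "\<dots> = root_mean m (\<lambda>i p. ennreal (t i))"
      unfolding t_def by (simp add: ennreal_plus ennreal_1 harm_nonneg)
    also have "\<dots> = ennreal ((\<Sum>i\<le>m. t i) / real (Suc m))"
      by (rule root_mean_size_real[OF t])
    also have "(\<Sum>i\<le>m. t i) / real (Suc m) = harm (Suc m)"
    proof -
      have "(\<Sum>i\<le>m. harm (m - i)) = (\<Sum>i\<le>m. harm i :: real)"
        by (rule sum.reindex_bij_witness[of _ "\<lambda>i. m - i" "\<lambda>i. m - i"]) auto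
      then have "(\<Sum>i\<le>m. 1 + (harm (m - i) / 2 + harm i / 2)) = real (Suc m) + (\<Sum>i<Suc m. harm i)"
        by (simp add: sum.distrib sum_divide_distrib[symmetric] lessThan_Suc_atMost)
      also have "\<dots> = real (Suc m) * harm (Suc m)"
        unfolding sum_harm_lessThan by simp
      finally show ?thesis unfolding t_def by (simp del: of_nat_Suc)
    qed
    finally show ?thesis by (simp add: Suc)
  qed
qed

text \<open>The error of the approximation of the centred mean silhouette by its limit.\<close>

definition discrepancy :: "nat \<Rightarrow> (node \<Rightarrow> real stream) \<Rightarrow> real" where
  "discrepancy n \<omega> = cell_mean [] (random_tree n \<omega>) - harm n - eta_limit \<omega>"

lemma centred_discrepancy: "centred split_space (discrepancy n)"
proof -
  let ?c = "\<lambda>\<omega>. cell_mean [] (random_tree n \<omega>)"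
  have c: "integrable split_space ?c \<and> (LINT \<omega>|split_space. ?c \<omega>) = harm n"
    using nn_integral_cell_mean_random_tree[of n]
    by (subst (asm) nn_integral_eq_integrable) (auto simp: cell_mean_bounds harm_nonneg)
  have W: "integrable split_space eta_limit" "(LINT \<omega>|split_space. eta_limit \<omega>) = 0"
    using split_space.integrable_centred[OF centred_eta_limit] centredD[OF centred_eta_limit] by auto
  have "(LINT \<omega>|split_space. discrepancy n \<omega>) = 0"
    unfolding discrepancy_def using c W split_space.prob_space by simp
  moreover have "integrable split_space (\<lambda>\<omega>. (discrepancy n \<omega>)\<^sup>2)"
  proof (rule Bochner_Integration.integrable_bound)
    show "integrable split_space (\<lambda>\<omega>. 2 * (real n + harm n)\<^sup>2 + 2 * (eta_limit \<omega>)\<^sup>2)"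
      using centredD(2)[OF centred_eta_limit] by simp
    show "AE \<omega> in split_space. norm ((discrepancy n \<omega>)\<^sup>2) \<le> norm (2 * (real n + harm n)\<^sup>2 + 2 * (eta_limit \<omega>)\<^sup>2)"
    proof (rule AE_I2)
      fix \<omega>
      define x where "x = ?c \<omega> - harm n"
      have "\<bar>x\<bar> \<le> real n + harm n"
        using cell_mean_bounds[of "[]" "random_tree n \<omega>"] random_tree_tree[of n \<omega>] harm_nonneg[of n, where 'a = real]
        unfolding x_def by auto
      then have "x\<^sup>2 \<le> (real n + harm n)\<^sup>2"
        by (metis abs_ge_zero power2_abs power_mono)
      moreover have "(x - eta_limit \<omega>)\<^sup>2 \<le> 2 * x\<^sup>2 + 2 * (eta_limit \<omega>)\<^sup>2"
        using zero_le_power2[of "x + eta_limit \<omega>"] by (simp add: power2_eq_square algebra_simps)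
      ultimately show "norm ((discrepancy n \<omega>)\<^sup>2) \<le> norm (2 * (real n + harm n)\<^sup>2 + 2 * (eta_limit \<omega>)\<^sup>2)"
        unfolding discrepancy_def x_def by simp
    qed
  qed (simp add: discrepancy_def[abs_def])
  ultimately show ?thesis unfolding centred_def by (simp add: discrepancy_def[abs_def])
qed

lemma measurable_discrepancy [measurable]: "discrepancy n \<in> borel_measurable split_space"
  using centred_discrepancy by (rule centredD)

lemma discrepancy_second_moment_rec:
  "second_moment split_space (discrepancy (Suc n)) \<le>
    (\<Sum>i\<le>n. second_moment split_space (discrepancy i)) / real (Suc n) / 2 + harm (Suc n) / real (Suc n)"
proof -
  let ?d = "\<lambda>i. second_moment split_space (discrepancy i)"
  define x :: "nat \<Rightarrow> real \<Rightarrow> real" where "x i p = harm i - harm (Suc n) - ln p" for i p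
  \<comment> \<open>The contribution of the root to the error: the average of the terms of the right and of the left
    subtree.\<close>
  define toll where "toll i p = (x i p + x (n - i) (1 - p)) / 2" for i p
  have [measurable]: "x i \<in> borel_measurable borel" "toll i \<in> borel_measurable borel" for i
    unfolding x_def[abs_def] toll_def[abs_def] by measurable
  let ?f = "\<lambda>i \<omega>. ennreal (((discrepancy (n - i) (descend False \<omega>) + discrepancy i (descend True \<omega>)) / 2 +
      toll i (shd (\<omega> [])))\<^sup>2)"
  have f: "(\<lambda>\<omega>. ?f (split_count n (\<omega> [])) \<omega>) \<in> borel_measurable split_space"
    by (rule measurable_compose_countable[where f = ?f]) measurable
  have "ennreal (?d (Suc n)) = (\<integral>\<^sup>+\<omega>. ennreal ((discrepancy (Suc n) \<omega>)\<^sup>2) \<partial>split_space)"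
    by (rule nn_integral_second_moment[OF centred_discrepancy, symmetric])
  also have "\<dots> = (\<integral>\<^sup>+\<omega>. ?f (split_count n (\<omega> [])) \<omega> \<partial>split_space)"
  proof (rule nn_integral_cong_AE, use AE_eta_limit_rec in eventually_elim)
    fix \<omega> assume W: "eta_limit \<omega> = (eta_limit (descend False \<omega>) + eta_limit (descend True \<omega>)) / 2 + zeta_infty
        (shd (\<omega> []))"
    have "discrepancy (Suc n) \<omega> = (discrepancy (n - split_count n (\<omega> [])) (descend False \<omega>) +
        discrepancy (split_count n (\<omega> [])) (descend True \<omega>)) / 2 + toll (split_count n (\<omega> [])) (shd (\<omega> []))"
      unfolding discrepancy_def cell_mean_random_tree_Suc W toll_def x_def zeta_infty_def
      by (simp add: field_simps)
    then show "ennreal ((discrepancy (Suc n) \<omega>)\<^sup>2) = ?f (split_count n (\<omega> [])) \<omega>" by simp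
  qed
  also have "\<dots> = (\<integral>\<^sup>+s. ennreal (?d (n - split_count n s) / 4 + ?d (split_count n s) / 4 + (toll (split_count
      n s) (shd s))\<^sup>2) \<partial>unif_stream)"
    by (subst nn_integral_split[OF f]) (simp add: nn_integral_average_square[OF centred_discrepancy
        centred_discrepancy])
  also have "\<dots> = root_mean n (\<lambda>i p. ennreal (?d (n - i) / 4 + ?d i / 4 + (toll i p)\<^sup>2))"
    by (rule nn_integral_split_count) simp
  also have "\<dots> \<le> root_mean n (\<lambda>i p. ennreal (?d (n - i) / 4 + ?d i / 4) +
      (ennreal (1 / 2) * ennreal ((x i p)\<^sup>2) + ennreal (1 / 2) * ennreal ((x (n - i) (1 - p))\<^sup>2)))"
  proof (rule root_mean_mono)
    fix i p
    have "(toll i p)\<^sup>2 \<le> 1 / 2 * (x i p)\<^sup>2 + 1 / 2 * (x (n - i) (1 - p))\<^sup>2"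
      using zero_le_power2[of "x i p - x (n - i) (1 - p)"] unfolding toll_def
      by (simp add: power2_eq_square field_simps)
    then have "ennreal (?d (n - i) / 4 + ?d i / 4 + (toll i p)\<^sup>2) \<le>
       ennreal (?d (n - i) / 4 + ?d i / 4 + (1 / 2 * (x i p)\<^sup>2 + 1 / 2 * (x (n - i) (1 - p))\<^sup>2))"
      by (intro ennreal_leI) simp
    also have "\<dots> = ennreal (?d (n - i) / 4 + ?d i / 4) +
      (ennreal (1 / 2) * ennreal ((x i p)\<^sup>2) + ennreal (1 / 2) * ennreal ((x (n - i) (1 - p))\<^sup>2))"
      by (subst ennreal_plus) (simp_all only: ennreal_plus ennreal_mult zero_le_power2 second_moment_nonneg
          mult_nonneg_nonneg add_nonneg_nonneg divide_nonneg_nonneg zero_le_numeral zero_le_one zero_le_divide_1_iff)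
    finally show "ennreal (?d (n - i) / 4 + ?d i / 4 + (toll i p)\<^sup>2) \<le> \<dots>" .
  qed
  also have "\<dots> = root_mean n (\<lambda>i p. ennreal (?d (n - i) / 4 + ?d i / 4)) +
     (ennreal (1 / 2) * root_mean n (\<lambda>i p. ennreal ((x i p)\<^sup>2)) +
      ennreal (1 / 2) * root_mean n (\<lambda>i p. ennreal ((x (n - i) (1 - p))\<^sup>2)))"
    by (simp add: root_mean_add root_mean_cmult)
  also have "root_mean n (\<lambda>i p. ennreal ((x (n - i) (1 - p))\<^sup>2)) = root_mean n (\<lambda>i p. ennreal ((x i p)\<^sup>2))"
    by (rule root_mean_reflect) simp
  also have "root_mean n (\<lambda>i p. ennreal ((x i p)\<^sup>2)) = ennreal (harm (Suc n) / real (Suc n))"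
    unfolding x_def by (rule root_mean_harm_ln)
  also have "ennreal (1 / 2) * ennreal (harm (Suc n) / real (Suc n)) + ennreal (1 / 2) * ennreal (harm (Suc n)
      / real (Suc n)) =
      ennreal (harm (Suc n) / real (Suc n))"
  proof -
    have "ennreal (1 / 2) * ennreal y + ennreal (1 / 2) * ennreal y = ennreal y" if "0 \<le> y" for y
    proof -
      have "ennreal (1 / 2) * ennreal y = ennreal (1 / 2 * y)"
        using that by (intro ennreal_mult[symmetric]) auto
      moreover have "ennreal (1 / 2 * y) + ennreal (1 / 2 * y) = ennreal (1 / 2 * y + 1 / 2 * y)"
        using that by (intro ennreal_plus[symmetric]) auto
      ultimately show ?thesis by simp
    qed
    then show ?thesis by (simp only: harm_nonneg divide_nonneg_nonneg of_nat_0_le_iff)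
  qed
  also have "root_mean n (\<lambda>i p. ennreal (?d (n - i) / 4 + ?d i / 4)) = ennreal ((\<Sum>i\<le>n. ?d i) / real (Suc n) / 2)"
  proof -
    have "root_mean n (\<lambda>i p. ennreal (?d (n - i) / 4 + ?d i / 4)) = ennreal ((\<Sum>i\<le>n. ?d (n - i) / 4 + ?d i / 4)
        / real (Suc n))"
      by (rule root_mean_size_real) simp
    also have "(\<Sum>i\<le>n. ?d (n - i) / 4 + ?d i / 4) / real (Suc n) = (\<Sum>i\<le>n. ?d i) / real (Suc n) / 2"
    proof -
      have "(\<Sum>i\<le>n. ?d (n - i)) = (\<Sum>i\<le>n. ?d i)"
        by (rule sum.reindex_bij_witness[of _ "\<lambda>i. n - i" "\<lambda>i. n - i"]) auto
      then show ?thesis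
        unfolding sum.distrib sum_divide_distrib[symmetric] by (simp add: field_simps)
    qed
    finally show ?thesis .
  qed
  also have "ennreal ((\<Sum>i\<le>n. ?d i) / real (Suc n) / 2) + ennreal (harm (Suc n) / real (Suc n)) =
     ennreal ((\<Sum>i\<le>n. ?d i) / real (Suc n) / 2 + harm (Suc n) / real (Suc n))"
    by (intro ennreal_plus[symmetric] divide_nonneg_nonneg sum_nonneg harm_nonneg) auto
  finally show ?thesis
    by (subst (asm) ennreal_le_iff) (auto intro!: add_nonneg_nonneg divide_nonneg_nonneg sum_nonneg harm_nonneg)
qed

lemma discrepancy_second_moment_tendsto_0:
  "(\<lambda>n. second_moment split_space (discrepancy n)) \<longlonglongrightarrow> 0"
  by (rule half_average_recursion_tendsto_0[OF second_moment_nonneg harm_average_tendsto_0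
      discrepancy_second_moment_rec])

section \<open>Convergence of the cell means\<close>

text \<open>The limit of \<open>cell_mean w (random_tree n) - H n\<close>. The values where the argument of the logarithm
  is not positive play no role, as they have probability zero.\<close>

primrec cell_limit :: "node \<Rightarrow> (node \<Rightarrow> real stream) \<Rightarrow> real" where
  "cell_limit [] \<omega> = eta_limit \<omega>"
| "cell_limit (b # w) \<omega> = 1 + ln (if b then shd (\<omega> []) else 1 - shd (\<omega> [])) + cell_limit w (descend b \<omega>)"

lemma measurable_cell_limit [measurable]: "cell_limit w \<in> borel_measurable split_space"
proof (induction w)
  case Nil
  have "cell_limit [] = eta_limit" by (simp add: fun_eq_iff)
  then show ?case by simp
next
  case (Cons b w)
  note [measurable] = Cons
  have "cell_limit (b # w) = (\<lambda>\<omega>. 1 + ln (if b then shd (\<omega> []) else 1 - shd (\<omega> [])) + cell_limit w (descend b \<omega>))"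
    by (simp add: fun_eq_iff)
  also have "\<dots> \<in> borel_measurable split_space" by measurable
  finally show ?case .
qed

text \<open>The error of the approximation of the centred cell mean by its limit.\<close>

definition cell_gap :: "node \<Rightarrow> nat \<Rightarrow> (node \<Rightarrow> real stream) \<Rightarrow> real" where
  "cell_gap w n \<omega> = cell_mean w (random_tree n \<omega>) - harm n - cell_limit w \<omega>"

lemma measurable_cell_gap [measurable]: "cell_gap w n \<in> borel_measurable split_space"
  unfolding cell_gap_def[abs_def] by measurable

text \<open>The truncated mean square error, which measures convergence in probability. The truncation removes
  all questions of integrability.\<close>

definition gap_size :: "node \<Rightarrow> nat \<Rightarrow> real" where
  "gap_size w n = (LINT \<omega>|split_space. min 1 ((cell_gap w n \<omega>)\<^sup>2))"

lemma integrable_gap: "integrable split_space (\<lambda>\<omega>. min 1 ((cell_gap w n \<omega>)\<^sup>2))"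
  by (rule split_space.integrable_const_bound[where B = 1]) auto

lemma gap_size_bounds: "0 \<le> gap_size w n" "gap_size w n \<le> 1"
proof -
  show "0 \<le> gap_size w n" by (simp add: gap_size_def)
  have "gap_size w n \<le> (LINT \<omega>|split_space. 1)"
    unfolding gap_size_def by (intro integral_mono integrable_gap) auto
  then show "gap_size w n \<le> 1" using split_space.prob_space by simp
qed

lemma nn_integral_gap: "(\<integral>\<^sup>+\<omega>. ennreal (min 1 ((cell_gap w n \<omega>)\<^sup>2)) \<partial>split_space) = ennreal (gap_size w n)"
  unfolding gap_size_def by (intro nn_integral_eq_integral integrable_gap) auto

text \<open>The case of a function that does not depend on the other subtree.\<close>

lemma nn_integral_split_descend:
  assumes "(\<lambda>\<omega>. g (\<omega> []) (descend b \<omega>)) \<in> borel_measurable split_space"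
  shows "(\<integral>\<^sup>+\<omega>. g (\<omega> []) (descend b \<omega>) \<partial>split_space) = (\<integral>\<^sup>+s. \<integral>\<^sup>+\<omega>'. g s \<omega>' \<partial>split_space \<partial>unif_stream)"
  using split_space.emeasure_space_1 by (subst nn_integral_split[OF assms]) (cases b; simp)

lemma gap_size_Cons:
  "gap_size (b # w) (Suc n) \<le> 2 * ((\<Sum>i\<le>n. gap_size w i) / real (Suc n)) + 2 * (harm (Suc n) / real (Suc n))"
proof -
  define x :: "nat \<Rightarrow> real \<Rightarrow> real" where "x i p = harm i - harm (Suc n) - ln p" for i p
  define q where "q p = (if b then p else 1 - p)" for p :: real
  define size where "size i = (if b then i else n - i)" for i
  have [measurable]: "x i \<in> borel_measurable borel" "q \<in> borel_measurable borel" for i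
    unfolding x_def[abs_def] q_def[abs_def] by measurable
  let ?g = "\<lambda>s (\<omega>' :: node \<Rightarrow> real stream). 2 * ennreal (min 1 ((cell_gap w (size (split_count n s)) \<omega>')\<^sup>2)) +
      2 * ennreal ((x (size (split_count n s)) (q (shd s)))\<^sup>2)"
  have m: "(\<lambda>\<omega>. ?g (\<omega> []) (descend b \<omega>)) \<in> borel_measurable split_space"
    by (rule measurable_compose_countable[where g = "\<lambda>\<omega>. split_count n (\<omega> [])" and
      f = "\<lambda>i \<omega>. 2 * ennreal (min 1 ((cell_gap w (size i) (descend b \<omega>))\<^sup>2)) + 2 * ennreal ((x (size i) (q
          (shd (\<omega> []))))\<^sup>2)"])
      measurable
  have "ennreal (gap_size (b # w) (Suc n)) = (\<integral>\<^sup>+\<omega>. ennreal (min 1 ((cell_gap (b # w) (Suc n) \<omega>)\<^sup>2)) \<partial>split_space)"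
    by (rule nn_integral_gap[symmetric])
  also have "\<dots> \<le> (\<integral>\<^sup>+\<omega>. ?g (\<omega> []) (descend b \<omega>) \<partial>split_space)"
  proof (rule nn_integral_mono)
    fix \<omega> :: "node \<Rightarrow> real stream"
    let ?i = "size (split_count n (\<omega> []))"
    have eq: "cell_gap (b # w) (Suc n) \<omega> = cell_gap w ?i (descend b \<omega>) + x ?i (q (shd (\<omega> [])))"
      by (cases b) (simp_all add: cell_gap_def cell_mean_Cons finite_random_tree size_def x_def q_def)
    have "min 1 ((y + z)\<^sup>2) \<le> 2 * min 1 (y\<^sup>2) + 2 * z\<^sup>2" for y z :: real
    proof -
      have "(y + z)\<^sup>2 \<le> 2 * y\<^sup>2 + 2 * z\<^sup>2"
        using zero_le_power2[of "y - z"] by (simp add: power2_eq_square algebra_simps)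
      moreover have "min 1 a \<le> 2 * min 1 b + 2 * c" if "a \<le> 2 * b + 2 * c" "0 \<le> c" for a b c :: real
        using that by (auto simp: min_def)
      ultimately show ?thesis by simp
    qed
    then have "ennreal (min 1 ((cell_gap (b # w) (Suc n) \<omega>)\<^sup>2)) \<le>
        ennreal (2 * min 1 ((cell_gap w ?i (descend b \<omega>))\<^sup>2) + 2 * (x ?i (q (shd (\<omega> []))))\<^sup>2)"
      unfolding eq by (intro ennreal_leI)
    also have "\<dots> = ?g (\<omega> []) (descend b \<omega>)"
      by (simp add: ennreal_mult)
    finally show "ennreal (min 1 ((cell_gap (b # w) (Suc n) \<omega>)\<^sup>2)) \<le> ?g (\<omega> []) (descend b \<omega>)" .
  qed
  also have "\<dots> = (\<integral>\<^sup>+s. 2 * ennreal (gap_size w (size (split_count n s))) + 2 * ennreal ((x (size (split_count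
      n s)) (q (shd s)))\<^sup>2) \<partial>unif_stream)"
    using split_space.emeasure_space_1
    by (subst nn_integral_split_descend[OF m]) (simp add: nn_integral_add nn_integral_cmult nn_integral_gap)
  also have "\<dots> = root_mean n (\<lambda>i p. 2 * ennreal (gap_size w (size i)) + 2 * ennreal ((x (size i) (q p))\<^sup>2))"
    by (rule nn_integral_split_count) simp
  also have "\<dots> = root_mean n (\<lambda>i p. 2 * ennreal (gap_size w i) + 2 * ennreal ((x i p)\<^sup>2))"
  proof (cases b)
    case False
    then show ?thesis unfolding size_def q_def
      using root_mean_reflect[of "\<lambda>i p. 2 * ennreal (gap_size w i) + 2 * ennreal ((x i p)\<^sup>2)" n] by simp
  qed (simp add: size_def q_def)
  also have "\<dots> = 2 * root_mean n (\<lambda>i p. ennreal (gap_size w i)) + 2 * root_mean n (\<lambda>i p. ennreal ((x i p)\<^sup>2))"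
    by (simp add: root_mean_add root_mean_cmult)
  also have "root_mean n (\<lambda>i p. ennreal ((x i p)\<^sup>2)) = ennreal (harm (Suc n) / real (Suc n))"
    unfolding x_def by (rule root_mean_harm_ln)
  also have "root_mean n (\<lambda>i p. ennreal (gap_size w i)) = ennreal ((\<Sum>i\<le>n. gap_size w i) / real (Suc n))"
    by (rule root_mean_size_real) (rule gap_size_bounds)
  also have "2 * ennreal ((\<Sum>i\<le>n. gap_size w i) / real (Suc n)) + 2 * ennreal (harm (Suc n) / real (Suc n)) =
     ennreal (2 * ((\<Sum>i\<le>n. gap_size w i) / real (Suc n)) + 2 * (harm (Suc n) / real (Suc n)))"
  proof -
    have "2 * ennreal y + 2 * ennreal z = ennreal (2 * y + 2 * z)" if "0 \<le> y" "0 \<le> z" for y z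
      using that by (simp add: ennreal_plus ennreal_mult)
    then show ?thesis
      by (simp only: divide_nonneg_nonneg sum_nonneg gap_size_bounds harm_nonneg of_nat_0_le_iff)
  qed
  finally show ?thesis
    by (subst (asm) ennreal_le_iff) (auto intro!: add_nonneg_nonneg divide_nonneg_nonneg sum_nonneg
        harm_nonneg gap_size_bounds)
qed

lemma gap_size_tendsto_0: "gap_size w \<longlonglongrightarrow> 0"
proof (induction w)
  case Nil
  show ?case
  proof (rule tendsto_sandwich[OF _ _ tendsto_const discrepancy_second_moment_tendsto_0])
    show "\<forall>\<^sub>F n in sequentially. 0 \<le> gap_size [] n" by (simp add: gap_size_bounds)
    have "gap_size [] n \<le> second_moment split_space (discrepancy n)" for n
      unfolding gap_size_def
      by (rule integral_mono[OF integrable_gap]) (auto simp: cell_gap_def discrepancy_def[symmetric]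
          centredD(2)[OF centred_discrepancy])
    then show "\<forall>\<^sub>F n in sequentially. gap_size [] n \<le> second_moment split_space (discrepancy n)" by simp
  qed
next
  case (Cons b w)
  have lim: "(\<lambda>n. 2 * ((\<Sum>i\<le>n. gap_size w i) / real (Suc n)) + 2 * (harm (Suc n) / real (Suc n))) \<longlonglongrightarrow> 2 * 0 + 2 * 0"
    by (intro tendsto_add tendsto_mult_left average_tendsto_0[OF gap_size_bounds Cons] harm_average_tendsto_0)
  have "(\<lambda>n. gap_size (b # w) (Suc n)) \<longlonglongrightarrow> 0"
  proof (rule tendsto_sandwich)
    show "\<forall>\<^sub>F n in sequentially. 0 \<le> gap_size (b # w) (Suc n)" by (simp add: gap_size_bounds)
    show "\<forall>\<^sub>F n in sequentially. gap_size (b # w) (Suc n) \<le>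
        2 * ((\<Sum>i\<le>n. gap_size w i) / real (Suc n)) + 2 * (harm (Suc n) / real (Suc n))"
      by (intro always_eventually allI gap_size_Cons)
    show "(\<lambda>n. 2 * ((\<Sum>i\<le>n. gap_size w i) / real (Suc n)) + 2 * (harm (Suc n) / real (Suc n))) \<longlonglongrightarrow> 0"
      using lim by simp
  qed simp
  then show ?case by (rule LIMSEQ_imp_Suc)
qed

section \<open>The law of the random search tree\<close>

lemma indep_uniform_distr:
  assumes \<xi>: "indep_uniform M \<xi> I" and I: "I \<noteq> {}"
  shows "(\<lambda>\<omega>. \<lambda>i\<in>I. \<xi> i \<omega>) \<in> M \<rightarrow>\<^sub>M (\<Pi>\<^sub>M i\<in>I. unif)"
    and "distr M (\<Pi>\<^sub>M i\<in>I. unif) (\<lambda>\<omega>. \<lambda>i\<in>I. \<xi> i \<omega>) = (\<Pi>\<^sub>M i\<in>I. unif)"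
proof -
  interpret M: prob_space M using \<xi> by (simp add: indep_uniform_def)
  have ind: "M.indep_vars (\<lambda>_. borel) \<xi> I" and law: "\<And>i. i \<in> I \<Longrightarrow> distr M borel (\<xi> i) = unif"
    using \<xi> by (auto simp: indep_uniform_def unif_def)
  have rv: "\<xi> i \<in> borel_measurable M" if "i \<in> I" for i
    using ind that by (auto simp: M.indep_vars_def)
  show "(\<lambda>\<omega>. \<lambda>i\<in>I. \<xi> i \<omega>) \<in> M \<rightarrow>\<^sub>M (\<Pi>\<^sub>M i\<in>I. unif)"
    by (rule measurable_restrict) (use rv in simp)
  have "distr M (\<Pi>\<^sub>M i\<in>I. unif) (\<lambda>\<omega>. \<lambda>i\<in>I. \<xi> i \<omega>) = distr M (\<Pi>\<^sub>M i\<in>I. borel) (\<lambda>\<omega>. \<lambda>i\<in>I. \<xi> i \<omega>)"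
    by (intro distr_cong sets_PiM_cong) auto
  also have "\<dots> = (\<Pi>\<^sub>M i\<in>I. distr M borel (\<xi> i))"
    using ind by (subst (asm) M.indep_vars_iff_distr_eq_PiM'[OF I rv]) auto
  also have "\<dots> = (\<Pi>\<^sub>M i\<in>I. unif)"
    by (intro PiM_cong law) auto
  finally show "distr M (\<Pi>\<^sub>M i\<in>I. unif) (\<lambda>\<omega>. \<lambda>i\<in>I. \<xi> i \<omega>) = (\<Pi>\<^sub>M i\<in>I. unif)" .
qed

text \<open>The index of the sample starts at \<open>1\<close>, that of the stream at \<open>0\<close>.\<close>

lemma indep_uniform_stream:
  assumes \<xi>: "indep_uniform M \<xi> {1..}"
  shows "(\<lambda>\<omega>. to_stream (\<lambda>n. \<xi> (Suc n) \<omega>)) \<in> M \<rightarrow>\<^sub>M unif_stream"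
    and "distr M unif_stream (\<lambda>\<omega>. to_stream (\<lambda>n. \<xi> (Suc n) \<omega>)) = unif_stream"
proof -
  have ne: "{1 :: nat..} \<noteq> {}" by auto
  let ?X = "\<lambda>\<omega>. \<lambda>i\<in>{1..}. \<xi> i \<omega>" and ?s = "\<lambda>x :: nat \<Rightarrow> real. \<lambda>n\<in>UNIV. x (Suc n)"
  note X = indep_uniform_distr[OF \<xi> ne]
  have s: "distr (\<Pi>\<^sub>M i\<in>{1..}. unif) (\<Pi>\<^sub>M n\<in>UNIV. unif) ?s = (\<Pi>\<^sub>M n\<in>UNIV. unif)"
    by (rule distr_PiM_reindex) (auto intro: prob_space_unif)
  have sm: "?s \<in> (\<Pi>\<^sub>M i\<in>{1..}. unif) \<rightarrow>\<^sub>M (\<Pi>\<^sub>M n\<in>UNIV. unif)"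
    by (rule measurable_restrict) (rule measurable_component_singleton, simp)
  have eq: "(\<lambda>\<omega>. to_stream (\<lambda>n. \<xi> (Suc n) \<omega>)) = (\<lambda>\<omega>. to_stream (?s (?X \<omega>)))"
    by (simp add: restrict_UNIV)
  have m: "(\<lambda>\<omega>. ?s (?X \<omega>)) \<in> M \<rightarrow>\<^sub>M (\<Pi>\<^sub>M n\<in>UNIV. unif)"
    by (rule measurable_compose[OF X(1) sm])
  show "(\<lambda>\<omega>. to_stream (\<lambda>n. \<xi> (Suc n) \<omega>)) \<in> M \<rightarrow>\<^sub>M unif_stream"
    unfolding eq by (rule measurable_compose[OF m measurable_to_stream])
  have "unif_stream = distr (distr (distr M (\<Pi>\<^sub>M i\<in>{1..}. unif) ?X) (\<Pi>\<^sub>M n\<in>UNIV. unif) ?s) unif_stream to_stream"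
    unfolding X(2) s by (rule stream_space_eq_distr)
  also have "\<dots> = distr M unif_stream (\<lambda>\<omega>. to_stream (?s (?X \<omega>)))"
  proof -
    have "distr (distr M (\<Pi>\<^sub>M i\<in>{1..}. unif) ?X) (\<Pi>\<^sub>M n\<in>UNIV. unif) ?s = distr M (\<Pi>\<^sub>M n\<in>UNIV. unif) (\<lambda>\<omega>. ?s (?X \<omega>))"
      by (subst distr_distr[OF sm X(1)]) (simp only: comp_def)
    moreover have "distr (distr M (\<Pi>\<^sub>M n\<in>UNIV. unif) (\<lambda>\<omega>. ?s (?X \<omega>))) unif_stream to_stream =
        distr M unif_stream (\<lambda>\<omega>. to_stream (?s (?X \<omega>)))"
      by (subst distr_distr[OF measurable_to_stream m]) (simp only: comp_def)
    ultimately show ?thesis by (simp only:)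
  qed
  finally show "distr M unif_stream (\<lambda>\<omega>. to_stream (\<lambda>n. \<xi> (Suc n) \<omega>)) = unif_stream"
    unfolding eq by simp
qed

lemma distr_bst_shape: "distr unif_stream tree_space (\<lambda>s. bst_shape (stake n s)) = distr split_space
    tree_space (random_tree n)"
proof (rule measure_eqI_countable[where A = "Collect finite"])
  show "countable (Collect finite :: node set set)" by (rule countable_Collect_finite)
  fix T :: "node set" assume T: "T \<in> Collect finite"
  have m: "(\<lambda>s. bst_shape (stake n s)) \<in> unif_stream \<rightarrow>\<^sub>M tree_space"
    using list_measurable_bst_shape by (simp add: list_measurable_def)
  have "emeasure (distr unif_stream tree_space (\<lambda>s. bst_shape (stake n s))) {T} = shape_prob n T"
    unfolding shape_prob_def sample_mean_def using T
    by (subst nn_integral_indicator[symmetric], simp, subst nn_integral_distr[OF m]) auto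
  moreover have "emeasure (distr split_space tree_space (random_tree n)) {T} = shape_prob n T"
    unfolding nn_integral_random_tree_indicator[symmetric] using T
    by (subst nn_integral_indicator[symmetric], simp, subst nn_integral_distr[OF measurable_random_tree]) auto
  ultimately show "emeasure (distr unif_stream tree_space (\<lambda>s. bst_shape (stake n s))) {T} =
    emeasure (distr split_space tree_space (random_tree n)) {T}" by simp
qed simp_all

lemma bst_sequence_law:
  assumes "bst_sequence M T" and n: "n \<ge> 1"
  shows "T n \<in> M \<rightarrow>\<^sub>M tree_space" "distr M tree_space (T n) = distr split_space tree_space (random_tree n)"
proof -
  obtain \<xi> where \<xi>: "indep_uniform M \<xi> {1..}"
    and T: "\<And>\<omega>. \<omega> \<in> space M \<Longrightarrow> T n \<omega> = dom (bst_labelled (\<lambda>i. \<xi> i \<omega>) n)"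
    using assms by (auto simp: bst_sequence_def)
  let ?s = "\<lambda>\<omega>. to_stream (\<lambda>n. \<xi> (Suc n) \<omega>)"
  note s = indep_uniform_stream[OF \<xi>]
  have eq: "T n \<omega> = bst_shape (stake n (?s \<omega>))" if "\<omega> \<in> space M" for \<omega>
  proof -
    have "map (\<lambda>i. \<xi> i \<omega>) [1..<Suc n] = stake n (?s \<omega>)"
      by (rule nth_equalityI) (auto simp: to_stream_def simp del: upt_Suc)
    then show ?thesis using T[OF that] by (simp only: bst_labelled_eq bst_shape_def)
  qed
  have m: "(\<lambda>s. bst_shape (stake n s)) \<in> unif_stream \<rightarrow>\<^sub>M tree_space"
    using list_measurable_bst_shape by (simp add: list_measurable_def)
  show "T n \<in> M \<rightarrow>\<^sub>M tree_space"
    using measurable_compose[OF s(1) m] by (simp add: eq cong: measurable_cong)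
  have "distr M tree_space (T n) = distr M tree_space (\<lambda>\<omega>. bst_shape (stake n (?s \<omega>)))"
    by (intro distr_cong eq) auto
  also have "\<dots> = distr (distr M unif_stream ?s) tree_space (\<lambda>s. bst_shape (stake n s))"
    by (subst distr_distr[OF m s(1)]) (simp add: comp_def)
  finally show "distr M tree_space (T n) = distr split_space tree_space (random_tree n)"
    unfolding s(2) distr_bst_shape .
qed

section \<open>Convergence of bounded continuous functionals\<close>

text \<open>Extending vectors by zero reduces the claim to the product topology on all real sequences, where
  the Borel \<open>\<sigma>\<close>-algebra is the product \<open>\<sigma>\<close>-algebra.\<close>

lemma borel_measurable_powertop_real:
  assumes g: "continuous_map (powertop_real {1..d}) euclideanreal g"
  shows "g \<in> borel_measurable (borel_vec d)"
proof -
  have "continuous_map (powertop_real UNIV) (powertop_real {1..d}) (\<lambda>x. restrict x {1..d})"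
    unfolding continuous_map_componentwise by (auto intro: continuous_map_product_projection)
  then have "continuous_map (powertop_real UNIV) euclideanreal (\<lambda>x. g (restrict x {1..d}))"
    using continuous_map_compose[OF _ g] by (simp add: comp_def)
  then have "continuous_on UNIV (\<lambda>x :: nat \<Rightarrow> real. g (restrict x {1..d}))"
    by (simp add: euclidean_product_topology)
  then have "(\<lambda>x. g (restrict x {1..d})) \<in> borel_measurable (borel :: (nat \<Rightarrow> real) measure)"
    by (rule borel_measurable_continuous_onI)
  then have g': "(\<lambda>x. g (restrict x {1..d})) \<in> borel_measurable (\<Pi>\<^sub>M i\<in>(UNIV :: nat set). borel :: real measure)"
    using measurable_cong_sets[OF sets_PiM_equal_borel refl] by blast
  have h: "(\<lambda>x i. if i \<in> {1..d} then x i else 0) \<in> borel_vec d \<rightarrow>\<^sub>M (\<Pi>\<^sub>M i\<in>(UNIV :: nat set). borel :: real measure)"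
  proof (rule measurable_PiM_single')
    show "(\<lambda>x. if i \<in> {1..d} then x i else 0) \<in> borel_measurable (borel_vec d)" for i
      by (cases "i \<in> {1..d}") auto
  qed auto
  have "(\<lambda>x. g (restrict (\<lambda>i. if i \<in> {1..d} then x i else 0) {1..d})) \<in> borel_measurable (borel_vec d)"
    by (rule measurable_compose[OF h g'])
  moreover have "restrict (\<lambda>i. if i \<in> {1..d} then x i else 0) {1..d} = x" if "x \<in> space (borel_vec d)" for x
      :: "nat \<Rightarrow> real"
    using that by (auto simp: space_PiM PiE_def extensional_def fun_eq_iff)
  ultimately show ?thesis
    by (subst measurable_cong[of _ g "\<lambda>x. g (restrict (\<lambda>i. if i \<in> {1..d} then x i else 0) {1..d})"]) simp_all
qed

text \<open>The vector whose convergence is claimed, for a fixed tree, and its limit on the space of splits.\<close>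

definition silhouette_vector :: "nat \<Rightarrow> node set \<Rightarrow> nat \<Rightarrow> real" where
  "silhouette_vector k T = stack (2 ^ k) (Delta k (centred_int_silhouette T)) (eta_circ T)"

definition limit_vector :: "nat \<Rightarrow> (node \<Rightarrow> real stream) \<Rightarrow> nat \<Rightarrow> real" where
  "limit_vector k \<omega> = stack (2 ^ k) (\<lambda>j. (cell_limit (ancestor k j k) \<omega> - eta_limit \<omega>) / 2 ^ k) (eta_limit \<omega>)"

lemma stack_extensional: "stack d v x \<in> extensional {1..d + 1}"
  by (simp add: stack_def rvec_def)

lemma stack_nth: "j \<in> {1..d} \<Longrightarrow> stack d v x j = v j" "stack d v x (d + 1) = x"
  by (auto simp: stack_def rvec_def)

lemma stack_cong: "(\<And>j. j \<in> {1..d} \<Longrightarrow> v j = v' j) \<Longrightarrow> x = x' \<Longrightarrow> stack d v x = stack d v' x'"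
  by (auto simp: stack_def rvec_def fun_eq_iff)

lemma silhouette_vector_random_tree:
  "silhouette_vector k (random_tree n \<omega>) = stack (2 ^ k)
    (\<lambda>j. (cell_mean (ancestor k j k) (random_tree n \<omega>) - cell_mean [] (random_tree n \<omega>)) / 2 ^ k)
    (cell_mean [] (random_tree n \<omega>) - harm n)"
proof -
  have T: "binary_tree (random_tree n \<omega>)" "card (random_tree n \<omega>) = n"
    using random_tree_tree by auto
  show ?thesis
    unfolding silhouette_vector_def
  proof (rule stack_cong)
    fix j :: nat assume j: "j \<in> {1..2 ^ k}"
    show "Delta k (centred_int_silhouette (random_tree n \<omega>)) j =
      (cell_mean (ancestor k j k) (random_tree n \<omega>) - cell_mean [] (random_tree n \<omega>)) / 2 ^ k"
      using j cell_left_ancestor[of j k k]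
      by (intro Delta_centred_int_silhouette[OF T(1)]) (auto simp: of_nat_diff)
  qed (simp add: eta_circ_def eta_eq_cell_mean[OF T(1)] T(2))
qed

lemma tendsto_0_if_min_square:
  fixes x :: "nat \<Rightarrow> real"
  assumes "(\<lambda>n. min 1 ((x n)\<^sup>2)) \<longlonglongrightarrow> 0"
  shows "x \<longlonglongrightarrow> 0"
proof -
  have "\<forall>\<^sub>F n in sequentially. min 1 ((x n)\<^sup>2) < 1"
    by (rule order_tendstoD[OF assms]) simp
  then have "\<forall>\<^sub>F n in sequentially. min 1 ((x n)\<^sup>2) = (x n)\<^sup>2"
    by eventually_elim (auto simp: min_def)
  with assms have "(\<lambda>n. (x n)\<^sup>2) \<longlonglongrightarrow> 0"
    by (rule Lim_transform_eventually)
  from tendsto_real_sqrt[OF this] have "(\<lambda>n. \<bar>x n\<bar>) \<longlonglongrightarrow> 0" by simp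
  then show ?thesis by (rule tendsto_rabs_zero_cancel)
qed

lemma silhouette_vector_tendsto:
  assumes gap: "\<And>w. w = [] \<or> length w = k \<Longrightarrow> (\<lambda>n. cell_gap w (r n) \<omega>) \<longlonglongrightarrow> 0"
  shows "limitin (powertop_real {1..2 ^ k + 1}) (\<lambda>n. silhouette_vector k (random_tree (r n) \<omega>)) (limit_vector
      k \<omega>) sequentially"
  unfolding limitin_componentwise
proof (intro conjI ballI)
  show "limit_vector k \<omega> \<in> extensional {1..2 ^ k + 1}"
    unfolding limit_vector_def by (rule stack_extensional)
  show "\<forall>\<^sub>F n in sequentially. silhouette_vector k (random_tree (r n) \<omega>) \<in> topspace (powertop_real {1..2 ^ k + 1})"
    using stack_extensional by (simp add: silhouette_vector_def PiE_UNIV_domain PiE_def)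
  fix i :: nat assume i: "i \<in> {1..2 ^ k + 1}"
  have "(\<lambda>n. silhouette_vector k (random_tree (r n) \<omega>) i) \<longlonglongrightarrow> limit_vector k \<omega> i"
  proof (cases "i = 2 ^ k + 1")
    case True
    have "(\<lambda>n. cell_gap [] (r n) \<omega> + eta_limit \<omega>) \<longlonglongrightarrow> 0 + eta_limit \<omega>"
      by (intro tendsto_add gap tendsto_const) simp
    then show ?thesis
      unfolding True silhouette_vector_random_tree limit_vector_def stack_nth by (simp add: cell_gap_def)
  next
    case False
    with i have i: "i \<in> {1..2 ^ k}" by auto
    let ?w = "ancestor k i k"
    have "(\<lambda>n. (cell_gap ?w (r n) \<omega> - cell_gap [] (r n) \<omega>) / 2 ^ k + (cell_limit ?w \<omega> - eta_limit \<omega>) / 2 ^ k)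
        \<longlonglongrightarrow> (0 - 0) / 2 ^ k + (cell_limit ?w \<omega> - eta_limit \<omega>) / 2 ^ k"
      by (intro tendsto_intros gap) auto
    then show ?thesis
      unfolding silhouette_vector_random_tree limit_vector_def stack_nth(1)[OF i]
      by (simp add: cell_gap_def diff_divide_distrib add_divide_distrib algebra_simps)
  qed
  then show "limitin euclideanreal (\<lambda>n. silhouette_vector k (random_tree (r n) \<omega>) i) (limit_vector k \<omega> i) sequentially"
    by simp
qed

lemma finite_words: "finite {w :: node. length w = k}"
  using finite_lists_length_eq[of "UNIV :: bool set" k] by simp

lemma measurable_stack:
  assumes "\<And>j. j \<in> {1..d} \<Longrightarrow> (\<lambda>\<omega>. v \<omega> j) \<in> borel_measurable M" "x \<in> borel_measurable M"
  shows "(\<lambda>\<omega>. stack d (v \<omega>) (x \<omega>)) \<in> M \<rightarrow>\<^sub>M borel_vec (d + 1)"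
  unfolding stack_def rvec_def
proof (rule measurable_restrict)
  fix i assume "i \<in> {1..d + 1}"
  then show "(\<lambda>\<omega>. if i \<le> d then v \<omega> i else x \<omega>) \<in> borel_measurable M"
    using assms by (cases "i \<le> d") auto
qed

lemma measurable_limit_vector: "limit_vector k \<in> split_space \<rightarrow>\<^sub>M borel_vec (2 ^ k + 1)"
proof -
  have "(\<lambda>\<omega>. stack (2 ^ k) (\<lambda>j. (cell_limit (ancestor k j k) \<omega> - eta_limit \<omega>) / 2 ^ k) (eta_limit \<omega>)) \<in>
      split_space \<rightarrow>\<^sub>M borel_vec (2 ^ k + 1)"
    by (rule measurable_stack) measurable
  then show ?thesis by (simp add: limit_vector_def[abs_def])
qed

text \<open>Every subsequence has a further subsequence along which all errors involved tend to zero almost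
  surely, and then dominated convergence applies.\<close>

lemma expectation_silhouette_vector_tendsto:
  assumes g: "continuous_map (powertop_real {1..2 ^ k + 1}) euclideanreal g"
    and bounded: "bounded (g ` topspace (powertop_real {1..2 ^ k + 1}))"
  shows "(\<lambda>n. LINT \<omega>|split_space. g (silhouette_vector k (random_tree n \<omega>))) \<longlonglongrightarrow> (LINT \<omega>|split_space. g
      (limit_vector k \<omega>))"
proof (rule ccontr)
  let ?a = "\<lambda>n. LINT \<omega>|split_space. g (silhouette_vector k (random_tree n \<omega>))"
  let ?L = "LINT \<omega>|split_space. g (limit_vector k \<omega>)"
  assume "\<not> ?a \<longlonglongrightarrow> ?L"
  then obtain e where e: "e > 0" and freq: "\<not> (\<forall>\<^sub>F n in sequentially. dist (?a n) ?L < e)"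
    unfolding tendsto_iff by blast
  from freq have "infinite {n. \<not> dist (?a n) ?L < e}"
    unfolding not_eventually frequently_cofinite[symmetric] cofinite_eq_sequentially .
  then obtain r :: "nat \<Rightarrow> nat" where r: "strict_mono r" and far: "\<And>n. \<not> dist (?a (r n)) ?L < e"
    using infinite_enumerate by blast
  define A where "A = insert [] {w :: node. length w = k}"
  have finA: "finite A" by (simp add: A_def finite_words)
  define u where "u n \<omega> = (\<Sum>w\<in>A. min 1 ((cell_gap w (r n) \<omega>)\<^sup>2))" for n \<omega>
  have u_nonneg: "0 \<le> u n \<omega>" for n \<omega> unfolding u_def by (intro sum_nonneg) auto
  have u_int: "integrable split_space (u n)" for n
    unfolding u_def[abs_def] by (intro Bochner_Integration.integrable_sum integrable_gap)
  have "(LINT \<omega>|split_space. norm (u n \<omega>)) = (\<Sum>w\<in>A. gap_size w (r n))" for n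
    using u_nonneg unfolding gap_size_def u_def by (simp add: Bochner_Integration.integral_sum integrable_gap)
  moreover have "(\<lambda>n. \<Sum>w\<in>A. gap_size w (r n)) \<longlonglongrightarrow> 0"
    by (rule tendsto_null_sum) (use LIMSEQ_subseq_LIMSEQ[OF gap_size_tendsto_0 r] in \<open>simp add: comp_def\<close>)
  ultimately have "(\<lambda>n. LINT \<omega>|split_space. norm (u n \<omega>)) \<longlonglongrightarrow> 0" by simp
  from tendsto_L1_AE_subseq[OF u_int this] obtain s :: "nat \<Rightarrow> nat"
    where s: "strict_mono s" and u_lim: "AE \<omega> in split_space. (\<lambda>n. u (s n) \<omega>) \<longlonglongrightarrow> 0" by auto
  have conv: "AE \<omega> in split_space. (\<lambda>n. g (silhouette_vector k (random_tree (r (s n)) \<omega>))) \<longlonglongrightarrow> g (limit_vector k \<omega>)"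
    using u_lim
  proof eventually_elim
    case (elim \<omega>)
    have "(\<lambda>n. cell_gap w (r (s n)) \<omega>) \<longlonglongrightarrow> 0" if "w = [] \<or> length w = k" for w
    proof (rule tendsto_0_if_min_square, rule tendsto_sandwich[OF _ _ tendsto_const elim])
      have "w \<in> A" using that by (auto simp: A_def)
      then have "min 1 ((cell_gap w (r (s n)) \<omega>)\<^sup>2) \<le> u (s n) \<omega>" for n
        unfolding u_def by (intro member_le_sum finA) auto
      then show "\<forall>\<^sub>F n in sequentially. min 1 ((cell_gap w (r (s n)) \<omega>)\<^sup>2) \<le> u (s n) \<omega>" by simp
    qed simp
    then have "limitin (powertop_real {1..2 ^ k + 1}) (\<lambda>n. silhouette_vector k (random_tree (r (s n)) \<omega>))
        (limit_vector k \<omega>) sequentially"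
      by (rule silhouette_vector_tendsto)
    from continuous_map_limit[OF g this] show ?case by (simp add: comp_def)
  qed
  obtain B where B: "\<And>x. x \<in> topspace (powertop_real {1..2 ^ k + 1}) \<Longrightarrow> norm (g x) \<le> B"
    using bounded unfolding bounded_iff by auto
  have top: "silhouette_vector k T \<in> topspace (powertop_real {1..2 ^ k + 1})" for T
    using stack_extensional by (simp add: silhouette_vector_def PiE_def)
  have "(\<lambda>n. ?a (r (s n))) \<longlonglongrightarrow> ?L"
  proof (rule integral_dominated_convergence[OF _ _ _ conv])
    show "(\<lambda>\<omega>. g (limit_vector k \<omega>)) \<in> borel_measurable split_space"
      by (rule measurable_compose[OF measurable_limit_vector borel_measurable_powertop_real[OF g]])
    show "(\<lambda>\<omega>. g (silhouette_vector k (random_tree (r (s n)) \<omega>))) \<in> borel_measurable split_space" for n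
      by (rule measurable_fun_random_tree) simp
    show "integrable split_space (\<lambda>_. B)" by simp
    show "AE \<omega> in split_space. norm (g (silhouette_vector k (random_tree (r (s n)) \<omega>))) \<le> B" for n
      using B[OF top] by simp
  qed
  then have "\<forall>\<^sub>F n in sequentially. dist (?a (r (s n))) ?L < e"
    using e by (rule tendstoD)
  then show False using far by (auto simp: eventually_sequentially)
qed

section \<open>The law of the limit vector\<close>

text \<open>The sum of the logarithms of the proportions in which the splitting values on the path to \<open>w\<close>
  divide the sample.\<close>

definition path_log :: "node \<Rightarrow> (node \<Rightarrow> real) \<Rightarrow> real" where
  "path_log w x = (\<Sum>l<length w. ln (if w ! l then x (take l w) else 1 - x (take l w)))"

lemma rho_rep_eq_path_log: "rho_rep k x j = path_log (ancestor k j k) x"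
proof -
  let ?f = "\<lambda>l. ln (if node_bit k j l then x (ancestor k j (l - 1)) else 1 - x (ancestor k j (l - 1)))"
  have "rho_rep k x j = (\<Sum>l\<in>{l \<in> {1..k}. node_bit k j l}. ?f l) + (\<Sum>l\<in>{l \<in> {1..k}. \<not> node_bit k j l}. ?f l)"
    unfolding rho_rep_def by (intro arg_cong2[of _ _ _ _ "(+)"] sum.cong) auto
  also have "\<dots> = (\<Sum>l\<in>{l \<in> {1..k}. node_bit k j l} \<union> {l \<in> {1..k}. \<not> node_bit k j l}. ?f l)"
    by (intro sum.union_disjoint[symmetric]) auto
  also have "{l \<in> {1..k}. node_bit k j l} \<union> {l \<in> {1..k}. \<not> node_bit k j l} = Suc ` {..<k}"
    by (auto simp: image_Suc_lessThan)
  also have "(\<Sum>l\<in>Suc ` {..<k}. ?f l) = (\<Sum>l<k. ?f (Suc l))"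
    by (simp add: sum.reindex)
  also have "\<dots> = path_log (ancestor k j k) x"
    unfolding path_log_def length_ancestor
    by (intro sum.cong refl arg_cong[where f = ln]) (simp add: nth_ancestor take_ancestor)
  finally show ?thesis .
qed

lemma cell_limit_eq:
  "cell_limit w \<omega> = real (length w) + path_log w (\<lambda>u. shd (\<omega> u)) + eta_limit (\<lambda>v. \<omega> (w @ v))"
proof (induction w arbitrary: \<omega>)
  case Nil
  then show ?case by (simp add: path_log_def)
next
  case (Cons b w)
  have "path_log (b # w) (\<lambda>u. shd (\<omega> u)) =
      ln (if b then shd (\<omega> []) else 1 - shd (\<omega> [])) + path_log w (\<lambda>u. shd (descend b \<omega> u))"
    unfolding path_log_def length_Cons by (subst sum.lessThan_Suc_shift) (simp add: descend_def cong: if_cong)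
  then show ?case by (simp add: Cons descend_def)
qed

lemma sum_words_Suc:
  "(\<Sum>w | length w = Suc k. f w) = (\<Sum>w | length w = k. f (False # w)) + (\<Sum>w | length w = k. f (True # w) :: real)"
proof -
  have "{w :: node. length w = Suc k} = Cons False ` {w. length w = k} \<union> Cons True ` {w. length w = k}"
  proof (intro set_eqI iffI)
    fix w :: node assume "w \<in> {w. length w = Suc k}"
    then obtain b v where "w = b # v" "length v = k" by (auto simp: length_Suc_conv)
    then show "w \<in> Cons False ` {w. length w = k} \<union> Cons True ` {w. length w = k}" by (cases b) auto
  qed auto
  then have "(\<Sum>w | length w = Suc k. f w) = sum f (Cons False ` {w. length w = k}) + sum f (Cons True ` {w.
      length w = k})"
    by (simp only:) (rule sum.union_disjoint, use finite_words[of k] in auto)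
  then show ?thesis by (simp add: sum.reindex)
qed

lemma card_words: "card {w :: node. length w = k} = 2 ^ k"
  using card_lists_length_eq[of "UNIV :: bool set" k] by simp

text \<open>Iterating the recursion of \<open>eta_limit\<close> over \<open>k\<close> levels expresses it by the limits over the words
  of length \<open>k\<close>.\<close>

lemma AE_eta_limit_average:
  "AE \<omega> in split_space. eta_limit \<omega> = (\<Sum>w | length w = k. cell_limit w \<omega>) / 2 ^ k"
proof (induction k)
  case 0
  have "{w :: node. length w = 0} = {[]}" by auto
  then show ?case by simp
next
  case (Suc k)
  show ?case
    using AE_eta_limit_rec AE_descend[OF Suc, of False] AE_descend[OF Suc, of True]
  proof eventually_elim
    case (elim \<omega>)
    have "(\<Sum>w | length w = Suc k. cell_limit w \<omega>) =
       2 ^ k * (1 + ln (1 - shd (\<omega> []))) + 2 ^ k * eta_limit (descend False \<omega>) +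
       (2 ^ k * (1 + ln (shd (\<omega> []))) + 2 ^ k * eta_limit (descend True \<omega>))"
      unfolding sum_words_Suc elim(2,3) by (simp add: sum.distrib card_words)
    then show ?case unfolding elim(1) zeta_infty_def by (simp add: field_simps)
  qed
qed

text \<open>The limit vector of the theorem as a function of the vectors \<open>\<rho>_k\<close> and \<open>\<eta>_k\<close>; the auxiliary value
  \<open>m\<close> is \<open>\<eta>\<degree>_\<infinity>\<close>.\<close>

definition combine :: "nat \<Rightarrow> (nat \<Rightarrow> real) \<Rightarrow> (nat \<Rightarrow> real) \<Rightarrow> nat \<Rightarrow> real" where
  "combine k r e = (let m = (\<Sum>j=1..2 ^ k. real k + r j + e j) / 2 ^ k in
     stack (2 ^ k) (\<lambda>j. (real k + r j + e j - m) / 2 ^ k) m)"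

lemma combine_rvec: "combine k (rvec (2 ^ k) r) (rvec (2 ^ k) e) = combine k r e"
proof -
  have "(\<Sum>j=1..2 ^ k. real k + rvec (2 ^ k) r j + rvec (2 ^ k) e j) = (\<Sum>j=1..2 ^ k. real k + r j + e j)"
    by (intro sum.cong) (auto simp: rvec_def)
  then show ?thesis
    unfolding combine_def Let_def by (intro stack_cong) (auto simp: rvec_def)
qed

lemma measurable_combine:
  "(\<lambda>z. combine k (fst z) (snd z)) \<in> borel_vec (2 ^ k) \<Otimes>\<^sub>M borel_vec (2 ^ k) \<rightarrow>\<^sub>M borel_vec (2 ^ k + 1)"
proof -
  have c [measurable]: "(\<lambda>z. fst z j) \<in> borel_measurable (borel_vec (2 ^ k) \<Otimes>\<^sub>M borel_vec (2 ^ k))"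
    "(\<lambda>z. snd z j) \<in> borel_measurable (borel_vec (2 ^ k) \<Otimes>\<^sub>M borel_vec (2 ^ k))" if "j \<in> {1..2 ^ k}" for j :: nat
    by (rule measurable_compose[OF measurable_fst measurable_component_singleton[OF that]],
        rule measurable_compose[OF measurable_snd measurable_component_singleton[OF that]])
  have m [measurable]: "(\<lambda>z. (\<Sum>j=1..2 ^ k. real k + fst z j + snd z j) / 2 ^ k) \<in> borel_measurable (borel_vec
      (2 ^ k) \<Otimes>\<^sub>M borel_vec (2 ^ k))"
    by (intro borel_measurable_divide borel_measurable_sum borel_measurable_add c) auto
  show ?thesis
    unfolding combine_def Let_def
  proof (rule measurable_stack)
    fix j :: nat assume j: "j \<in> {1..2 ^ k}"
    show "(\<lambda>z. (real k + fst z j + snd z j - (\<Sum>j=1..2 ^ k. real k + fst z j + snd z j) / 2 ^ k) / 2 ^ k)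
      \<in> borel_measurable (borel_vec (2 ^ k) \<Otimes>\<^sub>M borel_vec (2 ^ k))"
      by (intro borel_measurable_divide borel_measurable_add borel_measurable_diff c[OF j] m) auto
  qed (rule m)
qed

lemma AE_limit_vector_eq_combine:
  "AE \<omega> in split_space. limit_vector k \<omega> = combine k (rho_rep k (\<lambda>u. shd (\<omega> u))) (\<lambda>j. eta_limit (\<lambda>v. \<omega>
      (ancestor k j k @ v)))"
  using AE_eta_limit_average[of k]
proof eventually_elim
  case (elim \<omega>)
  have cl: "cell_limit (ancestor k j k) \<omega> = real k + rho_rep k (\<lambda>u. shd (\<omega> u)) j + eta_limit (\<lambda>v. \<omega> (ancestor
      k j k @ v))" for j
    by (simp add: cell_limit_eq rho_rep_eq_path_log)
  have "(\<Sum>w | length w = k. cell_limit w \<omega>) = (\<Sum>j=1..2 ^ k. cell_limit (ancestor k j k) \<omega>)"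
    by (rule sum.reindex_bij_betw[OF bij_betw_ancestor, symmetric])
  then show ?case
    unfolding combine_def limit_vector_def Let_def cl[symmetric] by (simp add: elim)
qed

lemma indep_vars_split_space: "split_space.indep_vars (\<lambda>_. unif_stream) (\<lambda>u \<omega>. \<omega> u) UNIV"
proof (subst split_space.indep_vars_iff_distr_eq_PiM')
  have "distr split_space (PiM UNIV (\<lambda>_. unif_stream)) (\<lambda>\<omega>. \<lambda>u\<in>UNIV. \<omega> u) = split_space"
    unfolding restrict_UNIV by (rule distr_id2) (simp add: split_space_def)
  then show "distr split_space (PiM UNIV (\<lambda>_. unif_stream)) (\<lambda>\<omega>. \<lambda>u\<in>UNIV. \<omega> u) =
     (\<Pi>\<^sub>M u\<in>UNIV. distr split_space unif_stream (\<lambda>\<omega>. \<omega> u))"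
    by (simp only: distr_split_space_component) (simp only: split_space_def)
qed simp_all

lemma indep_uniform_split_space: "indep_uniform split_space (\<lambda>u \<omega>. shd (\<omega> u)) UNIV"
  unfolding indep_uniform_def unif_def[symmetric]
proof (intro conjI ballI)
  show "prob_space split_space" by (rule split_space.prob_space_axioms)
  show "split_space.indep_vars (\<lambda>_. borel) (\<lambda>u \<omega>. shd (\<omega> u)) UNIV"
    by (rule split_space.indep_vars_compose2[OF indep_vars_split_space]) simp
  fix u
  have "distr split_space borel (\<lambda>\<omega>. shd (\<omega> u)) = distr split_space unif (\<lambda>\<omega>. shd (\<omega> u))"
    by (intro distr_cong) auto
  also have "\<dots> = distr (distr split_space unif_stream (\<lambda>\<omega>. \<omega> u)) unif shd"
    by (subst distr_distr) (auto simp: comp_def)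
  finally show "distr split_space borel (\<lambda>\<omega>. shd (\<omega> u)) = unif"
    by (simp only: distr_split_space_component distr_shd)
qed

lemma measurable_append: "(\<lambda>\<omega> v. \<omega> (w @ v)) \<in> split_space \<rightarrow>\<^sub>M split_space"
  by (rule measurable_into_split_space) simp

lemma distr_append: "distr split_space split_space (\<lambda>\<omega> v. \<omega> (w @ v)) = split_space"
proof -
  have "distr (PiM UNIV (\<lambda>_. unif_stream)) (PiM UNIV (\<lambda>_. unif_stream)) (\<lambda>\<omega>. \<lambda>v\<in>UNIV. \<omega> (w @ v)) =
    PiM UNIV (\<lambda>u :: node. unif_stream)"
    by (rule distr_PiM_reindex) (auto intro: unif_stream.prob_space_axioms injI)
  then show ?thesis unfolding split_space_def by (simp only: restrict_UNIV)
qed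

lemma distr_eta_limit_append: "distr split_space borel (\<lambda>\<omega>. eta_limit (\<lambda>v. \<omega> (w @ v))) = eta_infty_law"
proof -
  have "distr split_space borel (\<lambda>\<omega>. eta_limit (\<lambda>v. \<omega> (w @ v))) =
     distr (distr split_space split_space (\<lambda>\<omega> v. \<omega> (w @ v))) borel eta_limit"
    by (subst distr_distr[OF measurable_eta_limit measurable_append]) (simp add: comp_def)
  then show ?thesis unfolding distr_append eta_infty_law_eq .
qed

lemma measurable_rho_rep:
  "(\<lambda>x. rvec (2 ^ k) (rho_rep k x)) \<in> (\<Pi>\<^sub>M u\<in>UNIV. unif) \<rightarrow>\<^sub>M borel_vec (2 ^ k)"
proof -
  have [measurable]: "(\<lambda>x. x u) \<in> borel_measurable (\<Pi>\<^sub>M u\<in>UNIV. unif)" for u :: node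
    using measurable_component_singleton[of u UNIV "\<lambda>_. unif"] by simp
  show ?thesis unfolding rvec_def rho_rep_def by (rule measurable_restrict) measurable
qed

lemma distr_rho_rep:
  assumes "indep_uniform P \<xi> UNIV"
  shows "distr P (borel_vec (2 ^ k)) (\<lambda>\<omega>. rvec (2 ^ k) (rho_rep k (\<lambda>u. \<xi> u \<omega>))) =
    distr (\<Pi>\<^sub>M u\<in>UNIV. unif) (borel_vec (2 ^ k)) (\<lambda>x. rvec (2 ^ k) (rho_rep k x))"
proof -
  note \<xi> = indep_uniform_distr[OF assms UNIV_not_empty, unfolded restrict_UNIV]
  show ?thesis
    by (subst \<xi>(2)[symmetric], subst distr_distr[OF measurable_rho_rep \<xi>(1)]) (simp add: comp_def)
qed

text \<open>The vector \<open>\<rho>_k\<close> is a function of the streams at depth less than \<open>k\<close>, and the components of \<open>\<eta>_k\<close>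
  are functions of the streams in the disjoint subtrees rooted at depth \<open>k\<close>.\<close>

lemma split_space_rho_eta:
  fixes k :: nat
  defines "\<rho> \<equiv> \<lambda>\<omega> :: node \<Rightarrow> real stream. rvec (2 ^ k) (rho_rep k (\<lambda>u. shd (\<omega> u)))"
    and "\<eta> \<equiv> \<lambda>\<omega>. rvec (2 ^ k) (\<lambda>j. eta_limit (\<lambda>v. \<omega> (ancestor k j k @ v)))"
  shows "split_space.indep_var (borel_vec (2 ^ k)) \<rho> (borel_vec (2 ^ k)) \<eta>"
    and "split_space.indep_vars (\<lambda>_. borel) (\<lambda>j \<omega>. eta_limit (\<lambda>v. \<omega> (ancestor k j k @ v))) {1..2 ^ k}"
proof -
  let ?w = "\<lambda>j. ancestor k j k"
  have tail: "(\<lambda>x. eta_limit (\<lambda>v. x (w @ v))) \<in> borel_measurable (PiM K (\<lambda>_. unif_stream))" if "range (\<lambda>v. w @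
      v) \<subseteq> K" for w K
  proof (rule measurable_compose[OF measurable_into_split_space measurable_eta_limit])
    show "(\<lambda>x. x (w @ v)) \<in> PiM K (\<lambda>_. unif_stream) \<rightarrow>\<^sub>M unif_stream" for v
      using that by (intro measurable_component_singleton) auto
  qed
  let ?A = "{u :: node. length u < k}" and ?B = "{u :: node. k \<le> length u}"
  let ?F = "\<lambda>x. rvec (2 ^ k) (rho_rep k (\<lambda>u. shd (x u)))"
    and ?G = "\<lambda>x. rvec (2 ^ k) (\<lambda>j. eta_limit (\<lambda>v. x (?w j @ v)))"
  have F: "?F \<in> PiM ?A (\<lambda>_. unif_stream) \<rightarrow>\<^sub>M borel_vec (2 ^ k)"
    unfolding rvec_def rho_rep_def
  proof (intro measurable_restrict borel_measurable_add borel_measurable_sum)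
    have c: "(\<lambda>x. shd (x (ancestor k i (l - 1)))) \<in> borel_measurable (PiM ?A (\<lambda>_. unif_stream))" if "l \<in> {1..k}" for i l
      by (rule measurable_compose[OF _ measurable_shd_borel], rule measurable_component_singleton) (use that in auto)
    show "(\<lambda>x. ln (shd (x (ancestor k i (l - 1))))) \<in> borel_measurable (PiM ?A (\<lambda>_. unif_stream))"
      if "l \<in> {l. l \<in> {1..k} \<and> node_bit k i l}" for i l
      using c[of l i] that by auto
    show "(\<lambda>x. ln (1 - shd (x (ancestor k i (l - 1))))) \<in> borel_measurable (PiM ?A (\<lambda>_. unif_stream))"
      if "l \<in> {l. l \<in> {1..k} \<and> \<not> node_bit k i l}" for i l
      using c[of l i] that by auto
  qed
  have G: "?G \<in> PiM ?B (\<lambda>_. unif_stream) \<rightarrow>\<^sub>M borel_vec (2 ^ k)"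
    unfolding rvec_def by (intro measurable_restrict tail) auto
  have "split_space.indep_var (PiM ?A (\<lambda>_. unif_stream)) (\<lambda>\<omega>. restrict (\<lambda>u. \<omega> u) ?A) (PiM ?B (\<lambda>_.
      unif_stream)) (\<lambda>\<omega>. restrict (\<lambda>u. \<omega> u) ?B)"
    by (rule split_space.indep_var_restrict[OF indep_vars_split_space]) auto
  from split_space.indep_var_compose[OF this F G]
  have "split_space.indep_var (borel_vec (2 ^ k)) (\<lambda>\<omega>. ?F (restrict \<omega> ?A)) (borel_vec (2 ^ k)) (\<lambda>\<omega>. ?G (restrict \<omega> ?B))"
    by (simp add: comp_def)
  moreover have "?F (restrict \<omega> ?A) = \<rho> \<omega>" for \<omega>
  proof -
    have "rho_rep k (\<lambda>u. shd (restrict \<omega> ?A u)) j = rho_rep k (\<lambda>u. shd (\<omega> u)) j" for j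
      unfolding rho_rep_def by (intro arg_cong2[of _ _ _ _ "(+)"] sum.cong) auto
    then show ?thesis by (simp add: \<rho>_def rvec_def)
  qed
  moreover have "?G (restrict \<omega> ?B) = \<eta> \<omega>" for \<omega>
    by (simp add: \<eta>_def)
  ultimately show "split_space.indep_var (borel_vec (2 ^ k)) \<rho> (borel_vec (2 ^ k)) \<eta>" by simp
  let ?K = "\<lambda>j. range (\<lambda>v. ?w j @ v)"
  have disj: "disjoint_family_on ?K {1..2 ^ k}"
    unfolding disjoint_family_on_def
  proof (intro ballI impI)
    fix i j :: nat assume ij: "i \<in> {1..2 ^ k}" "j \<in> {1..2 ^ k}" "i \<noteq> j"
    then have "?w i \<noteq> ?w j" using bij_betw_ancestor[of k] by (auto simp: bij_betw_def inj_on_def)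
    then show "?K i \<inter> ?K j = {}" by (auto simp: append_eq_append_conv)
  qed
  from split_space.indep_vars_restrict[OF indep_vars_split_space _ disj]
  have "split_space.indep_vars (\<lambda>j. PiM (?K j) (\<lambda>_. unif_stream)) (\<lambda>j \<omega>. restrict (\<lambda>u. \<omega> u) (?K j)) {1..2 ^ k}"
    by simp
  from split_space.indep_vars_compose2[OF this, of "\<lambda>j x. eta_limit (\<lambda>v. x (?w j @ v))" "\<lambda>_. borel"]
  show "split_space.indep_vars (\<lambda>_. borel) (\<lambda>j \<omega>. eta_limit (\<lambda>v. \<omega> (?w j @ v))) {1..2 ^ k}"
    using tail by simp
qed

section \<open>Convergence in distribution\<close>

text \<open>The assumptions of the theorem determine the joint law of the two vectors, so that they may be
  replaced by those on the space of splits.\<close>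

lemma joint_law:
  assumes N: "prob_space N"
    and indep: "prob_space.indep_var N (borel_vec d) (\<lambda>\<omega>. rvec d (\<lambda>j. \<rho> j \<omega>)) (borel_vec d) (\<lambda>\<omega>. rvec d (\<lambda>j. \<eta> j \<omega>))"
    and eta_indep: "prob_space.indep_vars N (\<lambda>_. borel) \<eta> {1..d}"
    and eta_law: "\<And>j. j \<in> {1..d} \<Longrightarrow> distr N borel (\<eta> j) = \<mu>" and d: "d \<ge> 1"
  shows "distr N (borel_vec d \<Otimes>\<^sub>M borel_vec d) (\<lambda>\<omega>. (rvec d (\<lambda>j. \<rho> j \<omega>), rvec d (\<lambda>j. \<eta> j \<omega>))) =
    distr N (borel_vec d) (\<lambda>\<omega>. rvec d (\<lambda>j. \<rho> j \<omega>)) \<Otimes>\<^sub>M (\<Pi>\<^sub>M j\<in>{1..d}. \<mu>)"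
proof -
  interpret N: prob_space N by fact
  have ne: "{1..d} \<noteq> {}" using d by auto
  have rv: "\<eta> j \<in> borel_measurable N" if "j \<in> {1..d}" for j
    using eta_indep that by (auto simp: N.indep_vars_def)
  have "distr N (borel_vec d) (\<lambda>\<omega>. rvec d (\<lambda>j. \<eta> j \<omega>)) = (\<Pi>\<^sub>M j\<in>{1..d}. distr N borel (\<eta> j))"
    unfolding rvec_def using eta_indep by (subst (asm) N.indep_vars_iff_distr_eq_PiM'[OF ne rv]) auto
  also have "\<dots> = (\<Pi>\<^sub>M j\<in>{1..d}. \<mu>)"
    by (intro PiM_cong eta_law) auto
  finally show ?thesis
    using indep by (simp add: N.indep_var_distribution_eq)
qed

theorem theorem4:
  fixes M :: "'a measure" and T :: "nat \<Rightarrow> 'a \<Rightarrow> node set"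
    and N :: "'b measure" and \<rho> \<eta> :: "nat \<Rightarrow> 'b \<Rightarrow> real"
    and P :: "'c measure" and \<xi> :: "node \<Rightarrow> 'c \<Rightarrow> real"
    and k :: nat and \<eta>inf :: "'b \<Rightarrow> real"
  assumes bst: "bst_sequence M T"
    and k: "k \<ge> 1"
    and N: "prob_space N"
    and rho_eta_indep: "prob_space.indep_var N
          (borel_vec (2 ^ k)) (\<lambda>\<omega>. rvec (2 ^ k) (\<lambda>j. \<rho> j \<omega>))
          (borel_vec (2 ^ k)) (\<lambda>\<omega>. rvec (2 ^ k) (\<lambda>j. \<eta> j \<omega>))"
    and eta_indep: "prob_space.indep_vars N (\<lambda>_. borel) \<eta> {1..2 ^ k}"
    and eta_law: "\<And>j. j \<in> {1..2 ^ k} \<Longrightarrow> distr N borel (\<eta> j) = eta_infty_law"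
    and xi: "indep_uniform P \<xi> UNIV"
    and rho_law: "distr N (borel_vec (2 ^ k)) (\<lambda>\<omega>. rvec (2 ^ k) (\<lambda>j. \<rho> j \<omega>)) =
          distr P (borel_vec (2 ^ k)) (\<lambda>\<omega>. rvec (2 ^ k) (rho_rep k (\<lambda>u. \<xi> u \<omega>)))"
    and eta_inf: "\<And>\<omega>. \<eta>inf \<omega> = (\<Sum>j=1..2 ^ k. real k + \<rho> j \<omega> + \<eta> j \<omega>) / 2 ^ k"
  shows "conv_in_distr (2 ^ k + 1)
     M (\<lambda>n \<omega>. stack (2 ^ k) (Delta k (centred_int_silhouette (T n \<omega>))) (eta_circ (T n \<omega>)))
     N (\<lambda>\<omega>. stack (2 ^ k) (\<lambda>j. (real k + \<rho> j \<omega> + \<eta> j \<omega> - \<eta>inf \<omega>) / 2 ^ k) (\<eta>inf \<omega>))"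
proof -
  interpret N: prob_space N by fact
  let ?d = "2 ^ k :: nat"
  let ?X = "\<lambda>\<omega>. (rvec ?d (\<lambda>j. \<rho> j \<omega>), rvec ?d (\<lambda>j. \<eta> j \<omega>))"
  let ?Z = "\<lambda>\<omega>. stack (2 ^ k) (\<lambda>j. (real k + \<rho> j \<omega> + \<eta> j \<omega> - \<eta>inf \<omega>) / 2 ^ k) (\<eta>inf \<omega>)"
  let ?\<rho>' = "\<lambda>j \<omega>. rho_rep k (\<lambda>u. shd (\<omega> u)) j"
    and ?\<eta>' = "\<lambda>j \<omega>. eta_limit (\<lambda>v. \<omega> (ancestor k j k @ v))"
  let ?X' = "\<lambda>\<omega>. (rvec ?d (\<lambda>j. ?\<rho>' j \<omega>), rvec ?d (\<lambda>j. ?\<eta>' j \<omega>))"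
  have Z_eq: "?Z \<omega> = combine k (fst (?X \<omega>)) (snd (?X \<omega>))" for \<omega>
    unfolding fst_conv snd_conv combine_rvec by (simp add: combine_def eta_inf Let_def)
  have X: "?X \<in> N \<rightarrow>\<^sub>M borel_vec ?d \<Otimes>\<^sub>M borel_vec ?d"
    using N.indep_var_rv1[OF rho_eta_indep] N.indep_var_rv2[OF rho_eta_indep] by simp
  have X': "?X' \<in> split_space \<rightarrow>\<^sub>M borel_vec ?d \<Otimes>\<^sub>M borel_vec ?d"
    using split_space.indep_var_rv1[OF split_space_rho_eta(1)] split_space.indep_var_rv2[OF
        split_space_rho_eta(1)] by simp
  have law: "distr N (borel_vec ?d \<Otimes>\<^sub>M borel_vec ?d) ?X = distr split_space (borel_vec ?d \<Otimes>\<^sub>M borel_vec ?d) ?X'"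
  proof -
    have "distr split_space (borel_vec ?d \<Otimes>\<^sub>M borel_vec ?d) ?X' =
       distr split_space (borel_vec ?d) (\<lambda>\<omega>. rvec ?d (\<lambda>j. ?\<rho>' j \<omega>)) \<Otimes>\<^sub>M (\<Pi>\<^sub>M j\<in>{1..?d}. eta_infty_law)"
      by (rule joint_law[OF split_space.prob_space_axioms split_space_rho_eta distr_eta_limit_append]) simp
    moreover have "distr split_space (borel_vec ?d) (\<lambda>\<omega>. rvec ?d (\<lambda>j. ?\<rho>' j \<omega>)) =
        distr N (borel_vec ?d) (\<lambda>\<omega>. rvec ?d (\<lambda>j. \<rho> j \<omega>))"
      unfolding rho_law distr_rho_rep[OF xi] using distr_rho_rep[OF indep_uniform_split_space] by simp
    ultimately show ?thesis
      using joint_law[OF N rho_eta_indep eta_indep eta_law] by simp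
  qed
  have Tn: "(\<lambda>\<omega>. silhouette_vector k (T n \<omega>)) \<in> M \<rightarrow>\<^sub>M borel_vec (2 ^ k + 1)" if "n \<ge> 1" for n
    by (rule measurable_compose[OF bst_sequence_law(1)[OF bst that]])
      (use stack_extensional in \<open>auto simp: silhouette_vector_def space_PiM PiE_def\<close>)
  have Z: "?Z \<in> N \<rightarrow>\<^sub>M borel_vec (2 ^ k + 1)"
    unfolding Z_eq by (rule measurable_compose[OF X measurable_combine])
  have conv: "(\<lambda>n. LINT \<omega>|M. g (silhouette_vector k (T n \<omega>))) \<longlonglongrightarrow> (LINT \<omega>|N. g (?Z \<omega>))"
    if g: "continuous_map (powertop_real {1..2 ^ k + 1}) euclideanreal g"
      and bounded: "bounded (g ` topspace (powertop_real {1..2 ^ k + 1}))" for g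
  proof -
    note gm = borel_measurable_powertop_real[OF g]
    have gc: "(\<lambda>z. g (combine k (fst z) (snd z))) \<in> borel_measurable (borel_vec ?d \<Otimes>\<^sub>M borel_vec ?d)"
      by (rule measurable_compose[OF measurable_combine gm])
    have "(LINT \<omega>|N. g (?Z \<omega>)) = (LINT z|distr N (borel_vec ?d \<Otimes>\<^sub>M borel_vec ?d) ?X. g (combine k (fst z) (snd z)))"
      unfolding Z_eq by (rule integral_distr[OF X gc, symmetric])
    also have "\<dots> = (LINT \<omega>|split_space. g (combine k (fst (?X' \<omega>)) (snd (?X' \<omega>))))"
      unfolding law by (rule integral_distr[OF X' gc])
    also have "\<dots> = (LINT \<omega>|split_space. g (limit_vector k \<omega>))"
    proof (rule integral_cong_AE)
      show "(\<lambda>\<omega>. g (combine k (fst (?X' \<omega>)) (snd (?X' \<omega>)))) \<in> borel_measurable split_space"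
        by (rule measurable_compose[OF X' gc])
      show "(\<lambda>\<omega>. g (limit_vector k \<omega>)) \<in> borel_measurable split_space"
        by (rule measurable_compose[OF measurable_limit_vector gm])
      show "AE \<omega> in split_space. g (combine k (fst (?X' \<omega>)) (snd (?X' \<omega>))) = g (limit_vector k \<omega>)"
        using AE_limit_vector_eq_combine[of k]
        by eventually_elim (simp only: fst_conv snd_conv combine_rvec)
    qed
    finally have lim: "(LINT \<omega>|N. g (?Z \<omega>)) = (LINT \<omega>|split_space. g (limit_vector k \<omega>))" .
    have eq: "(LINT \<omega>|M. g (silhouette_vector k (T n \<omega>))) = (LINT \<omega>|split_space. g (silhouette_vector k
        (random_tree n \<omega>)))"
      if n: "n \<ge> 1" for n
    proof -
      note Tl = bst_sequence_law[OF bst n]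
      have "(LINT \<omega>|M. g (silhouette_vector k (T n \<omega>))) = (LINT t|distr M tree_space (T n). g (silhouette_vector k t))"
        by (rule integral_distr[OF Tl(1), symmetric]) simp
      also have "\<dots> = (LINT \<omega>|split_space. g (silhouette_vector k (random_tree n \<omega>)))"
        unfolding Tl(2) by (rule integral_distr[OF measurable_random_tree]) simp
      finally show ?thesis .
    qed
    have "\<forall>\<^sub>F n in sequentially. (LINT \<omega>|split_space. g (silhouette_vector k (random_tree n \<omega>))) = (LINT \<omega>|M.
        g (silhouette_vector k (T n \<omega>)))"
      by (rule eventually_sequentiallyI[of 1]) (simp add: eq)
    from Lim_transform_eventually[OF expectation_silhouette_vector_tendsto[OF g bounded] this]
    show ?thesis unfolding lim .
  qed
  show ?thesis
    unfolding conv_in_distr_def silhouette_vector_def[symmetric] using Tn Z conv by blast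
qed

end
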